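(* There exists a finite tile set $T$ such that for every integer $k \geq 7$ there exists a nondecreasing temperature function $\tau_k:\mathbb{N}\to\mathbb{N}$ for which the size-dependent system $(T,\tau_k)$ self-assembles a $k \times 3$ rectangle.
   Context: Size-dependent two-handed tile assembly model. A tile type is a quadruple $(g_N,g_E,g_S,g_W)$ of glues from an alphabet $\Sigma$, each glue $g$ having a non-negative integer strength $\mathrm{str}(g)$. A tile is a unit square centered at a point of $\mathbb{Z}^2$ labeled by a tile type; two tiles are adjacent if their centers are at distance 1. An assembly is a partial map $\alpha:\mathbb{Z}^2\to T$ with finite domain $\mathrm{dom}(\alpha)$. Two adjacent tiles form a bond if the glues on their abutting edges are equal and of positive strength; the strength of the bond is that glue's strength. The bond graph of $\alpha$ has vertex set $\mathrm{dom}(\alpha)$ and an edge for each bond. A cut of an assembly is an edge cut of its bond graph (a partition of $\mathrm{dom}(\alpha)$ into two nonempty parts), and its strength is the total strength of bonds crossing it. A supertile $\tilde\alpha$ is the equivalence class of an assembly under translation; its size $|\tilde\alpha|$ is the number of tiles of an assembly in it. A size-dependent system is a pair $(T,\tau)$ with $T$ a finite tile set and $\tau:\mathbb{N}\to\mathbb{N}$ a nondecreasing temperature function. An assembly $\gamma$ is $\tau$-stable if every cut partitioning $\mathrm{dom}(\gamma)$ into parts $\alpha,\beta$ has strength at least $\tau(\min(|\alpha|,|\beta|))$. Two supertiles $\tilde\alpha,\tilde\beta$ can combine into $\tilde\gamma$ if there are disjoint assemblies $\alpha\in\tilde\alpha$, $\beta\in\tilde\beta$ with $\alpha\cup\beta=\gamma\in\tilde\gamma$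 and the cut separating $\mathrm{dom}(\alpha)$ from $\mathrm{dom}(\beta)$ has strength at least $\tau(\min(|\alpha|,|\beta|))$. A supertile $\tilde\gamma$ can break into $\tilde\alpha,\tilde\beta$ if there are disjoint assemblies $\alpha\in\tilde\alpha,\beta\in\tilde\beta$ with connected bond graphs, $\alpha\cup\beta=\gamma\in\tilde\gamma$, and the cut separating them has strength less than $\tau(\min(|\alpha|,|\beta|))$. A supertile is producible if it is a single tile of a type in $T$, a combination of two producible supertiles, or a result of a break of a producible supertile. A producible supertile is terminal if it can combine with no producible supertile and cannot break. The system self-assembles a shape $P\subseteq\mathbb{Z}^2$ if every terminal supertile has an assembly whose domain is exactly $P$ (and, implicitly, a terminal supertile exists). A $w\times h$ rectangle is a set $\{x+1,\dots,x+w\}\times\{y+1,\dots,y+h\}$ for some integers $x,y$. *)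

theory Defs
  imports Main
begin

text \<open>Size-dependent two-handed tile assembly model.
  Glues are drawn from the countable alphabet nat; a tile type is a quadruple
  (g_N, g_E, g_S, g_W) of glues; a glue strength function str assigns each glue
  a natural-number strength.  An assembly is a partial map from Z^2 to tile types.\<close>

type_synonym tile = "nat \<times> nat \<times> nat \<times> nat"
type_synonym assembly = "int \<times> int \<Rightarrow> tile option"

definition glueN :: "tile \<Rightarrow> nat" where "glueN t = fst t"
definition glueE :: "tile \<Rightarrow> nat" where "glueE t = fst (snd t)"
definition glueS :: "tile \<Rightarrow> nat" where "glueS t = fst (snd (snd t))"
definition glueW :: "tile \<Rightarrow> nat" where "glueW t = snd (snd (snd t))"

text \<open>Strength of the bond between the tiles at positions p and q (0 if there is no bond).\<close>
definition bond_str :: "(nat \<Rightarrow> nat) \<Rightarrow> assembly \<Rightarrow> int \<times> int \<Rightarrow> int \<times> int \<Rightarrow> nat" where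
  "bond_str str \<alpha> p q =
    (case (\<alpha> p, \<alpha> q) of
      (Some s, Some t) \<Rightarrow>
        (if q = (fst p + 1, snd p) \<and> glueE s = glueW t \<and> 0 < str (glueE s) then str (glueE s)
         else if q = (fst p - 1, snd p) \<and> glueW s = glueE t \<and> 0 < str (glueW s) then str (glueW s)
         else if q = (fst p, snd p + 1) \<and> glueN s = glueS t \<and> 0 < str (glueN s) then str (glueN s)
         else if q = (fst p, snd p - 1) \<and> glueS s = glueN t \<and> 0 < str (glueS s) then str (glueS s)
         else 0)
    | _ \<Rightarrow> 0)"

definition bonded :: "(nat \<Rightarrow> nat) \<Rightarrow> assembly \<Rightarrow> int \<times> int \<Rightarrow> int \<times> int \<Rightarrow> bool" where
  "bonded str \<alpha> p q \<longleftrightarrow> 0 < bond_str str \<alpha> p q"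

text \<open>Strength of the cut separating A from B: total strength of bonds crossing it.\<close>
definition cut_str :: "(nat \<Rightarrow> nat) \<Rightarrow> assembly \<Rightarrow> (int \<times> int) set \<Rightarrow> (int \<times> int) set \<Rightarrow> nat" where
  "cut_str str \<alpha> A B = (\<Sum>(p, q) \<in> A \<times> B. bond_str str \<alpha> p q)"

text \<open>The bond graph of the assembly is connected.\<close>
definition bond_connected :: "(nat \<Rightarrow> nat) \<Rightarrow> assembly \<Rightarrow> bool" where
  "bond_connected str \<alpha> \<longleftrightarrow>
     (\<forall>p \<in> dom \<alpha>. \<forall>q \<in> dom \<alpha>. (p, q) \<in> {(a, b). bonded str \<alpha> a b}\<^sup>*)"

definition translate :: "int \<times> int \<Rightarrow> assembly \<Rightarrow> assembly" where
  "translate v \<alpha> = (\<lambda>p. \<alpha> (fst p - fst v, snd p - snd v))"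

text \<open>Assemblies alpha and beta (representatives of two supertiles) combine into gamma.\<close>
definition can_combine :: "(nat \<Rightarrow> nat) \<Rightarrow> (nat \<Rightarrow> nat) \<Rightarrow> assembly \<Rightarrow> assembly \<Rightarrow> assembly \<Rightarrow> bool" where
  "can_combine str \<tau> \<alpha> \<beta> \<gamma> \<longleftrightarrow>
     dom \<alpha> \<inter> dom \<beta> = {} \<and> \<gamma> = \<alpha> ++ \<beta> \<and>
     \<tau> (min (card (dom \<alpha>)) (card (dom \<beta>))) \<le> cut_str str \<gamma> (dom \<alpha>) (dom \<beta>)"

text \<open>Assembly gamma can break into alpha and beta.\<close>
definition can_break :: "(nat \<Rightarrow> nat) \<Rightarrow> (nat \<Rightarrow> nat) \<Rightarrow> assembly \<Rightarrow> assembly \<Rightarrow> assembly \<Rightarrow> bool" where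
  "can_break str \<tau> \<gamma> \<alpha> \<beta> \<longleftrightarrow>
     dom \<alpha> \<noteq> {} \<and> dom \<beta> \<noteq> {} \<and> dom \<alpha> \<inter> dom \<beta> = {} \<and> \<gamma> = \<alpha> ++ \<beta> \<and>
     bond_connected str \<alpha> \<and> bond_connected str \<beta> \<and>
     cut_str str \<gamma> (dom \<alpha>) (dom \<beta>) < \<tau> (min (card (dom \<alpha>)) (card (dom \<beta>)))"

text \<open>Producible assemblies: the assemblies belonging to producible supertiles
  (the set is closed under translation).\<close>
inductive producible :: "(nat \<Rightarrow> nat) \<Rightarrow> tile set \<Rightarrow> (nat \<Rightarrow> nat) \<Rightarrow> assembly \<Rightarrow> bool"
  for str :: "nat \<Rightarrow> nat" and T :: "tile set" and \<tau> :: "nat \<Rightarrow> nat" where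
  single: "t \<in> T \<Longrightarrow> producible str T \<tau> [p \<mapsto> t]"
| transl: "producible str T \<tau> \<alpha> \<Longrightarrow> producible str T \<tau> (translate v \<alpha>)"
| comb: "producible str T \<tau> \<alpha> \<Longrightarrow> producible str T \<tau> \<beta> \<Longrightarrow> can_combine str \<tau> \<alpha> \<beta> \<gamma>
          \<Longrightarrow> producible str T \<tau> \<gamma>"
| brk1: "producible str T \<tau> \<gamma> \<Longrightarrow> can_break str \<tau> \<gamma> \<alpha> \<beta> \<Longrightarrow> producible str T \<tau> \<alpha>"
| brk2: "producible str T \<tau> \<gamma> \<Longrightarrow> can_break str \<tau> \<gamma> \<alpha> \<beta> \<Longrightarrow> producible str T \<tau> \<beta>"

text \<open>Terminal: producible, combines with no producible supertile, cannot break
  (quantifying over all representatives of the supertile of gamma).\<close>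
definition terminal :: "(nat \<Rightarrow> nat) \<Rightarrow> tile set \<Rightarrow> (nat \<Rightarrow> nat) \<Rightarrow> assembly \<Rightarrow> bool" where
  "terminal str T \<tau> \<gamma> \<longleftrightarrow>
     producible str T \<tau> \<gamma> \<and>
     (\<forall>v \<beta> \<delta>. producible str T \<tau> \<beta> \<longrightarrow> \<not> can_combine str \<tau> (translate v \<gamma>) \<beta> \<delta>) \<and>
     (\<forall>v \<alpha> \<beta>. \<not> can_break str \<tau> (translate v \<gamma>) \<alpha> \<beta>)"

definition self_assembles :: "(nat \<Rightarrow> nat) \<Rightarrow> tile set \<Rightarrow> (nat \<Rightarrow> nat) \<Rightarrow> (int \<times> int) set \<Rightarrow> bool" where
  "self_assembles str T \<tau> P \<longleftrightarrow>
     (\<exists>\<gamma>. terminal str T \<tau> \<gamma>) \<and>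
     (\<forall>\<gamma>. terminal str T \<tau> \<gamma> \<longrightarrow> (\<exists>v. dom (translate v \<gamma>) = P))"

definition rectangle :: "int \<Rightarrow> int \<Rightarrow> nat \<Rightarrow> nat \<Rightarrow> (int \<times> int) set" where
  "rectangle x y w h = {x + 1 .. x + int w} \<times> {y + 1 .. y + int h}"

end

theory Submission
  imports Defs "HOL-Library.Product_Plus"
begin

text \<open>
  A rectangle of height 3 and width \<open>j\<close> is covered by a snake, a boustrophedon Hamiltonian path
  whose bonds all have strength 3 and which is closed at both ends. The top tiles of its first and last column,
  the anchors, additionally carry on their north side a glue of strength 2, too weak to bind alone.
  A second family of tiles forms canopies, boustrophedon paths of height 4
  that grow without end in both directions and carry the matching glue under each bottom tile.

  Take \<open>\<tau> n = 3\<close> for \<open>n \<le> 3k/2\<close>, \<open>\<tau> n = 4\<close> for \<open>3k/2 < n \<le> 3k - 3\<close> and \<open>\<tau> n = 5\<close> beyond.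
  A complete snake of width \<open>j > k\<close> breaks in the middle, where the cut has strength 3. One of width \<open>j < k\<close>
  binds with both anchors, hence with strength 4, to a long enough canopy. For \<open>j = k\<close> no break is possible, and any
  assembly touching both anchors contains the piece of a canopy between them, which has at least
  \<open>4k - 6 \<ge> 3k - 2\<close> tiles, so that strength 5 would be required.

  The invariant behind this is that a producible assembly is either a segment of a snake or a single
  segment of a canopy with snakes hanging from it by both anchors. Assemblies with a canopy are
  never terminal, since a canopy can always be extended, and neither are incomplete snakes.
\<close>

section \<open>The boustrophedon path\<close>

text \<open>The tile set is fixed while k varies, so no tile can know k: every width from 2 on has
  its complete snake, and only the temperature tells widths apart. A nondecreasing temperature can
  by itself destroy only large assemblies, since the parts of a small one face a lower threshold.
  The canopies are there to keep the short snakes from being terminal; they have no ends, so that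
  they are never terminal themselves. Height 4 is the least that works: between bottom tiles k - 1
  columns apart, a path of height h may have as few as h(k - 2) + 2 tiles, and for h = 3 this is 3k
  - 4, short of the required 3k - 2. The strengths 3 and 2 separate the cases by their sums. One
  anchor bond stays below every temperature, one path bond suffices to add a single tile, and two
  anchor bonds give 4. An anchor bond and a path bond together give 5, the highest temperature, so
  that no break crosses both. This limits the ways in which a composite can fall apart.\<close>

definition cell :: "int \<Rightarrow> int \<Rightarrow> int \<times> int" where
  "cell h i = (i div h, if even (i div h) then - (i mod h) else i mod h - (h - 1))"

text \<open>Inverse of \<open>cell\<close> on the \<open>h\<close> rows of the path. Off these rows
  the value is meaningless, which is why \<open>track\<close> tests the round trip.\<close>

definition cell_index :: "int \<Rightarrow> int \<times> int \<Rightarrow> int" where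
  "cell_index h p = h * fst p + (if even (fst p) then - snd p else snd p + (h - 1))"

definition step :: "int \<Rightarrow> int \<Rightarrow> int \<times> int" where
  "step h i = cell h (i + 1) - cell h i"

lemma cell_index_cell [simp]: "cell_index h (cell h i) = i"
  by (simp add: cell_index_def cell_def)

lemma cell_eq_iff [simp]: "cell h i = cell h j \<longleftrightarrow> i = j"
  by (metis cell_index_cell)

lemma cell_cell_index:
  assumes "0 < h" "- h < snd p" "snd p \<le> 0"
  shows "cell h (cell_index h p) = p"
proof -
  obtain x y where p: "p = (x, y)" by fastforce
  define r where "r = (if even x then - y else y + (h - 1))"
  have r: "0 \<le> r" "r < h" using assms by (auto simp: r_def p)
  have o: "cell_index h p = r + h * x" by (simp add: cell_index_def p r_def)
  have "cell_index h p div h = x" "cell_index h p mod h = r"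
    using r assms(1) unfolding o by auto
  then show ?thesis by (auto simp: cell_def p r_def)
qed

lemma cell_row: assumes "0 < h" shows "- h < snd (cell h i)" "snd (cell h i) \<le> 0"
  using assms pos_mod_bound[of h i] pos_mod_sign[of h i] by (auto simp: cell_def)

text \<open>A downward and an upward column together form one period of the path. Hence directions,
  glues and tiles are governed by the index modulo \<open>2 * h\<close>, that is 6 for snakes and 8
  for canopies.\<close>

lemma cell_period: assumes "0 < h" shows "cell h (i + 2 * h * m) = cell h i + (2 * m, 0)"
proof -
  have e: "i + 2 * h * m = i + 2 * m * h" by simp
  have "(i + 2 * h * m) div h = i div h + 2 * m" "(i + 2 * h * m) mod h = i mod h"
    unfolding e using assms div_mult_self1[of h i "2 * m"] mod_mult_self1[of i "2 * m" h]
    by linarith+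
  then show ?thesis by (simp add: cell_def)
qed

lemma step_eq:
  assumes "0 < h"
  shows "step h i = (if i mod h = h - 1 then (1, 0) else if even (i div h) then (0, -1) else (0, 1))"
proof -
  define c r where "c = i div h" and "r = i mod h"
  have i: "i = h * c + r" "0 \<le> r" "r < h" using assms by (auto simp: c_def r_def)
  show ?thesis
  proof (cases "r = h - 1")
    case True
    then have e: "i + 1 = h * (c + 1)" by (simp add: i algebra_simps)
    have "(i + 1) div h = c + 1" "(i + 1) mod h = 0"
      unfolding e using assms by auto
    then show ?thesis
      using True by (simp add: step_def cell_def c_def[symmetric] r_def[symmetric])
  next
    case False
    have e: "i + 1 = (r + 1) + h * c" by (simp add: i)
    have "(i + 1) div h = c" "(i + 1) mod h = r + 1"
      unfolding e using i(2,3) False assms by auto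
    then show ?thesis
      using False by (simp add: step_def cell_def c_def[symmetric] r_def[symmetric])
  qed
qed

lemma step_unit: "0 < h \<Longrightarrow> step h i \<in> {(1, 0), (0, 1), (0, -1)}"
  by (simp add: step_eq)

lemma step_period: "0 < h \<Longrightarrow> step h (i + 2 * h * m) = step h i"
  using cell_period[of h i m] cell_period[of h "i + 1" m] by (simp add: step_def algebra_simps)

text \<open>The path is injective, so it never turns straight back. The entry and the exit of a tile
  therefore lie on different sides and their glues cannot clash.\<close>

lemma step_not_back: "step h i \<noteq> - step h (i - 1)"
proof
  assume "step h i = - step h (i - 1)"
  then have "cell h (i + 1) = cell h (i - 1)" by (simp add: step_def)
  then show False by simp
qed

lemma cell_Suc: "cell h (i + 1) = cell h i + step h i"
  by (simp add: step_def)

section \<open>Glues and bonds\<close>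

text \<open>With a tile read as a function of the direction, the four cases of
  \<open>bond_str\<close> collapse into the single formula of \<open>bond_eq\<close>.\<close>

definition glue :: "tile \<Rightarrow> int \<times> int \<Rightarrow> nat" where
  "glue t d = (if d = (1, 0) then glueE t else if d = (-1, 0) then glueW t
     else if d = (0, 1) then glueN t else if d = (0, -1) then glueS t else 0)"

definition tile_of_glues :: "(int \<times> int \<Rightarrow> nat) \<Rightarrow> tile" where
  "tile_of_glues f = (f (0, 1), f (1, 0), f (0, -1), f (-1, 0))"

lemma glue_tile_of_glues:
  "(\<And>d. d \<notin> {(1, 0), (-1, 0), (0, 1), (0, -1)} \<Longrightarrow> f d = 0) \<Longrightarrow> glue (tile_of_glues f) d = f d"
  by (auto simp: glue_def tile_of_glues_def glueE_def glueW_def glueN_def glueS_def)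

text \<open>Glue 0 is the null glue, glue 1 the anchor glue, and all others are path glues.\<close>

definition strength :: "nat \<Rightarrow> nat" where
  "strength g = (if g = 0 then 0 else if g = 1 then 2 else 3)"

abbreviation bond :: "assembly \<Rightarrow> int \<times> int \<Rightarrow> int \<times> int \<Rightarrow> nat" where
  "bond \<equiv> bond_str strength"

abbreviation cut :: "assembly \<Rightarrow> (int \<times> int) set \<Rightarrow> (int \<times> int) set \<Rightarrow> nat" where
  "cut \<equiv> cut_str strength"

lemma bond_eq:
  "bond \<alpha> p q = (case (\<alpha> p, \<alpha> q) of
     (Some s, Some t) \<Rightarrow> if glue s (q - p) = glue t (p - q) then strength (glue s (q - p)) else 0
   | _ \<Rightarrow> 0)"
proof -
  define d where "d = q - p"
  have d: "q = (fst p + 1, snd p) \<longleftrightarrow> d = (1, 0)" "q = (fst p - 1, snd p) \<longleftrightarrow> d = (-1, 0)"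
    "q = (fst p, snd p + 1) \<longleftrightarrow> d = (0, 1)" "q = (fst p, snd p - 1) \<longleftrightarrow> d = (0, -1)"
    by (cases p; cases q; auto simp: d_def)+
  have pq: "p - q = - d" by (simp add: d_def)
  have "bond \<alpha> p q = (if glue s d = glue t (- d) then strength (glue s d) else 0)"
    if "\<alpha> p = Some s" "\<alpha> q = Some t" for s t
  proof -
    consider "d = (1, 0)" | "d = (-1, 0)" | "d = (0, 1)" | "d = (0, -1)"
      | "d \<notin> {(1, 0), (-1, 0), (0, 1), (0, -1)}" by blast
    then show ?thesis
    proof cases
      \<comment> \<open>For cells that are not adjacent \<open>glue\<close> returns 0, whose
        strength is 0, so the uniform formula needs no test of adjacency.\<close>
      case 5
      then show ?thesis using that by (simp add: bond_str_def glue_def strength_def d)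
    qed (use that in \<open>simp_all add: bond_str_def glue_def strength_def d\<close>)
  qed
  then show ?thesis
    by (auto simp: bond_str_def pq d_def[symmetric] split: option.splits)
qed

lemma bond_Some:
  "\<alpha> p = Some s \<Longrightarrow> \<alpha> q = Some t \<Longrightarrow>
   bond \<alpha> p q = (if glue s (q - p) = glue t (p - q) then strength (glue s (q - p)) else 0)"
  by (simp add: bond_eq)

lemma bond_sym: "bond \<alpha> p q = bond \<alpha> q p"
  by (auto simp: bond_eq split: option.splits)

lemma bond_posE:
  assumes "0 < bond \<alpha> p q"
  obtains s t where "\<alpha> p = Some s" "\<alpha> q = Some t" "glue s (q - p) = glue t (p - q)" "0 < glue s (q - p)"
    "bond \<alpha> p q = strength (glue s (q - p))"
  using assms by (auto simp: bond_eq strength_def split: option.splits if_splits)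

lemma cut_commute: "cut \<gamma> A B = cut \<gamma> B A"
proof -
  have "cut \<gamma> A B = (\<Sum>p\<in>A. \<Sum>q\<in>B. bond \<gamma> p q)"
    by (simp add: cut_str_def sum.cartesian_product)
  also have "\<dots> = (\<Sum>q\<in>B. \<Sum>p\<in>A. bond \<gamma> p q)" by (rule sum.swap)
  also have "\<dots> = (\<Sum>q\<in>B. \<Sum>p\<in>A. bond \<gamma> q p)" by (simp add: bond_sym)
  also have "\<dots> = cut \<gamma> B A" by (simp add: cut_str_def sum.cartesian_product)
  finally show ?thesis .
qed

lemma cut_ge_sum:
  assumes "finite A" "finite B" "F \<subseteq> A \<times> B"
  shows "(\<Sum>(p, q)\<in>F. bond \<gamma> p q) \<le> cut \<gamma> A B"
  unfolding cut_str_def by (rule sum_mono2) (use assms in auto)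

lemma cut_ge_bond:
  assumes "finite A" "finite B" "p \<in> A" "q \<in> B"
  shows "bond \<gamma> p q \<le> cut \<gamma> A B"
  using cut_ge_sum[of A B "{(p, q)}" \<gamma>] assms by simp

text \<open>The orientation of both edges is left open, because in the applications it is only known
  that their endpoints lie on different sides.\<close>

lemma cut_ge_two:
  assumes "finite A" "finite B" "A \<inter> B = {}"
    and "p \<in> A \<and> q \<in> B \<or> p \<in> B \<and> q \<in> A"
    and "p' \<in> A \<and> q' \<in> B \<or> p' \<in> B \<and> q' \<in> A"
    and "{p, q} \<noteq> {p', q'}"
  shows "bond \<gamma> p q + bond \<gamma> p' q' \<le> cut \<gamma> A B"
proof -
  have *: "bond \<gamma> p q + bond \<gamma> p' q' \<le> cut \<gamma> A B"
    if "p \<in> A" "q \<in> B" "p' \<in> A" "q' \<in> B" "{p, q} \<noteq> {p', q'}" for p q p' q'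
  proof -
    have "(p, q) \<noteq> (p', q')" using that(5) by auto
    then show ?thesis
      using cut_ge_sum[of A B "{(p, q), (p', q')}" \<gamma>] that(1-4) assms(1,2) by simp
  qed
  show ?thesis
    using assms(4-6) *[of p q p' q'] *[of q p p' q'] *[of p q q' p'] *[of q p q' p']
    unfolding insert_commute[of q p] insert_commute[of q' p'] bond_sym[of \<gamma> q p] bond_sym[of \<gamma> q' p']
    by metis
qed

lemma cut_le:
  assumes "finite A" "finite B" "finite F"
    and "\<And>p q. p \<in> A \<Longrightarrow> q \<in> B \<Longrightarrow> 0 < bond \<gamma> p q \<Longrightarrow> (p, q) \<in> F \<and> bond \<gamma> p q \<le> c"
  shows "cut \<gamma> A B \<le> c * card F"
proof -
  let ?S = "{x \<in> A \<times> B. 0 < bond \<gamma> (fst x) (snd x)}"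
  have "cut \<gamma> A B = (\<Sum>x\<in>?S. bond \<gamma> (fst x) (snd x))"
    unfolding cut_str_def case_prod_unfold
    by (rule sum.mono_neutral_right) (use assms in auto)
  also have "\<dots> \<le> of_nat (card ?S) * c"
    by (rule sum_bounded_above) (use assms(4) in auto)
  also have "\<dots> \<le> card F * c"
    using card_mono[of F ?S] assms(3,4) by fastforce
  finally show ?thesis by (simp add: mult.commute)
qed

text \<open>A cut stronger than any single crossing bond has two crossing bonds. With
  \<open>c\<close> = 2 this yields both anchors of a snake at once.\<close>

lemma cut_gt_imp_two:
  assumes "finite A" "finite B" "c < cut \<gamma> A B"
    and "\<And>p q. p \<in> A \<Longrightarrow> q \<in> B \<Longrightarrow> bond \<gamma> p q \<le> c"
  obtains p q p' q' where "p \<in> A" "q \<in> B" "p' \<in> A" "q' \<in> B" "(p, q) \<noteq> (p', q')"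
    "0 < bond \<gamma> p q" "0 < bond \<gamma> p' q'"
proof (rule ccontr)
  assume neg: "\<not> thesis"
  have "\<exists>x. \<forall>p q. p \<in> A \<longrightarrow> q \<in> B \<longrightarrow> 0 < bond \<gamma> p q \<longrightarrow> (p, q) = x"
    using neg that by metis
  then obtain x where "\<And>p q. p \<in> A \<Longrightarrow> q \<in> B \<Longrightarrow> 0 < bond \<gamma> p q \<Longrightarrow> (p, q) = x" by blast
  then have "cut \<gamma> A B \<le> c * card {x}"
    by (intro cut_le) (use assms in auto)
  then show False using assms(3) by simp
qed

lemma cut_pos_imp:
  assumes "0 < cut \<gamma> A B"
  obtains p q where "p \<in> A" "q \<in> B" "0 < bond \<gamma> p q"
  using assms sum.neutral[of "A \<times> B" "\<lambda>(p, q). bond \<gamma> p q"] unfolding cut_str_def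
  by fastforce

lemma map_add_disjoint_Some_iff:
  "dom \<alpha> \<inter> dom \<beta> = {} \<Longrightarrow> (\<alpha> ++ \<beta>) p = Some t \<longleftrightarrow> \<alpha> p = Some t \<or> \<beta> p = Some t"
  by (auto simp: map_add_Some_iff)

lemma map_eqI: "(\<And>p t. f p = Some t \<longleftrightarrow> g p = Some t) \<Longrightarrow> f = g"
  by (rule ext) (metis not_None_eq)

lemma can_break_commute:
  "can_break str \<tau> \<gamma> \<alpha> \<beta> \<Longrightarrow> str = strength \<Longrightarrow> can_break str \<tau> \<gamma> \<beta> \<alpha>"
  by (auto simp: can_break_def cut_commute[of _ "dom \<beta>"] min.commute map_add_comm Int_commute)

section \<open>Tracks\<close>

text \<open>Common form of snakes and canopies. Cutting, appending and translating become arithmetic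
  on \<open>a\<close>, \<open>b\<close> and \<open>v\<close>.\<close>

definition track :: "int \<Rightarrow> (int \<Rightarrow> tile) \<Rightarrow> int \<times> int \<Rightarrow> int \<Rightarrow> int \<Rightarrow> assembly" where
  "track h f v a b p = (let i = cell_index h (p - v) in
     if v + cell h i = p \<and> a \<le> i \<and> i \<le> b then Some (f i) else None)"

lemma track_Some:
  "track h f v a b p = Some t \<longleftrightarrow> (\<exists>i. a \<le> i \<and> i \<le> b \<and> p = v + cell h i \<and> t = f i)"
  by (auto simp: track_def Let_def)

lemma dom_track: "dom (track h f v a b) = (\<lambda>i. v + cell h i) ` {a..b}"
proof (intro set_eqI iffI)
  fix p assume "p \<in> dom (track h f v a b)"
  then obtain t where "track h f v a b p = Some t" by blast
  then show "p \<in> (\<lambda>i. v + cell h i) ` {a..b}" unfolding track_Some by auto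
next
  fix p assume "p \<in> (\<lambda>i. v + cell h i) ` {a..b}"
  then obtain i where "track h f v a b p = Some (f i)" unfolding track_Some by auto
  then show "p \<in> dom (track h f v a b)" by blast
qed

lemma finite_dom_track [simp]: "finite (dom (track h f v a b))"
  by (simp add: dom_track)

lemma card_dom_track: "card (dom (track h f v a b)) = nat (b - a + 1)"
  unfolding dom_track by (subst card_image) (auto simp: inj_on_def)

lemma track_cell: "a \<le> i \<Longrightarrow> i \<le> b \<Longrightarrow> track h f v a b (v + cell h i) = Some (f i)"
  by (auto simp: track_Some)

lemma cell_in_dom_track: "v + cell h i \<in> dom (track h f v a b) \<longleftrightarrow> a \<le> i \<and> i \<le> b"
  by (auto simp: dom_track)

lemma translate_eq: "translate v \<alpha> p = \<alpha> (p - v)"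
  by (cases p; cases v) (simp add: translate_def)

lemma translate_track: "translate u (track h f v a b) = track h f (v + u) a b"
  by (rule map_eqI) (auto simp: translate_eq track_Some algebra_simps)

lemma translate_0 [simp]: "translate 0 \<alpha> = \<alpha>"
  by (rule ext) (simp add: translate_eq)

lemma track_disjoint: "b < c \<Longrightarrow> dom (track h f v a b) \<inter> dom (track h f v c d) = {}"
  by (auto simp: dom_track)

lemma track_append:
  assumes "a \<le> b + 1" "b \<le> c"
  shows "track h f v a b ++ track h f v (b + 1) c = track h f v a c"
proof (rule map_eqI)
  fix p t
  have "a \<le> i \<and> i \<le> c \<longleftrightarrow> a \<le> i \<and> i \<le> b \<or> b + 1 \<le> i \<and> i \<le> c" for i
    using assms by auto
  then show "(track h f v a b ++ track h f v (b + 1) c) p = Some t \<longleftrightarrow> track h f v a c p = Some t"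
    unfolding map_add_disjoint_Some_iff[OF track_disjoint[of b "b + 1", simplified]] track_Some by blast
qed

lemma track_single: "track h f v i i = [v + cell h i \<mapsto> f i]"
  by (rule map_eqI) (auto simp: track_Some)

definition linked :: "int \<Rightarrow> (int \<Rightarrow> tile) \<Rightarrow> int \<Rightarrow> int \<Rightarrow> bool" where
  "linked h f a b \<longleftrightarrow> (\<forall>i. a \<le> i \<longrightarrow> i < b \<longrightarrow>
     glue (f i) (step h i) = glue (f (i + 1)) (- step h i) \<and> strength (glue (f i) (step h i)) = 3)"

lemma linked_bond:
  assumes "linked h f a b" "a \<le> i" "i < b"
    and "\<alpha> (v + cell h i) = Some (f i)" "\<alpha> (v + cell h (i + 1)) = Some (f (i + 1))"
  shows "bond \<alpha> (v + cell h i) (v + cell h (i + 1)) = 3"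
proof -
  have "v + cell h (i + 1) - (v + cell h i) = step h i"
    "v + cell h i - (v + cell h (i + 1)) = - step h i" by (simp_all add: cell_Suc)
  moreover have "glue (f i) (step h i) = glue (f (i + 1)) (- step h i) \<and> strength (glue (f i) (step h i)) = 3"
    using assms(1-3) unfolding linked_def by blast
  ultimately show ?thesis
    using bond_Some[of \<alpha> "v + cell h i" "f i" "v + cell h (i + 1)" "f (i + 1)", OF assms(4,5)]
    by metis
qed

lemma linked_mono: "linked h f a b \<Longrightarrow> a \<le> a' \<Longrightarrow> b' \<le> b \<Longrightarrow> linked h f a' b'"
  unfolding linked_def by (meson order.strict_trans2 order.trans)

lemma track_connected:
  assumes "linked h f a b"
  shows "bond_connected strength (track h f v a b)"
proof -
  let ?\<alpha> = "track h f v a b" and ?c = "\<lambda>i. v + cell h i"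
  let ?R = "{(p, q). bonded strength ?\<alpha> p q}"
  have "(?c a, ?c i) \<in> ?R\<^sup>*" if "a \<le> i" "i \<le> b" for i
    using that
  proof (induction i rule: int_ge_induct)
    case (step i)
    have "bond ?\<alpha> (?c i) (?c (i + 1)) = 3"
      using assms step by (intro linked_bond) (auto simp: track_cell)
    then have "(?c i, ?c (i + 1)) \<in> ?R" by (simp add: bonded_def)
    then show ?case using step by (auto intro: rtrancl_into_rtrancl)
  qed simp
  then have "(?c a, p) \<in> ?R\<^sup>*" if "p \<in> dom ?\<alpha>" for p
    using that by (auto simp: dom_track)
  moreover have "sym (?R\<^sup>*)"
    by (rule sym_rtrancl) (auto simp: sym_def bonded_def bond_sym)
  ultimately show ?thesis
    unfolding bond_connected_def by (meson rtrancl_trans symD)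
qed

text \<open>The path is grown one tile at a time, so the smaller part always has size 1 and only
  \<open>\<tau> 1\<close> matters, however high the temperature is for larger sizes.\<close>

lemma track_producible:
  assumes "linked h f a b" "\<tau> 1 \<le> 3" "a \<le> b" "\<And>i. a \<le> i \<Longrightarrow> i \<le> b \<Longrightarrow> f i \<in> T"
  shows "producible strength T \<tau> (track h f v a b)"
proof -
  have "producible strength T \<tau> (track h f v a c)" if "a \<le> c" "c \<le> b" for c
    using that
  proof (induction c rule: int_ge_induct)
    case base
    show ?case
      unfolding track_single using assms(3,4) by (intro producible.single) simp
  next
    case (step c)
    let ?\<alpha> = "track h f v a c" and ?\<beta> = "track h f v (c + 1) (c + 1)"
      and ?\<gamma> = "track h f v a (c + 1)"
    have eq: "?\<alpha> ++ ?\<beta> = ?\<gamma>" using step by (intro track_append) auto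
    have m: "min (card (dom ?\<alpha>)) (card (dom ?\<beta>)) = 1"
      using step by (simp add: card_dom_track)
    have "bond ?\<gamma> (v + cell h c) (v + cell h (c + 1)) = 3"
      using step assms(1) by (intro linked_bond[of h f a b]) (auto simp: track_cell)
    then have "3 \<le> cut ?\<gamma> (dom ?\<alpha>) (dom ?\<beta>)"
      using cut_ge_bond[of "dom ?\<alpha>" "dom ?\<beta>" "v + cell h c" "v + cell h (c + 1)" ?\<gamma>] step
      by (simp add: cell_in_dom_track)
    then have "can_combine strength \<tau> ?\<alpha> ?\<beta> ?\<gamma>"
      using assms(2) eq track_disjoint[of c "c + 1" h f v a "c + 1"] m unfolding can_combine_def
      by simp
    moreover have "producible strength T \<tau> ?\<beta>"
      unfolding track_single using step assms(4) by (intro producible.single) simp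
    ultimately show ?case using step by (auto intro: producible.comb)
  qed
  then show ?thesis using assms(3) by simp
qed

text \<open>A predicate that changes only once along an interval is a threshold. Applied to
  membership in one side of a weak cut, it shows that the cut splits a path into two
  segments.\<close>

lemma unique_crossing:
  fixes a b :: int
  assumes "a \<le> i" "i \<le> b" "P i \<noteq> P a"
    and uniq: "\<And>i j. a \<le> i \<Longrightarrow> i < b \<Longrightarrow> a \<le> j \<Longrightarrow> j < b \<Longrightarrow> P i \<noteq> P (i + 1) \<Longrightarrow> P j \<noteq> P (j + 1) \<Longrightarrow> i = j"
  obtains c where "a \<le> c" "c < b" "P c \<noteq> P (c + 1)"
    "\<And>i. a \<le> i \<Longrightarrow> i \<le> c \<Longrightarrow> P i = P a" "\<And>i. c < i \<Longrightarrow> i \<le> b \<Longrightarrow> P i \<noteq> P a"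
proof -
  have const: "P y = P x" if "x \<le> y" "\<And>j. x \<le> j \<Longrightarrow> j < y \<Longrightarrow> P j = P (j + 1)" for x y
    using that
  proof (induction y rule: int_ge_induct)
    case (step y)
    then have "P y = P x" "P y = P (y + 1)" by simp_all
    then show ?case by metis
  qed simp
  have "\<exists>c. a \<le> c \<and> c < i \<and> P c \<noteq> P (c + 1)"
    using const[OF assms(1)] assms(3) by blast
  then obtain c where c: "a \<le> c" "c < b" "P c \<noteq> P (c + 1)"
    using assms(2) by (meson order.strict_trans2)
  have other: "P j = P (j + 1)" if "a \<le> j" "j < b" "j \<noteq> c" for j
    using uniq[OF c(1,2) that(1,2) c(3)] that(3) by blast
  have pre: "P j = P a" if "a \<le> j" "j \<le> c" for j
    by (rule const[OF that(1)], rule other) (use that c in linarith)+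
  have post: "P j = P (c + 1)" if "c < j" "j \<le> b" for j
    by (rule const, use that in linarith, rule other) (use that c in linarith)+
  show thesis
  proof (rule that[OF c])
    show "P j = P a" if "a \<le> j" "j \<le> c" for j by (rule pre[OF that])
    show "P j \<noteq> P a" if "c < j" "j \<le> b" for j
      using post[OF that] pre[OF c(1) order_refl] c(3) by metis
  qed
qed

section \<open>The tile set\<close>

text \<open>The cells of a snake are numbered from 0 to \<open>e\<close>, where \<open>e + 1\<close> is three times the width.
  If the width is odd, so that \<open>e\<close> is even, the last column is traversed downwards and its top
  cell is not the end of the path; its two inner bonds then get private glues (9 and 10), so that
  nothing but this column can follow its top tile. The glue 1 is the anchor glue.\<close>

definition valid_end :: "int \<Rightarrow> bool" where
  "valid_end e \<longleftrightarrow> 2 < e \<and> e mod 3 = 2"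

definition anchor :: "int \<Rightarrow> int" where
  "anchor e = (if even e then e - 2 else e)"

text \<open>The residue modulo 6 determines the direction of the step, so equal links always point
  the same way. The generic links are the glues 2 to 7.\<close>

definition snake_link :: "int \<Rightarrow> int \<Rightarrow> nat" where
  "snake_link e i = (if even e \<and> e - 2 \<le> i then (if i = e - 2 then 9 else 10) else nat (2 + i mod 6))"

text \<open>Tile 0 has no entry and tile \<open>e\<close> no exit, which closes the path at both
  ends. The anchor glue comes last in the case distinction; \<open>snake_glue_top\<close> checks
  that no link takes its place.\<close>

definition snake_glue :: "int \<Rightarrow> int \<Rightarrow> int \<times> int \<Rightarrow> nat" where
  "snake_glue e i d = (if i < e \<and> d = step 3 i then snake_link e i
     else if 0 < i \<and> d = - step 3 (i - 1) then snake_link e (i - 1)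
     else if d = (0, 1) \<and> (i = 0 \<or> i = anchor e) then 1 else 0)"

definition snake_tile :: "int \<Rightarrow> int \<Rightarrow> tile" where
  "snake_tile e i = tile_of_glues (snake_glue e i)"

text \<open>The offset 12 keeps these glues apart from those of the snakes, so that the two families
  share only the glue 1.\<close>

definition canopy_link :: "int \<Rightarrow> nat" where
  "canopy_link i = nat (12 + i mod 8)"

definition canopy_glue :: "int \<Rightarrow> int \<times> int \<Rightarrow> nat" where
  "canopy_glue i d = (if d = step 4 i then canopy_link i
     else if d = - step 4 (i - 1) then canopy_link (i - 1)
     else if d = (0, -1) \<and> snd (cell 4 i) = -3 then 1 else 0)"

definition canopy_tile :: "int \<Rightarrow> tile" where
  "canopy_tile i = tile_of_glues (canopy_glue i)"

definition tiles :: "tile set" where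
  "tiles = {snake_tile e i | e i. valid_end e \<and> 0 \<le> i \<and> i \<le> e} \<union> range canopy_tile"

abbreviation snake :: "int \<times> int \<Rightarrow> int \<Rightarrow> int \<Rightarrow> int \<Rightarrow> assembly" where
  "snake v e a b \<equiv> track 3 (snake_tile e) v a b"

abbreviation canopy :: "int \<times> int \<Rightarrow> int \<Rightarrow> int \<Rightarrow> assembly" where
  "canopy v a b \<equiv> track 4 canopy_tile v a b"

lemma glue_snake_tile: "glue (snake_tile e i) d = snake_glue e i d"
  unfolding snake_tile_def
proof (rule glue_tile_of_glues)
  fix d :: "int \<times> int" assume "d \<notin> {(1, 0), (-1, 0), (0, 1), (0, -1)}"
  then show "snake_glue e i d = 0"
    using step_unit[of 3 i] step_unit[of 3 "i - 1"] by (auto simp: snake_glue_def)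
qed

lemma glue_canopy_tile: "glue (canopy_tile i) d = canopy_glue i d"
  unfolding canopy_tile_def
proof (rule glue_tile_of_glues)
  fix d :: "int \<times> int" assume "d \<notin> {(1, 0), (-1, 0), (0, 1), (0, -1)}"
  then show "canopy_glue i d = 0"
    using step_unit[of 4 i] step_unit[of 4 "i - 1"] by (auto simp: canopy_glue_def)
qed

lemma step_3: "step 3 i = (if i mod 3 = 2 then (1, 0) else if i mod 6 < 3 then (0, -1) else (0, 1))"
proof -
  have "even (i div 3) \<longleftrightarrow> i mod 6 < 3" by presburger
  then show ?thesis by (simp add: step_eq)
qed

lemma step_4: "step 4 i = (if i mod 4 = 3 then (1, 0) else if i mod 8 < 4 then (0, -1) else (0, 1))"
proof -
  have "even (i div 4) \<longleftrightarrow> i mod 8 < 4" by presburger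
  then show ?thesis by (simp add: step_eq)
qed

lemma canopy_bottom_iff: "snd (cell 4 i) = -3 \<longleftrightarrow> i mod 8 = 3 \<or> i mod 8 = 4"
proof -
  have "even (i div 4) \<longleftrightarrow> i mod 8 < 4" by presburger
  then show ?thesis by (auto simp: cell_def) presburger+
qed

lemma valid_end_mod: "valid_end e \<Longrightarrow> e mod 6 = (if even e then 2 else 5)"
  unfolding valid_end_def by presburger

lemma snake_link_bounds: "1 < snake_link e i" "snake_link e i \<le> 10"
  by (auto simp: snake_link_def nat_le_iff)

lemma canopy_link_bounds: "11 < canopy_link i" "canopy_link i < 20"
  by (auto simp: canopy_link_def)

lemma snake_glue_out: "i < e \<Longrightarrow> snake_glue e i (step 3 i) = snake_link e i"
  by (simp add: snake_glue_def)

lemma snake_glue_in: "0 < i \<Longrightarrow> snake_glue e i (- step 3 (i - 1)) = snake_link e (i - 1)"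
  using step_not_back[of 3 i] by (simp add: snake_glue_def)

lemma canopy_glue_out: "canopy_glue i (step 4 i) = canopy_link i"
  by (simp add: canopy_glue_def)

lemma canopy_glue_in: "canopy_glue i (- step 4 (i - 1)) = canopy_link (i - 1)"
  using step_not_back[of 4 i] by (simp add: canopy_glue_def)

text \<open>The first tile is left downwards. The second anchor is the top of the last column: for
  even \<open>e\<close> it is entered from the west and left downwards, for odd \<open>e\<close> it
  is entered from below and is the end. In each case the north side is free.\<close>

lemma snake_glue_top:
  assumes "valid_end e" "i = 0 \<or> i = anchor e"
  shows "snake_glue e i (0, 1) = 1"
proof -
  have "i = 0 \<or> i = e - 2 \<and> e mod 6 = 2 \<or> i = e \<and> e mod 6 = 5"
    using assms(2) valid_end_mod[OF assms(1)] by (auto simp: anchor_def split: if_splits)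
  then have "i mod 6 = 0 \<or> i = e \<and> i mod 6 = 5" by presburger
  then consider "i mod 6 = 0" | "i = e" "i mod 6 = 5" by blast
  then have "(0, 1) \<noteq> - step 3 (i - 1) \<and> (i < e \<longrightarrow> (0, 1) \<noteq> step 3 i)"
  proof cases
    case 1
    then have "(i - 1) mod 3 = 2" "i mod 3 \<noteq> 2" by presburger+
    then show ?thesis using 1 by (simp add: step_3)
  next
    case 2
    then have "(i - 1) mod 3 \<noteq> 2" "\<not> (i - 1) mod 6 < 3" by presburger+
    then show ?thesis using 2 by (simp add: step_3)
  qed
  then show ?thesis using assms(2) by (auto simp: snake_glue_def)
qed

text \<open>A bottom tile with residue 3 is entered from above and left eastwards, one with residue
  4 is entered from the west and left upwards. The south side is free in both cases.\<close>

lemma canopy_glue_bottom: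
  assumes "snd (cell 4 i) = -3"
  shows "canopy_glue i (0, -1) = 1"
proof -
  consider "i mod 8 = 3" | "i mod 8 = 4" using assms canopy_bottom_iff by blast
  then have "(0, -1) \<noteq> step 4 i" "(0, -1) \<noteq> - step 4 (i - 1)"
  proof (atomize (full), cases)
    case 1
    then have "i mod 4 = 3" "(i - 1) mod 4 \<noteq> 3" "(i - 1) mod 8 < 4" by presburger+
    then show "(0, -1) \<noteq> step 4 i \<and> (0, -1) \<noteq> - step 4 (i - 1)" by (simp add: step_4)
  next
    case 2
    then have "i mod 4 \<noteq> 3" "\<not> i mod 8 < 4" "(i - 1) mod 4 = 3" by presburger+
    then show "(0, -1) \<noteq> step 4 i \<and> (0, -1) \<noteq> - step 4 (i - 1)" by (simp add: step_4)
  qed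
  then show ?thesis using assms by (simp add: canopy_glue_def)
qed

lemma snake_glue_cases:
  assumes "0 < snake_glue e i d"
  obtains (out) "i < e" "d = step 3 i" "snake_glue e i d = snake_link e i"
  | (inn) "0 < i" "d = - step 3 (i - 1)" "snake_glue e i d = snake_link e (i - 1)"
  | (top) "d = (0, 1)" "i = 0 \<or> i = anchor e" "snake_glue e i d = 1"
  using assms by (auto simp: snake_glue_def split: if_splits)

lemma canopy_glue_cases:
  assumes "0 < canopy_glue i d"
  obtains (out) "d = step 4 i" "canopy_glue i d = canopy_link i"
  | (inn) "d = - step 4 (i - 1)" "canopy_glue i d = canopy_link (i - 1)"
  | (bot) "d = (0, -1)" "snd (cell 4 i) = -3" "canopy_glue i d = 1"
  using assms by (auto simp: canopy_glue_def split: if_splits)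

lemma strength_link: "strength (snake_link e i) = 3" "strength (canopy_link i) = 3"
  using snake_link_bounds(1)[of e i] canopy_link_bounds(1)[of i] by (simp_all add: strength_def)

lemma linked_snake: "linked 3 (snake_tile e) 0 e"
  unfolding linked_def
proof (intro allI impI)
  fix i assume "0 \<le> i" "i < e"
  then show "glue (snake_tile e i) (step 3 i) = glue (snake_tile e (i + 1)) (- step 3 i) \<and> strength (glue (snake_tile e i) (step 3 i)) = 3"
    using snake_glue_out[of i e] snake_glue_in[of "i + 1" e] by (simp add: glue_snake_tile strength_link)
qed

lemma linked_canopy: "linked 4 canopy_tile a b"
  unfolding linked_def
proof (intro allI impI)
  fix i
  show "glue (canopy_tile i) (step 4 i) = glue (canopy_tile (i + 1)) (- step 4 i) \<and> strength (glue (canopy_tile i) (step 4 i)) = 3"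
    using canopy_glue_out[of i] canopy_glue_in[of "i + 1"] by (simp add: glue_canopy_tile strength_link)
qed

lemma mod_eq_shift:
  fixes i j m :: int
  assumes "i mod m = j mod m"
  obtains k where "i = j + m * k"
proof
  show "i = j + m * (i div m - j div m)"
    using mult_div_mod_eq[of m i] mult_div_mod_eq[of m j] assms unfolding right_diff_distrib by linarith
qed

lemma step_mod_cong:
  assumes "0 < h" "i mod (2 * h) = j mod (2 * h)"
  shows "step h i = step h j"
  using mod_eq_shift[OF assms(2)] step_period[OF assms(1)] by metis

text \<open>A private link determines the distance to the end of the path. As every even end is 2
  modulo 6, it determines the phase too.\<close>

lemma snake_link_eqD:
  assumes "valid_end e" "valid_end e'" "i < e" "i' < e'" "snake_link e i = snake_link e' i'"
  shows "i mod 6 = i' mod 6"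
    and "even e \<and> e - 2 \<le> i \<longleftrightarrow> even e' \<and> e' - 2 \<le> i'"
    and "even e \<Longrightarrow> e - 2 \<le> i \<Longrightarrow> e - i = e' - i'"
proof -
  have b: "nat (2 + j mod 6) \<le> 7" "0 \<le> j mod 6" for j :: int by (simp_all add: nat_le_iff)
  show t: "even e \<and> e - 2 \<le> i \<longleftrightarrow> even e' \<and> e' - 2 \<le> i'"
    using assms(5) b(1)[of i] b(1)[of i'] by (auto simp: snake_link_def split: if_splits)
  show d: "e - i = e' - i'" if "even e" "e - 2 \<le> i"
    using that t assms(3-5) by (auto simp: snake_link_def split: if_splits)
  show "i mod 6 = i' mod 6"
  proof (cases "even e \<and> e - 2 \<le> i")
    case True
    then have "e mod 6 = 2" "e' mod 6 = 2" using t valid_end_mod assms(1,2) by auto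
    then obtain k where "e = e' + 6 * k" using mod_eq_shift[of e 6 e'] by auto
    then have "i = i' + 6 * k" using d True by auto
    then show ?thesis by simp
  next
    case False
    then have "nat (2 + i mod 6) = nat (2 + i' mod 6)"
      using t assms(5) by (auto simp: snake_link_def split: if_splits)
    then show ?thesis using b(2)[of i] b(2)[of i'] by simp
  qed
qed

lemma canopy_link_eqD: "canopy_link i = canopy_link j \<Longrightarrow> i mod 8 = j mod 8"
  using pos_mod_sign[of 8 i] pos_mod_sign[of 8 j] by (simp add: canopy_link_def eq_nat_nat_iff)

lemma step_neq_neg: "0 < h \<Longrightarrow> step h i \<noteq> - step h i"
  using step_unit[of h i] by auto

text \<open>Two exits or two entries never match: equal links have equal steps, while the tiles face
  each other in opposite directions. Two anchor glues would both face north. What remains is an exit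
  meeting an entry.\<close>

lemma snake_snake_bond:
  assumes "valid_end e" "valid_end e'" "glue (snake_tile e i) d = glue (snake_tile e' i') (- d)" "0 < glue (snake_tile e i) d"
    and "i \<le> e" "i' \<le> e'"
  shows "(i < e \<and> 0 < i' \<and> d = step 3 i \<and> snake_link e i = snake_link e' (i' - 1)) \<or>
         (i' < e' \<and> 0 < i \<and> - d = step 3 i' \<and> snake_link e' i' = snake_link e (i - 1))"
proof -
  have eq: "snake_glue e i d = snake_glue e' i' (- d)" and p: "0 < snake_glue e i d" and p': "0 < snake_glue e' i' (- d)"
    using assms(3,4) by (simp_all add: glue_snake_tile)
  have same: "step 3 x = step 3 y" if "snake_link e x = snake_link e' y" "x < e" "y < e'" for x y
    using snake_link_eqD(1)[OF assms(1,2) that(2,3,1)] step_mod_cong[of 3 x y] by simp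
  from p show ?thesis
  proof (cases rule: snake_glue_cases)
    case out
    from p' show ?thesis
    proof (cases rule: snake_glue_cases)
      case out': out
      then have "snake_link e i = snake_link e' i'" using out eq by simp
      then show ?thesis using same[of i i'] out out' step_neq_neg[of 3 i] by simp
    next
      case inn
      then show ?thesis using out eq by simp
    next
      case top
      then show ?thesis using out eq snake_link_bounds(1)[of e i] by simp
    qed
  next
    case inn
    from p' show ?thesis
    proof (cases rule: snake_glue_cases)
      case out
      then show ?thesis using inn eq by simp
    next
      case inn': inn
      then have "snake_link e (i - 1) = snake_link e' (i' - 1)" using inn eq by simp
      then show ?thesis
        using same[of "i - 1" "i' - 1"] inn inn' step_neq_neg[of 3 "i - 1"] assms(5,6) by simp
    next
      case top
      then show ?thesis using inn eq snake_link_bounds(1)[of e "i - 1"] by simp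
    qed
  next
    case top
    from p' show ?thesis
    proof (cases rule: snake_glue_cases)
      case out
      then show ?thesis using top eq snake_link_bounds(1)[of e' i'] by simp
    next
      case inn
      then show ?thesis using top eq snake_link_bounds(1)[of e' "i' - 1"] by simp
    next
      case top': top
      then show ?thesis using top by simp
    qed
  qed
qed

text \<open>The path glues of the two families lie in disjoint ranges, so only the anchor glue can
  match.\<close>

lemma snake_canopy_bond:
  assumes "glue (snake_tile e i) d = glue (canopy_tile j) (- d)" "0 < glue (snake_tile e i) d"
  shows "d = (0, 1) \<and> (i = 0 \<or> i = anchor e) \<and> snd (cell 4 j) = -3 \<and> glue (snake_tile e i) d = 1"
  using assms(2)[unfolded glue_snake_tile]
proof (cases rule: snake_glue_cases)
  case top
  then have "0 < canopy_glue j (- d)" using assms by (simp add: glue_snake_tile glue_canopy_tile)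
  then show ?thesis using top assms canopy_link_bounds(1)[of j] canopy_link_bounds(1)[of "j - 1"]
    by (cases rule: canopy_glue_cases) (auto simp: glue_snake_tile glue_canopy_tile)
next
  case out
  then have "0 < canopy_glue j (- d)" using assms by (simp add: glue_snake_tile glue_canopy_tile)
  then show ?thesis using out assms canopy_link_bounds(1)[of j] canopy_link_bounds(1)[of "j - 1"] snake_link_bounds[of e i]
    by (cases rule: canopy_glue_cases) (auto simp: glue_snake_tile glue_canopy_tile)
next
  case inn
  then have "0 < canopy_glue j (- d)" using assms by (simp add: glue_snake_tile glue_canopy_tile)
  then show ?thesis using inn assms canopy_link_bounds(1)[of j] canopy_link_bounds(1)[of "j - 1"] snake_link_bounds[of e "i - 1"]
    by (cases rule: canopy_glue_cases) (auto simp: glue_snake_tile glue_canopy_tile)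
qed

lemma canopy_canopy_bond:
  assumes "glue (canopy_tile i) d = glue (canopy_tile j) (- d)" "0 < glue (canopy_tile i) d"
  shows "(d = step 4 i \<and> canopy_link i = canopy_link (j - 1)) \<or> (- d = step 4 j \<and> canopy_link j = canopy_link (i - 1))"
proof -
  have eq: "canopy_glue i d = canopy_glue j (- d)" and p: "0 < canopy_glue i d" and p': "0 < canopy_glue j (- d)"
    using assms by (simp_all add: glue_canopy_tile)
  have same: "step 4 x = step 4 y" if "canopy_link x = canopy_link y" for x y
    using canopy_link_eqD[OF that] step_mod_cong[of 4 x y] by simp
  from p show ?thesis
  proof (cases rule: canopy_glue_cases)
    case out
    from p' show ?thesis
    proof (cases rule: canopy_glue_cases)
      case out': out
      then have "canopy_link i = canopy_link j" using out eq by simp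
      then show ?thesis using same[of i j] out out' step_neq_neg[of 4 i] by simp
    next
      case inn
      then show ?thesis using out eq by simp
    next
      case bot
      then show ?thesis using out eq canopy_link_bounds(1)[of i] by simp
    qed
  next
    case inn
    from p' show ?thesis
    proof (cases rule: canopy_glue_cases)
      case out
      then show ?thesis using inn eq by simp
    next
      case inn': inn
      then have "canopy_link (i - 1) = canopy_link (j - 1)" using inn eq by simp
      then show ?thesis
        using same[of "i - 1" "j - 1"] inn inn' step_neq_neg[of 4 "i - 1"] by simp
    next
      case bot
      then show ?thesis using inn eq canopy_link_bounds(1)[of "i - 1"] by simp
    qed
  next
    case bot
    from p' show ?thesis
    proof (cases rule: canopy_glue_cases)
      case out
      then show ?thesis using bot eq canopy_link_bounds(1)[of j] by simp
    next
      case inn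
      then show ?thesis using bot eq canopy_link_bounds(1)[of "j - 1"] by simp
    next
      case bot': bot
      then show ?thesis using bot by simp
    qed
  qed
qed

text \<open>The parameters \<open>e\<close> and \<open>i\<close> range over infinite sets, but all
  glues are at most 20.\<close>

lemma finite_tiles: "finite tiles"
proof -
  have "snake_glue e i d \<le> 20" for e i d
    using snake_link_bounds(2)[of e i] snake_link_bounds(2)[of e "i - 1"] by (auto simp: snake_glue_def)
  moreover have "canopy_glue i d \<le> 20" for i d
    using canopy_link_bounds(2)[of i] canopy_link_bounds(2)[of "i - 1"] by (auto simp: canopy_glue_def)
  ultimately have "tiles \<subseteq> {..20} \<times> {..20} \<times> {..20} \<times> {..20}"
    by (auto simp: tiles_def snake_tile_def canopy_tile_def tile_of_glues_def)
  then show ?thesis by (rule finite_subset) auto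
qed

section \<open>Concatenation\<close>

lemma snake_link_shift:
  assumes "s mod 6 = 0"
  shows "snake_link (e + s) (i + s) = snake_link e i"
proof -
  obtain k where "s = 6 * k" using assms by auto
  then have "even s" "(i + s) mod 6 = i mod 6" by simp_all
  then show ?thesis by (simp add: snake_link_def)
qed

text \<open>Away from the start a tile depends only on the phase modulo 6 of its index and of the
  end, and on the distance between them. Index 0 is excluded because the first tile lacks an entry
  and carries an anchor glue.\<close>

lemma snake_tile_shift:
  assumes "s mod 6 = 0" "0 < i" "0 < i + s"
  shows "snake_tile (e + s) (i + s) = snake_tile e i"
proof -
  obtain k where k: "s = 6 * k" using assms(1) by auto
  have eq: "i + s - 1 = i - 1 + 6 * k" by (simp add: k)
  have "(i + s) mod 6 = i mod 6" "(i + s - 1) mod 6 = (i - 1) mod 6"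
    unfolding eq unfolding k by (rule mod_mult_self2)+
  then have "step 3 (i + s) = step 3 i" "step 3 (i + s - 1) = step 3 (i - 1)"
    by (auto intro!: step_mod_cong)
  moreover have "i + s = anchor (e + s) \<longleftrightarrow> i = anchor e"
    by (auto simp: anchor_def k)
  moreover have "i + s < e + s \<longleftrightarrow> i < e" "0 < i + s \<longleftrightarrow> 0 < i" "i + s = 0 \<longleftrightarrow> i = 0"
    using assms(2,3) by auto
  moreover have "snake_link (e + s) (i + s) = snake_link e i" "snake_link (e + s) (i + s - 1) = snake_link e (i - 1)"
    using snake_link_shift[OF assms(1), of e i] snake_link_shift[OF assms(1), of e "i - 1"]
    by (simp_all add: algebra_simps)
  ultimately have "snake_glue (e + s) (i + s) d = snake_glue e i d" for d
    unfolding snake_glue_def by (simp only:)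
  then show ?thesis by (simp add: snake_tile_def tile_of_glues_def)
qed

text \<open>The segments to be joined may come from snakes with different ends. The second one is
  renumbered by \<open>s\<close> to continue the first, which is then reread as part of the snake
  ending in \<open>e' + s\<close>. Before the second anchor this changes no tile, since those tiles
  do not depend on the end; behind it the private links force \<open>e' + s\<close> to be
  \<open>e\<close>.\<close>

lemma snake_tile_concat:
  assumes "valid_end e" "valid_end e'" "0 \<le> b" "b < e" "0 < a'" "a' \<le> e'" "snake_link e b = snake_link e' (a' - 1)"
  defines "s \<equiv> b + 1 - a'"
  shows "s mod 6 = 0" "valid_end (e' + s)" "anchor e \<le> b \<Longrightarrow> e' + s = e"
    "0 \<le> i \<Longrightarrow> i \<le> b \<Longrightarrow> snake_tile (e' + s) i = snake_tile e i"
    "a' \<le> i \<Longrightarrow> snake_tile (e' + s) (i + s) = snake_tile e' i"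
proof -
  have tail: "even e \<and> e - 2 \<le> b \<longleftrightarrow> even e' \<and> e' - 2 \<le> a' - 1"
    and tail_eq: "even e \<Longrightarrow> e - 2 \<le> b \<Longrightarrow> e - b = e' - (a' - 1)"
    and m: "b mod 6 = (a' - 1) mod 6"
    using snake_link_eqD[OF assms(1,2,4) _ assms(7)] assms(6) by auto
  obtain k where "b = a' - 1 + 6 * k" using mod_eq_shift[OF m] .
  then have k: "s = 6 * k" by (simp add: s_def)
  then show s: "s mod 6 = 0" by simp
  show same: "e' + s = e" if "anchor e \<le> b"
    using that tail_eq assms(4) by (auto simp: anchor_def s_def split: if_splits)
  have "e' + s = e' + 3 * (2 * k)" by (simp add: k)
  then have v: "(e' + s) mod 3 = 2" using assms(2) unfolding valid_end_def by (simp only: mod_mult_self2)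
  have lt: "b + 1 \<le> e' + s" using assms(6) by (simp add: s_def)
  have par: "even (e' + s) \<longleftrightarrow> even e'" by (simp add: k)
  show v': "valid_end (e' + s)"
  proof (cases "anchor e \<le> b")
    case True
    then show ?thesis using same assms(1) by simp
  next
    case False
    \<comment> \<open>An end 2 would mean width 1. The junction would then lie before the top of the
      only column, which has index 0, so \<open>b\<close> would be negative.\<close>
    have "e' + s \<noteq> 2"
    proof
      assume "e' + s = 2"
      moreover from this have "even e'" using par by simp
      moreover from this have "a' - 1 < e' - 2" using tail False by (auto simp: anchor_def)
      ultimately show False using assms(3) by (simp add: s_def)
    qed
    moreover have "e' + s \<noteq> 1" using v by auto
    ultimately show ?thesis using v lt assms(3) unfolding valid_end_def by linarith
  qed
  show "snake_tile (e' + s) i = snake_tile e i" if "0 \<le> i" "i \<le> b"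
  proof (cases "anchor e \<le> b")
    case True
    then show ?thesis using same by simp
  next
    case False
    then have "\<not> (even e \<and> e - 2 \<le> b)" by (auto simp: anchor_def)
    then have n: "even e \<Longrightarrow> b < e - 2" "even e' \<Longrightarrow> b < e' + s - 2"
      using tail by (auto simp: s_def)
    have "snake_link (e' + s) j = snake_link e j" if "j \<le> b" for j
      using n that par by (auto simp: snake_link_def)
    moreover have "i \<noteq> anchor e" using False that by simp
    moreover have "i \<noteq> anchor (e' + s)" using n(2) that par lt by (auto simp: anchor_def)
    ultimately have "snake_glue (e' + s) i d = snake_glue e i d" for d
      using that lt assms(4) by (simp add: snake_glue_def)
    then show ?thesis by (simp add: snake_tile_def tile_of_glues_def)
  qed
  show "snake_tile (e' + s) (i + s) = snake_tile e' i" if "a' \<le> i"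
    using snake_tile_shift[OF s, of i e'] that assms(3,5) by (simp add: s_def)
qed

lemma cell_shift:
  assumes "0 < h" "s mod (2 * h) = 0"
  shows "cell h (i + s) - cell h i = cell h (j + s) - cell h j"
proof -
  obtain m where s: "s = 2 * h * m" using assms(2) by auto
  show ?thesis unfolding s cell_period[OF assms(1)] by simp
qed

lemma track_cong:
  assumes "\<And>i. a \<le> i \<Longrightarrow> i \<le> b \<Longrightarrow> f i = g i"
  shows "track h f v a b = track h g v a b"
  by (rule map_eqI) (use assms in \<open>auto simp: track_Some\<close>)

text \<open>Agreement of the positions at one index \<open>i0\<close> suffices: a shift by whole
  periods moves all cells by the same vector.\<close>

lemma track_shift:
  assumes "0 < h" "s mod (2 * h) = 0" "v + cell h (i0 + s) = v' + cell h i0"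
    and "\<And>i. a \<le> i \<Longrightarrow> i \<le> b \<Longrightarrow> f (i + s) = f' i"
  shows "track h f' v' a b = track h f v (a + s) (b + s)"
proof (rule map_eqI)
  fix p t
  have "v + cell h (i + s) = v' + cell h i" for i
  proof -
    have "v = v' + cell h i0 - cell h (i0 + s)" using assms(3) by (metis add_diff_cancel_right')
    moreover have "cell h (i + s) = cell h i + (cell h (i0 + s) - cell h i0)"
      using cell_shift[OF assms(1,2), of i i0] by (metis add.commute diff_add_cancel)
    ultimately show ?thesis by simp
  qed
  note pos = this
  show "track h f' v' a b p = Some t \<longleftrightarrow> track h f v (a + s) (b + s) p = Some t"
  proof
    assume "track h f' v' a b p = Some t"
    then obtain i where "a \<le> i" "i \<le> b" "p = v' + cell h i" "t = f' i" by (auto simp: track_Some)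
    then show "track h f v (a + s) (b + s) p = Some t"
      using pos[of i] assms(4)[of i] by (auto simp: track_Some intro!: exI[of _ "i + s"])
  next
    assume "track h f v (a + s) (b + s) p = Some t"
    then obtain j where "a + s \<le> j" "j \<le> b + s" "p = v + cell h j" "t = f j"
      by (auto simp: track_Some)
    then show "track h f' v' a b p = Some t"
      using pos[of "j - s"] assms(4)[of "j - s"] by (auto simp: track_Some intro!: exI[of _ "j - s"])
  qed
qed

lemma snake_concat:
  assumes "valid_end e" "valid_end e'" "0 \<le> a" "a \<le> b" "b < e" "0 < a'" "a' \<le> b'" "b' \<le> e'"
    and "snake_link e b = snake_link e' (a' - 1)" "v + cell 3 (b + 1) = v' + cell 3 a'"
  defines "s \<equiv> b + 1 - a'"
  shows "snake v e a b ++ snake v' e' a' b' = snake v (e' + s) a (b' + s)"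
proof -
  note c = snake_tile_concat[of e e' b a', folded s_def]
  have "snake v e a b = snake v (e' + s) a b"
    by (rule track_cong) (use c(4) assms in simp)
  moreover have "snake v' e' a' b' = snake v (e' + s) (a' + s) (b' + s)"
    by (rule track_shift[of _ _ _ a']) (use c assms in \<open>auto simp: s_def\<close>)
  moreover have "a' + s = b + 1" by (simp add: s_def)
  ultimately show ?thesis
    using track_append[of a b "b' + s" 3 "snake_tile (e' + s)" v] assms(4,7) by (simp add: s_def)
qed

lemma canopy_tile_shift: "s mod 8 = 0 \<Longrightarrow> canopy_tile (i + s) = canopy_tile i"
proof -
  assume s: "s mod 8 = 0"
  obtain k where k: "s = 8 * k" using s by auto
  have eq: "i + s - 1 = i - 1 + 8 * k" by (simp add: k)
  have m: "(i + s) mod 8 = i mod 8" "(i + s - 1) mod 8 = (i - 1) mod 8"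
    unfolding eq unfolding k by (rule mod_mult_self2)+
  then have "canopy_link (i + s) = canopy_link i" "canopy_link (i + s - 1) = canopy_link (i - 1)"
    by (simp_all add: canopy_link_def)
  moreover from m have "step 4 (i + s) = step 4 i" "step 4 (i + s - 1) = step 4 (i - 1)"
    by (auto intro!: step_mod_cong)
  moreover have "snd (cell 4 (i + s)) = -3 \<longleftrightarrow> snd (cell 4 i) = -3"
    unfolding canopy_bottom_iff m ..
  ultimately have "canopy_glue (i + s) d = canopy_glue i d" for d
    by (simp add: canopy_glue_def)
  then show ?thesis by (simp add: canopy_tile_def tile_of_glues_def)
qed

lemma canopy_concat:
  assumes "a \<le> b" "a' \<le> b'" "canopy_link b = canopy_link (a' - 1)" "v + cell 4 (b + 1) = v' + cell 4 a'"
  defines "s \<equiv> b + 1 - a'"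
  shows "canopy v a b ++ canopy v' a' b' = canopy v a (b' + s)"
proof -
  obtain k where "b = a' - 1 + 8 * k" using mod_eq_shift[OF canopy_link_eqD[OF assms(3)]] .
  then have s: "s mod 8 = 0" by (simp add: s_def)
  have "canopy v' a' b' = canopy v (a' + s) (b' + s)"
    by (rule track_shift[of _ _ _ a']) (use assms s canopy_tile_shift in \<open>auto simp: s_def\<close>)
  moreover have "a' + s = b + 1" by (simp add: s_def)
  ultimately show ?thesis
    using track_append[of a b "b' + s" 4 canopy_tile v] assms(1,2) by (simp add: s_def)
qed

section \<open>The shape of producible assemblies\<close>

text \<open>A triple \<open>(w, e, c)\<close> holds the position of the first tile, the end of the
  complete snake, and the index of the last tile present.\<close>

type_synonym hanger = "(int \<times> int) \<times> int \<times> int"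

definition hung_snake :: "hanger \<Rightarrow> assembly" where
  "hung_snake r = (case r of (w, e, c) \<Rightarrow> snake w e 0 c)"

text \<open>A canopy based at \<open>v\<close> occupies the four rows from \<open>snd v - 3\<close> to \<open>snd v\<close>. A hanging snake need
  not be complete: behind its second anchor up to two tiles may be missing.\<close>

definition hangs :: "int \<times> int \<Rightarrow> int \<Rightarrow> int \<Rightarrow> hanger \<Rightarrow> bool" where
  "hangs v a b r = (case r of (w, e, c) \<Rightarrow> valid_end e \<and> anchor e \<le> c \<and> c \<le> e \<and> snd w = snd v - 4 \<and>
     w + (0, 1) \<in> dom (canopy v a b) \<and> w + cell 3 (anchor e) + (0, 1) \<in> dom (canopy v a b))"

text \<open>Disjointness is demanded only among the snakes. The canopy is disjoint from them because
  it lies in higher rows.\<close>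

definition composite :: "assembly \<Rightarrow> int \<times> int \<Rightarrow> int \<Rightarrow> int \<Rightarrow> hanger set \<Rightarrow> bool" where
  "composite \<gamma> v a b H \<longleftrightarrow> a \<le> b \<and>
     (\<forall>p t. \<gamma> p = Some t \<longleftrightarrow> canopy v a b p = Some t \<or> (\<exists>r\<in>H. hung_snake r p = Some t)) \<and>
     (\<forall>r\<in>H. hangs v a b r) \<and>
     (\<forall>r\<in>H. \<forall>r'\<in>H. r \<noteq> r' \<longrightarrow> dom (hung_snake r) \<inter> dom (hung_snake r') = {})"

definition is_snake :: "assembly \<Rightarrow> bool" where
  "is_snake \<gamma> \<longleftrightarrow> (\<exists>v e a b. valid_end e \<and> 0 \<le> a \<and> a \<le> b \<and> b \<le> e \<and> \<gamma> = snake v e a b)"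

definition is_composite :: "assembly \<Rightarrow> bool" where
  "is_composite \<gamma> \<longleftrightarrow> (\<exists>v a b H. composite \<gamma> v a b H)"

section \<open>Bonds between two pieces\<close>

lemma cell_0 [simp]: "cell 3 0 = 0"
  by (simp add: cell_def zero_prod_def)

text \<open>The condition \<open>2 < e\<close> in \<open>valid_end\<close> excludes width 1, where
  both anchors would be the same tile.\<close>

lemma anchor_bounds: "valid_end e \<Longrightarrow> 0 < anchor e" "anchor e \<le> e"
  by (auto simp: valid_end_def anchor_def)

text \<open>Equal links have equal steps, so a bond fixes the preceding cell as well as the next
  one: around the bond both segments run along the same translated path.\<close>

lemma snake_snake_cross:
  assumes "valid_end e" "valid_end e'" "i \<le> e" "i' \<le> e'"
    and "\<gamma> (v + cell 3 i) = Some (snake_tile e i)" "\<gamma> (v' + cell 3 i') = Some (snake_tile e' i')"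
    and "0 < bond \<gamma> (v + cell 3 i) (v' + cell 3 i')"
  obtains (fwd) "i < e" "0 < i'" "snake_link e i = snake_link e' (i' - 1)"
      "v + cell 3 (i + 1) = v' + cell 3 i'" "v + cell 3 i = v' + cell 3 (i' - 1)"
  | (bwd) "i' < e'" "0 < i" "snake_link e' i' = snake_link e (i - 1)"
      "v' + cell 3 (i' + 1) = v + cell 3 i" "v' + cell 3 i' = v + cell 3 (i - 1)"
proof -
  let ?p = "v + cell 3 i" and ?q = "v' + cell 3 i'"
  define d where "d = ?q - ?p"
  have md: "?p - ?q = - d" and q: "?q = ?p + d" by (simp_all add: d_def)
  have "glue (snake_tile e i) d = glue (snake_tile e' i') (- d)" "0 < glue (snake_tile e i) d"
    using assms(5-7) unfolding md[symmetric] d_def by (auto elim!: bond_posE)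
  from snake_snake_bond[OF assms(1,2) this assms(3,4)] show thesis
  proof
    assume *: "i < e \<and> 0 < i' \<and> d = step 3 i \<and> snake_link e i = snake_link e' (i' - 1)"
    then have "i mod (2 * 3) = (i' - 1) mod (2 * 3)"
      using snake_link_eqD(1)[OF assms(1,2), of i "i' - 1"] assms(4) by simp
    then have "step 3 i = step 3 (i' - 1)" by (intro step_mod_cong) simp_all
    moreover have "?p + step 3 i = v' + (cell 3 (i' - 1) + step 3 (i' - 1))"
      using q * cell_Suc[of 3 "i' - 1"] by simp
    ultimately have "?p = v' + cell 3 (i' - 1)" by (simp add: add.assoc[symmetric])
    moreover have "v + cell 3 (i + 1) = ?q"
      using q * by (simp add: cell_Suc add.assoc)
    ultimately show thesis using fwd * by blast
  next
    assume *: "i' < e' \<and> 0 < i \<and> - d = step 3 i' \<and> snake_link e' i' = snake_link e (i - 1)"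
    then have "i' mod (2 * 3) = (i - 1) mod (2 * 3)"
      using snake_link_eqD(1)[OF assms(2,1), of i' "i - 1"] assms(3) by simp
    then have "step 3 i' = step 3 (i - 1)" by (intro step_mod_cong) simp_all
    moreover have p: "?p = ?q + step 3 i'" using * q by (metis add_diff_cancel_right' diff_conv_add_uminus)
    moreover have "?p = v + (cell 3 (i - 1) + step 3 (i - 1))"
      using cell_Suc[of 3 "i - 1"] by simp
    ultimately have "?q = v + cell 3 (i - 1)" by (metis add.assoc add_right_cancel)
    moreover have "v' + cell 3 (i' + 1) = ?p"
      using p by (simp add: cell_Suc add.assoc)
    ultimately show thesis using bwd * by blast
  qed
qed

lemma canopy_canopy_cross:
  assumes "\<gamma> (v + cell 4 i) = Some (canopy_tile i)" "\<gamma> (v' + cell 4 i') = Some (canopy_tile i')"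
    and "0 < bond \<gamma> (v + cell 4 i) (v' + cell 4 i')"
  obtains (fwd) "canopy_link i = canopy_link (i' - 1)"
      "v + cell 4 (i + 1) = v' + cell 4 i'" "v + cell 4 i = v' + cell 4 (i' - 1)"
  | (bwd) "canopy_link i' = canopy_link (i - 1)"
      "v' + cell 4 (i' + 1) = v + cell 4 i" "v' + cell 4 i' = v + cell 4 (i - 1)"
proof -
  let ?p = "v + cell 4 i" and ?q = "v' + cell 4 i'"
  define d where "d = ?q - ?p"
  have md: "?p - ?q = - d" and q: "?q = ?p + d" by (simp_all add: d_def)
  have "glue (canopy_tile i) d = glue (canopy_tile i') (- d)" "0 < glue (canopy_tile i) d"
    using assms unfolding md[symmetric] d_def by (auto elim!: bond_posE)
  from canopy_canopy_bond[OF this] show thesis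
  proof
    assume *: "d = step 4 i \<and> canopy_link i = canopy_link (i' - 1)"
    then have "step 4 i = step 4 (i' - 1)"
      using canopy_link_eqD[of i "i' - 1"] by (intro step_mod_cong) simp_all
    moreover have "?p + step 4 i = v' + (cell 4 (i' - 1) + step 4 (i' - 1))"
      using q * cell_Suc[of 4 "i' - 1"] by simp
    ultimately have "?p = v' + cell 4 (i' - 1)" by (simp add: add.assoc[symmetric])
    moreover have "v + cell 4 (i + 1) = ?q"
      using q * by (simp add: cell_Suc add.assoc)
    ultimately show thesis using fwd * by blast
  next
    assume *: "- d = step 4 i' \<and> canopy_link i' = canopy_link (i - 1)"
    then have "step 4 i' = step 4 (i - 1)"
      using canopy_link_eqD[of i' "i - 1"] by (intro step_mod_cong) simp_all
    moreover have p: "?p = ?q + step 4 i'" using * q by (metis add_diff_cancel_right' diff_conv_add_uminus)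
    moreover have "?p = v + (cell 4 (i - 1) + step 4 (i - 1))"
      using cell_Suc[of 4 "i - 1"] by simp
    ultimately have "?q = v + cell 4 (i - 1)" by (metis add.assoc add_right_cancel)
    moreover have "v' + cell 4 (i' + 1) = ?p"
      using p by (simp add: cell_Suc add.assoc)
    ultimately show thesis using bwd * by blast
  qed
qed

lemma snake_canopy_cross:
  assumes "\<gamma> (v + cell 3 i) = Some (snake_tile e i)" "\<gamma> (u + cell 4 j) = Some (canopy_tile j)"
    and "0 < bond \<gamma> (v + cell 3 i) (u + cell 4 j)"
  shows "u + cell 4 j = v + cell 3 i + (0, 1)" "i = 0 \<or> i = anchor e" "snd (cell 4 j) = -3"
    "bond \<gamma> (v + cell 3 i) (u + cell 4 j) = 2"
proof -
  let ?p = "v + cell 3 i" and ?q = "u + cell 4 j"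
  define d where "d = ?q - ?p"
  have md: "?p - ?q = - d" and q: "?q = ?p + d" by (simp_all add: d_def)
  have g: "glue (snake_tile e i) d = glue (canopy_tile j) (- d)" "0 < glue (snake_tile e i) d" "bond \<gamma> ?p ?q = strength (glue (snake_tile e i) d)"
    using assms unfolding md[symmetric] d_def by (auto elim!: bond_posE)
  have R: "d = (0, 1)" "i = 0 \<or> i = anchor e" "snd (cell 4 j) = -3" "glue (snake_tile e i) d = 1"
    using snake_canopy_bond[OF g(1,2)] by blast+
  show "?q = ?p + (0, 1)" using q R(1) by simp
  show "i = 0 \<or> i = anchor e" "snd (cell 4 j) = -3" by (fact R)+
  show "bond \<gamma> ?p ?q = 2" using g(3) R(4) by (simp add: strength_def)
qed

text \<open>Otherwise the cell after \<open>i\<close> or the cell before \<open>i'\<close> would be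
  covered by both tracks. Disjoint tracks thus meet only end to start.\<close>

lemma track_ends:
  assumes "dom (track h f v a b) \<inter> dom (track h f' v' a' b') = {}"
    and "a \<le> i" "i \<le> b" "a' \<le> i'" "i' \<le> b'"
    and "v + cell h (i + 1) = v' + cell h i'" "v + cell h i = v' + cell h (i' - 1)"
  shows "i = b \<and> i' = a'"
proof (rule ccontr)
  assume "\<not> (i = b \<and> i' = a')"
  then consider "i + 1 \<le> b" | "a' \<le> i' - 1" using assms by linarith
  then show False
  proof cases
    case 1
    then have "v + cell h (i + 1) \<in> dom (track h f v a b)" "v' + cell h i' \<in> dom (track h f' v' a' b')"
      unfolding cell_in_dom_track using assms(2-5) by simp_all
    then show False using assms(1,6) by auto
  next
    case 2
    then have "v + cell h i \<in> dom (track h f v a b)" "v' + cell h (i' - 1) \<in> dom (track h f' v' a' b')"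
      unfolding cell_in_dom_track using assms(2-5) by simp_all
    then show False using assms(1,7) by auto
  qed
qed

text \<open>The first conclusion excludes bonds between two hanging snakes, as both start at 0. In
  the second, the end is preserved once the second anchor is present, so a hanging snake keeps its
  anchors when it is prolonged.\<close>

lemma snake_join:
  assumes "valid_end e" "valid_end e'" "0 \<le> a" "a \<le> i" "i \<le> b" "b \<le> e" "0 \<le> a'" "a' \<le> i'" "i' \<le> b'" "b' \<le> e'"
    and "dom (snake v e a b) \<inter> dom (snake v' e' a' b') = {}"
    and "i < e" "0 < i'" "snake_link e i = snake_link e' (i' - 1)"
      "v + cell 3 (i + 1) = v' + cell 3 i'" "v + cell 3 i = v' + cell 3 (i' - 1)"
  shows "0 < a'" and "\<exists>e'' b''. valid_end e'' \<and> b < b'' \<and> b'' \<le> e'' \<and> (anchor e \<le> b \<longrightarrow> e'' = e) \<and>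
     snake v e a b ++ snake v' e' a' b' = snake v e'' a b''"
proof -
  have i: "i = b" "i' = a'" using track_ends[OF assms(11,4,5,8,9,15,16)] by auto
  show "0 < a'" using assms(13) i by simp
  define s where "s = b + 1 - a'"
  have l: "snake_link e b = snake_link e' (a' - 1)" "b < e" "0 \<le> b" "0 < a'" "a' \<le> e'" "a' \<le> b'" "a \<le> b"
    "v + cell 3 (b + 1) = v' + cell 3 a'"
    using assms(3-10,12-15) i by auto
  note c = snake_tile_concat[OF assms(1,2) l(3,2,4,5,1), folded s_def]
  have "snake v e a b ++ snake v' e' a' b' = snake v (e' + s) a (b' + s)"
    unfolding s_def by (rule snake_concat[OF assms(1-3) l(7,2,4,6) assms(10) l(1,8)])
  moreover have "b < b' + s" "b' + s \<le> e' + s" using l(6) assms(10) by (simp_all add: s_def)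
  ultimately show "\<exists>e'' b''. valid_end e'' \<and> b < b'' \<and> b'' \<le> e'' \<and> (anchor e \<le> b \<longrightarrow> e'' = e) \<and>
     snake v e a b ++ snake v' e' a' b' = snake v e'' a b''"
    using c(2,3) by blast
qed

section \<open>Closure of the shapes under combination\<close>

lemma map_add_Some_left: "dom \<alpha> \<inter> dom \<beta> = {} \<Longrightarrow> \<alpha> p = Some t \<Longrightarrow> (\<alpha> ++ \<beta>) p = Some t"
  by (simp add: map_add_disjoint_Some_iff)

lemma map_add_Some_right: "\<beta> p = Some t \<Longrightarrow> (\<alpha> ++ \<beta>) p = Some t"
  by simp

lemma is_snake_combine:
  assumes "is_snake \<alpha>" "is_snake \<beta>" "dom \<alpha> \<inter> dom \<beta> = {}" "0 < cut (\<alpha> ++ \<beta>) (dom \<alpha>) (dom \<beta>)"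
  shows "is_snake (\<alpha> ++ \<beta>)"
proof -
  obtain v e a b where R: "valid_end e" "0 \<le> a" "a \<le> b" "b \<le> e" "\<alpha> = snake v e a b"
    using assms(1) by (auto simp: is_snake_def)
  obtain v' e' a' b' where R': "valid_end e'" "0 \<le> a'" "a' \<le> b'" "b' \<le> e'" "\<beta> = snake v' e' a' b'"
    using assms(2) by (auto simp: is_snake_def)
  obtain p q where pq: "p \<in> dom \<alpha>" "q \<in> dom \<beta>" "0 < bond (\<alpha> ++ \<beta>) p q"
    using cut_pos_imp[OF assms(4)] by blast
  obtain i where i: "a \<le> i" "i \<le> b" "p = v + cell 3 i" using pq(1) unfolding R(5) dom_track by auto
  obtain i' where i': "a' \<le> i'" "i' \<le> b'" "q = v' + cell 3 i'" using pq(2) unfolding R'(5) dom_track by auto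
  have g: "(\<alpha> ++ \<beta>) (v + cell 3 i) = Some (snake_tile e i)" "(\<alpha> ++ \<beta>) (v' + cell 3 i') = Some (snake_tile e' i')"
    using i i' by (intro map_add_Some_left[OF assms(3)] map_add_Some_right; simp add: R(5) R'(5) track_cell)+
  have le: "i \<le> e" "i' \<le> e'" using i i' R R' by auto
  show ?thesis
  proof (rule snake_snake_cross[OF R(1) R'(1) le g pq(3)[unfolded i(3) i'(3)]], goal_cases)
    case 1
    from snake_join(2)[OF R(1) R'(1) R(2) i(1,2) R(4) R'(2) i'(1,2) R'(4) assms(3)[unfolded R(5) R'(5)] 1]
    obtain e'' b'' where "valid_end e''" "b < b''" "b'' \<le> e''" "\<alpha> ++ \<beta> = snake v e'' a b''"
      unfolding R(5) R'(5) by blast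
    then show ?thesis using R(2,3) unfolding is_snake_def
      by (intro exI[of _ v] exI[of _ e''] exI[of _ a] exI[of _ b'']) auto
  next
    case 2
    have d: "dom \<beta> \<inter> dom \<alpha> = {}" using assms(3) by blast
    from snake_join(2)[OF R'(1) R(1) R'(2) i'(1,2) R'(4) R(2) i(1,2) R(4) d[unfolded R(5) R'(5)] 2]
    obtain e'' b'' where "valid_end e''" "b' < b''" "b'' \<le> e''" "\<beta> ++ \<alpha> = snake v' e'' a' b''"
      unfolding R(5) R'(5) by blast
    then show ?thesis using R'(2,3) unfolding is_snake_def map_add_comm[OF assms(3)]
      by (intro exI[of _ v'] exI[of _ e''] exI[of _ a'] exI[of _ b'']) auto
  qed
qed

lemma composite_domE:
  assumes "composite \<gamma> v a b H" "p \<in> dom \<gamma>"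
  obtains (G) j where "a \<le> j" "j \<le> b" "p = v + cell 4 j" "\<gamma> p = Some (canopy_tile j)"
  | (H) w e c i where "(w, e, c) \<in> H" "0 \<le> i" "i \<le> c" "p = w + cell 3 i" "\<gamma> p = Some (snake_tile e i)"
proof -
  obtain t where t: "\<gamma> p = Some t" using assms(2) by auto
  then have "canopy v a b p = Some t \<or> (\<exists>r\<in>H. hung_snake r p = Some t)" using assms(1) unfolding composite_def by blast
  then show thesis
  proof
    assume "canopy v a b p = Some t"
    then show thesis using G t by (auto simp: track_Some)
  next
    assume "\<exists>r\<in>H. hung_snake r p = Some t"
    then obtain w e c where "(w, e, c) \<in> H" "snake w e 0 c p = Some t" by (auto simp: hung_snake_def)
    then obtain i where "0 \<le> i" "i \<le> c" "p = w + cell 3 i" "t = snake_tile e i" by (auto simp: track_Some)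
    then show thesis using H \<open>(w, e, c) \<in> H\<close> t by blast
  qed
qed

lemma comp_Some: "composite \<gamma> v a b H \<Longrightarrow>
    \<gamma> p = Some t \<longleftrightarrow> canopy v a b p = Some t \<or> (\<exists>r\<in>H. hung_snake r p = Some t)"
  unfolding composite_def by blast

lemma composite_canopy_tile: "composite \<gamma> v a b H \<Longrightarrow> a \<le> j \<Longrightarrow> j \<le> b \<Longrightarrow> \<gamma> (v + cell 4 j) = Some (canopy_tile j)"
  by (simp add: comp_Some track_cell)

lemma composite_snake_tile: "composite \<gamma> v a b H \<Longrightarrow> (w, e, c) \<in> H \<Longrightarrow> 0 \<le> i \<Longrightarrow> i \<le> c \<Longrightarrow>
    \<gamma> (w + cell 3 i) = Some (snake_tile e i)"
  unfolding comp_Some by (auto simp: hung_snake_def track_cell intro!: bexI[of _ "(w, e, c)"])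

lemma composite_hangs:
  assumes "composite \<gamma> v a b H" "(w, e, c) \<in> H"
  shows "valid_end e" "anchor e \<le> c" "c \<le> e" "snd w = snd v - 4" "w + (0, 1) \<in> dom (canopy v a b)"
    "w + cell 3 (anchor e) + (0, 1) \<in> dom (canopy v a b)"
  using assms by (auto simp: composite_def hangs_def)

lemma composite_dom_canopy: "composite \<gamma> v a b H \<Longrightarrow> dom (canopy v a b) \<subseteq> dom \<gamma>"
  by (auto simp: dom_track composite_canopy_tile)

lemma composite_dom_hung_snake: "composite \<gamma> v a b H \<Longrightarrow> r \<in> H \<Longrightarrow> dom (hung_snake r) \<subseteq> dom \<gamma>"
  unfolding dom_def using comp_Some by fastforce

text \<open>Covers two situations: \<open>H0\<close> is empty when \<alpha> is hung up as a new
  snake, and consists of one incomplete snake when \<alpha> prolongs it.\<close>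

lemma composite_add:
  assumes c: "composite \<beta> v a b H" and "H0 \<subseteq> H" and h: "hangs v a b r"
    and r: "\<And>p t. hung_snake r p = Some t \<longleftrightarrow> \<alpha> p = Some t \<or> (\<exists>r\<in>H0. hung_snake r p = Some t)"
    and d: "dom \<alpha> \<inter> dom \<beta> = {}"
  shows "composite (\<alpha> ++ \<beta>) v a b (insert r (H - H0))"
  unfolding composite_def
proof (intro conjI allI ballI impI)
  show "a \<le> b" using c by (simp add: composite_def)
  show "(\<alpha> ++ \<beta>) p = Some t \<longleftrightarrow> canopy v a b p = Some t \<or> (\<exists>r\<in>insert r (H - H0). hung_snake r p = Some t)" for p t
    unfolding map_add_disjoint_Some_iff[OF d] comp_Some[OF c] using r[of p t] assms(2) by blast
  show "hangs v a b x" if "x \<in> insert r (H - H0)" for x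
    using that h c unfolding composite_def by blast
  have dr: "dom (hung_snake r) \<subseteq> dom \<alpha> \<union> (\<Union>r\<in>H0. dom (hung_snake r))"
  proof
    fix p assume "p \<in> dom (hung_snake r)"
    then obtain t where "hung_snake r p = Some t" by blast
    then show "p \<in> dom \<alpha> \<union> (\<Union>r\<in>H0. dom (hung_snake r))" unfolding r by blast
  qed
  have *: "dom (hung_snake r) \<inter> dom (hung_snake x) = {}" if x: "x \<in> H - H0" for x
  proof -
    have "dom (hung_snake x) \<subseteq> dom \<beta>" using composite_dom_hung_snake[OF c] x by blast
    moreover have "dom (hung_snake y) \<inter> dom (hung_snake x) = {}" if "y \<in> H0" for y
    proof -
      have "y \<in> H" "x \<in> H" "y \<noteq> x" using that x assms(2) by auto
      then show ?thesis using c unfolding composite_def by blast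
    qed
    ultimately show ?thesis using dr d by blast
  qed
  show "dom (hung_snake x) \<inter> dom (hung_snake y) = {}"
    if "x \<in> insert r (H - H0)" "y \<in> insert r (H - H0)" "x \<noteq> y" for x y
  proof (cases "x = r \<or> y = r")
    case True
    then show ?thesis using that *[of x] *[of y] by blast
  next
    case False
    then have "x \<in> H" "y \<in> H" using that by auto
    then show ?thesis using c that(3) unfolding composite_def by blast
  qed
qed

lemma snake_composite_bond:
  assumes R: "\<alpha> = snake v' e' a' b'" and c: "composite \<beta> v a b H" and d: "dom \<alpha> \<inter> dom \<beta> = {}"
    and no: "\<forall>r\<in>H. \<forall>p\<in>dom \<alpha>. \<forall>q\<in>dom (hung_snake r). bond (\<alpha> ++ \<beta>) p q = 0"
    and pq: "p \<in> dom \<alpha>" "q \<in> dom \<beta>" "0 < bond (\<alpha> ++ \<beta>) p q"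
  shows "\<exists>i j. (i = 0 \<or> i = anchor e') \<and> a' \<le> i \<and> i \<le> b' \<and> p = v' + cell 3 i \<and> q = p + (0, 1) \<and>
        q \<in> dom (canopy v a b) \<and> q = v + cell 4 j \<and> snd (cell 4 j) = -3 \<and> bond (\<alpha> ++ \<beta>) p q = 2"
proof -
  let ?\<gamma> = "\<alpha> ++ \<beta>"
  obtain i where i: "a' \<le> i" "i \<le> b'" "p = v' + cell 3 i" using pq(1) unfolding R dom_track by auto
  have \<alpha>: "?\<gamma> (v' + cell 3 i) = Some (snake_tile e' i)"
    using i by (intro map_add_Some_left[OF d]) (simp add: R track_cell)
  have nH: "q \<notin> dom (hung_snake r)" if "r \<in> H" for r
  proof
    assume "q \<in> dom (hung_snake r)"
    then have "bond ?\<gamma> p q = 0" using no that pq(1) by blast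
    then show False using pq(3) by simp
  qed
  have "\<exists>j. a \<le> j \<and> j \<le> b \<and> q = v + cell 4 j"
  proof (rule composite_domE[OF c pq(2)], goal_cases)
    case (1 j)
    then show ?case by blast
  next
    case (2 w e k i)
    then have "q \<in> dom (hung_snake (w, e, k))" by (simp add: hung_snake_def cell_in_dom_track)
    then show ?case using nH 2 by blast
  qed
  then obtain j where j: "a \<le> j" "j \<le> b" "q = v + cell 4 j" by blast
  have g: "?\<gamma> (v + cell 4 j) = Some (canopy_tile j)" using composite_canopy_tile[OF c j(1,2)] by simp
  have qG: "q \<in> dom (canopy v a b)" unfolding j(3) cell_in_dom_track using j by simp
  show ?thesis
    using snake_canopy_cross[OF \<alpha> g pq(3)[unfolded i(3) j(3)]] i j(3) qG by blast
qed

text \<open>One anchor bond has strength 2, so both anchors must be bound. The first anchor has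
  index 0, hence the segment contains the whole path up to the second.\<close>

lemma snake_hangs:
  assumes R: "valid_end e'" "0 \<le> a'" "b' \<le> e'" "\<alpha> = snake v' e' a' b'"
    and c: "composite \<beta> v a b H" and d: "dom \<alpha> \<inter> dom \<beta> = {}" and fin: "finite (dom \<beta>)"
    and no: "\<forall>r\<in>H. \<forall>p\<in>dom \<alpha>. \<forall>q\<in>dom (hung_snake r). bond (\<alpha> ++ \<beta>) p q = 0"
    and cut: "2 < cut (\<alpha> ++ \<beta>) (dom \<alpha>) (dom \<beta>)"
  shows "a' = 0 \<and> hangs v a b (v', e', b')"
proof -
  let ?\<gamma> = "\<alpha> ++ \<beta>"
  note key = snake_composite_bond[OF R(4) c d no]
  have finR: "finite (dom \<alpha>)" by (simp add: R(4))
  have "bond ?\<gamma> p q \<le> 2" if "p \<in> dom \<alpha>" "q \<in> dom \<beta>" for p q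
    using key[OF that] by fastforce
  from cut_gt_imp_two[OF finR fin cut this]
  obtain p q p' q' where x: "p \<in> dom \<alpha>" "q \<in> dom \<beta>" "p' \<in> dom \<alpha>" "q' \<in> dom \<beta>" "(p, q) \<noteq> (p', q')"
    "0 < bond ?\<gamma> p q" "0 < bond ?\<gamma> p' q'" by metis
  obtain i j where i: "i = 0 \<or> i = anchor e'" "a' \<le> i" "i \<le> b'" "p = v' + cell 3 i" "q = p + (0, 1)"
      "q \<in> dom (canopy v a b)" "q = v + cell 4 j" "snd (cell 4 j) = -3"
    using key[OF x(1,2,6)] by blast
  obtain i' j' where i': "i' = 0 \<or> i' = anchor e'" "a' \<le> i'" "i' \<le> b'" "p' = v' + cell 3 i'" "q' = p' + (0, 1)"
      "q' \<in> dom (canopy v a b)" "q' = v + cell 4 j'" "snd (cell 4 j') = -3"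
    using key[OF x(3,4,7)] by blast
  \<comment> \<open>An anchor is bound only to the cell above it, so different bonds belong to
    different anchors.\<close>
  have "i \<noteq> i'" using i(4,5) i'(4,5) x(5) by auto
  then have both: "i = 0 \<and> i' = anchor e' \<or> i = anchor e' \<and> i' = 0" using i(1) i'(1) by blast
  have a': "a' = 0" "anchor e' \<le> b'" using both i i' R(2) by auto
  have "v' + (0, 1) \<in> dom (canopy v a b)" "v' + cell 3 (anchor e') + (0, 1) \<in> dom (canopy v a b)"
    using both i i' by (auto simp: add.assoc)
  moreover have "snd v' = snd v - 4"
  proof -
    obtain k where "v' + cell 3 0 + (0, 1) = v + cell 4 k" "snd (cell 4 k) = -3"
      using both i i' by metis
    from arg_cong[OF this(1), of snd] this(2) show ?thesis by simp
  qed
  ultimately show ?thesis using R a' by (simp add: hangs_def)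
qed

text \<open>A bond with a hanging snake makes \<alpha> a continuation of it, and no further bond is
  needed. Without such a bond \<alpha> is attached to the canopy alone and becomes a new hanging
  snake.\<close>

lemma is_composite_combine_snake:
  assumes "is_snake \<alpha>" and c: "composite \<beta> v a b H" and d: "dom \<alpha> \<inter> dom \<beta> = {}" and fin: "finite (dom \<beta>)"
    and cut: "2 < cut (\<alpha> ++ \<beta>) (dom \<alpha>) (dom \<beta>)"
  shows "is_composite (\<alpha> ++ \<beta>)"
proof -
  let ?\<gamma> = "\<alpha> ++ \<beta>"
  obtain v' e' a' b' where R: "valid_end e'" "0 \<le> a'" "a' \<le> b'" "b' \<le> e'" "\<alpha> = snake v' e' a' b'"
    using assms(1) by (auto simp: is_snake_def)
  have \<alpha>: "?\<gamma> (v' + cell 3 i) = Some (snake_tile e' i)" if "a' \<le> i" "i \<le> b'" for i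
    using that by (intro map_add_Some_left[OF d]) (simp add: R(5) track_cell)
  show ?thesis
  proof (cases "\<exists>p r q. p \<in> dom \<alpha> \<and> r \<in> H \<and> q \<in> dom (hung_snake r) \<and> 0 < bond ?\<gamma> p q")
    case True
    then obtain p r q where r: "p \<in> dom \<alpha>" "r \<in> H" "q \<in> dom (hung_snake r)" "0 < bond ?\<gamma> p q" by blast
    obtain w e c' where "r = (w, e, c')" by (cases r) blast
    then have pq: "p \<in> dom \<alpha>" "(w, e, c') \<in> H" "q \<in> dom (snake w e 0 c')" "0 < bond ?\<gamma> q p"
      using r by (simp_all add: hung_snake_def bond_sym[of ?\<gamma> q p])
    obtain i where i: "a' \<le> i" "i \<le> b'" "p = v' + cell 3 i" using pq(1) unfolding R(5) dom_track by auto
    obtain j where j: "0 \<le> j" "j \<le> c'" "q = w + cell 3 j" using pq(3) unfolding dom_track by auto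
    note h = composite_hangs[OF c pq(2)]
    have sub: "dom (snake w e 0 c') \<subseteq> dom \<beta>" using composite_dom_hung_snake[OF c pq(2)] by (simp add: hung_snake_def)
    have d1: "dom (snake w e 0 c') \<inter> dom (snake v' e' a' b') = {}" "dom (snake v' e' a' b') \<inter> dom (snake w e 0 c') = {}"
      using sub d unfolding R(5) by blast+
    have le: "j \<le> e" "i \<le> e'" using i j h R(4) by auto
    have g: "?\<gamma> (w + cell 3 j) = Some (snake_tile e j)" "?\<gamma> (v' + cell 3 i) = Some (snake_tile e' i)"
      using composite_snake_tile[OF c pq(2) j(1,2)] \<alpha> i by auto
    have "0 \<le> c'" using anchor_bounds(1)[OF h(1)] h(2) by simp
    show ?thesis
    proof (rule snake_snake_cross[OF h(1) R(1) le g pq(4)[unfolded i(3) j(3)]], goal_cases)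
      case 1
      from snake_join(2)[OF h(1) R(1) order_refl j(1,2) h(3) R(2) i(1,2) R(4) d1(1) 1] h(2)
      obtain b'' where b'': "c' < b''" "b'' \<le> e" "snake w e 0 c' ++ \<alpha> = snake w e 0 b''"
        unfolding R(5) by blast
      have "composite ?\<gamma> v a b (insert (w, e, b'') (H - {(w, e, c')}))"
      proof (rule composite_add[OF c _ _ _ d])
        show "{(w, e, c')} \<subseteq> H" using pq by simp
        show "hangs v a b (w, e, b'')" using h b'' by (simp add: hangs_def)
        show "hung_snake (w, e, b'') p = Some t \<longleftrightarrow> \<alpha> p = Some t \<or> (\<exists>r\<in>{(w, e, c')}. hung_snake r p = Some t)" for p t
          using map_add_disjoint_Some_iff[OF d1(1)[folded R(5)], of p t] b''(3) by (auto simp: hung_snake_def)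
      qed
      then show ?thesis unfolding is_composite_def by blast
    next
      case 2
      \<comment> \<open>A hanging snake starts at index 0, which has no entry, so nothing can
        precede it.\<close>
      from snake_join(1)[OF R(1) h(1) R(2) i(1,2) R(4) order_refl j(1,2) h(3) d1(2) 2] show ?thesis by simp
    qed
  next
    case False
    then have no: "\<forall>r\<in>H. \<forall>p\<in>dom \<alpha>. \<forall>q\<in>dom (hung_snake r). bond ?\<gamma> p q = 0"
      by (meson gr0I)
    from snake_hangs[OF R(1,2,4,5) c d fin no cut]
    have a': "a' = 0" and "hangs v a b (v', e', b')" by auto
    then have "composite ?\<gamma> v a b (insert (v', e', b') (H - {}))"
      by (intro composite_add[OF c]) (auto simp: hung_snake_def R(5) a' d[unfolded R(5) a'])
    then show ?thesis unfolding is_composite_def by blast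
  qed
qed

lemma composite_join:
  assumes c: "composite \<alpha> v a b H" and c': "composite \<beta> v' a' b' H'" and d: "dom \<alpha> \<inter> dom \<beta> = {}"
    and l: "canopy_link b = canopy_link (a' - 1)" and p: "v + cell 4 (b + 1) = v' + cell 4 a'"
  shows "is_composite (\<alpha> ++ \<beta>)"
proof -
  define s where "s = b + 1 - a'"
  have ab: "a \<le> b" "a' \<le> b'" using c c' by (simp_all add: composite_def)
  have G: "canopy v a b ++ canopy v' a' b' = canopy v a (b' + s)"
    using canopy_concat[OF ab l p] by (simp add: s_def)
  have dG: "dom (canopy v a b) \<inter> dom (canopy v' a' b') = {}"
    using composite_dom_canopy[OF c] composite_dom_canopy[OF c'] d by blast
  have domG: "dom (canopy v a (b' + s)) = dom (canopy v a b) \<union> dom (canopy v' a' b')"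
    unfolding G[symmetric] by auto
  \<comment> \<open>The two numberings differ by whole periods, hence the canopies are shifted
    horizontally only and the row condition in \<open>hangs\<close> survives.\<close>
  obtain k where k: "b = a' - 1 + 8 * k" using mod_eq_shift[OF canopy_link_eqD[OF l]] by blast
  then have "cell 4 (b + 1) = cell 4 a' + (2 * k, 0)"
    using cell_period[of 4 a' k] by (simp add: algebra_simps)
  then have vv: "snd v' = snd v" using arg_cong[OF p, of snd] by simp
  have "composite (\<alpha> ++ \<beta>) v a (b' + s) (H \<union> H')"
    unfolding composite_def
  proof (intro conjI allI ballI impI)
    show "a \<le> b' + s" using ab by (simp add: s_def)
    show "(\<alpha> ++ \<beta>) x = Some t \<longleftrightarrow> canopy v a (b' + s) x = Some t \<or> (\<exists>r\<in>H \<union> H'. hung_snake r x = Some t)" for x t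
      unfolding map_add_disjoint_Some_iff[OF d] G[symmetric] map_add_disjoint_Some_iff[OF dG] comp_Some[OF c] comp_Some[OF c']
      by blast
    show "hangs v a (b' + s) r" if r: "r \<in> H \<union> H'" for r
    proof -
      have "hangs v a b r \<or> hangs v' a' b' r" using r c c' unfolding composite_def by blast
      then show ?thesis unfolding hangs_def domG vv by (auto split: prod.splits)
    qed
    show "dom (hung_snake x) \<inter> dom (hung_snake y) = {}" if x: "x \<in> H \<union> H'" "y \<in> H \<union> H'" "x \<noteq> y" for x y
    proof -
      consider "x \<in> H" "y \<in> H" | "x \<in> H'" "y \<in> H'" | "x \<in> H" "y \<in> H'" | "x \<in> H'" "y \<in> H"
        using x by blast
      then show ?thesis
      proof cases
        case 1
        then show ?thesis using c x(3) unfolding composite_def by blast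
      next
        case 2
        then show ?thesis using c' x(3) unfolding composite_def by blast
      next
        case 3
        then show ?thesis using composite_dom_hung_snake[OF c, of x] composite_dom_hung_snake[OF c', of y] d by blast
      next
        case 4
        then show ?thesis using composite_dom_hung_snake[OF c, of y] composite_dom_hung_snake[OF c', of x] d by blast
      qed
    qed
  qed
  then show ?thesis unfolding is_composite_def by blast
qed

text \<open>The cells above both anchors of a hanging snake are already occupied by its own canopy,
  so a foreign canopy cannot reach the anchors.\<close>

lemma composite_no_snake_canopy_bond:
  assumes c: "composite \<alpha> v a b H" and d: "dom \<alpha> \<inter> dom \<beta> = {}" and "(w, e, c') \<in> H"
    and "\<gamma> (w + cell 3 i) = Some (snake_tile e i)" "\<gamma> (u + cell 4 j) = Some (canopy_tile j)" "u + cell 4 j \<in> dom \<beta>"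
  shows "bond \<gamma> (w + cell 3 i) (u + cell 4 j) = 0"
proof (rule ccontr)
  assume "bond \<gamma> (w + cell 3 i) (u + cell 4 j) \<noteq> 0"
  then have p: "0 < bond \<gamma> (w + cell 3 i) (u + cell 4 j)" by simp
  note r = snake_canopy_cross[OF assms(4,5) p]
  have "u + cell 4 j \<in> dom (canopy v a b)"
    using r(1,2) composite_hangs(5,6)[OF c assms(3)] by auto
  then show False using composite_dom_canopy[OF c] d assms(6) by blast
qed

text \<open>A hanging snake can bond neither to a foreign canopy nor to a foreign hanging snake. The
  two canopies must therefore meet end to start, and \<open>composite_join\<close> applies.\<close>

lemma is_composite_combine:
  assumes c: "composite \<alpha> v a b H" and c': "composite \<beta> v' a' b' H'" and d: "dom \<alpha> \<inter> dom \<beta> = {}"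
    and cut: "0 < cut (\<alpha> ++ \<beta>) (dom \<alpha>) (dom \<beta>)"
  shows "is_composite (\<alpha> ++ \<beta>)"
proof -
  let ?\<gamma> = "\<alpha> ++ \<beta>"
  have d': "dom \<beta> \<inter> dom \<alpha> = {}" using d by blast
  obtain p q where pq: "p \<in> dom \<alpha>" "q \<in> dom \<beta>" "0 < bond ?\<gamma> p q"
    using cut_pos_imp[OF cut] by blast
  have dG: "dom (canopy v a b) \<inter> dom (canopy v' a' b') = {}"
    using composite_dom_canopy[OF c] composite_dom_canopy[OF c'] d by blast
  show ?thesis
  proof (rule composite_domE[OF c pq(1)]; rule composite_domE[OF c' pq(2)])
    fix i j assume i: "a \<le> i" "i \<le> b" "p = v + cell 4 i" "\<alpha> p = Some (canopy_tile i)"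
      and j: "a' \<le> j" "j \<le> b'" "q = v' + cell 4 j" "\<beta> q = Some (canopy_tile j)"
    have g: "?\<gamma> (v + cell 4 i) = Some (canopy_tile i)" "?\<gamma> (v' + cell 4 j) = Some (canopy_tile j)"
      using map_add_Some_left[OF d i(4)] j(4) i(3) j(3) by auto
    show ?thesis
    proof (rule canopy_canopy_cross[OF g pq(3)[unfolded i(3) j(3)]], goal_cases)
      case 1
      then have "i = b \<and> j = a'" using track_ends[OF dG i(1,2) j(1,2)] by blast
      then show ?thesis using composite_join[OF c c' d] 1 by simp
    next
      case 2
      have "dom (canopy v' a' b') \<inter> dom (canopy v a b) = {}" using dG by blast
      then have "j = b' \<and> i = a" using track_ends[OF _ j(1,2) i(1,2)] 2 by blast
      then show ?thesis using composite_join[OF c' c d'] 2 by (simp add: map_add_comm[OF d])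
    qed
  next
    fix i w e k j assume i: "a \<le> i" "i \<le> b" "p = v + cell 4 i" "\<alpha> p = Some (canopy_tile i)"
      and j: "(w, e, k) \<in> H'" "q = w + cell 3 j" "\<beta> q = Some (snake_tile e j)"
    have "bond ?\<gamma> (w + cell 3 j) (v + cell 4 i) = 0"
      by (rule composite_no_snake_canopy_bond[OF c' d' j(1)]) (use i j pq map_add_Some_left[OF d i(4)] in auto)
    then show ?thesis using pq(3) i(3) j(2) by (simp add: bond_sym)
  next
    fix j w e k i assume j: "a' \<le> j" "j \<le> b'" "q = v' + cell 4 j" "\<beta> q = Some (canopy_tile j)"
      and i: "(w, e, k) \<in> H" "p = w + cell 3 i" "\<alpha> p = Some (snake_tile e i)"
    have "bond ?\<gamma> (w + cell 3 i) (v' + cell 4 j) = 0"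
      by (rule composite_no_snake_canopy_bond[OF c d i(1)]) (use i j pq map_add_Some_left[OF d i(3)] in auto)
    then show ?thesis using pq(3) i(2) j(3) by simp
  next
    fix w e k i w' e' k' j assume i: "(w, e, k) \<in> H" "0 \<le> i" "i \<le> k" "p = w + cell 3 i" "\<alpha> p = Some (snake_tile e i)"
      and j: "(w', e', k') \<in> H'" "0 \<le> j" "j \<le> k'" "q = w' + cell 3 j" "\<beta> q = Some (snake_tile e' j)"
    note h = composite_hangs[OF c i(1)] and h' = composite_hangs[OF c' j(1)]
    have dd: "dom (snake w e 0 k) \<inter> dom (snake w' e' 0 k') = {}" "dom (snake w' e' 0 k') \<inter> dom (snake w e 0 k) = {}"
      using composite_dom_hung_snake[OF c i(1)] composite_dom_hung_snake[OF c' j(1)] d by (auto simp: hung_snake_def)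
    have g: "?\<gamma> (w + cell 3 i) = Some (snake_tile e i)" "?\<gamma> (w' + cell 3 j) = Some (snake_tile e' j)"
      using map_add_Some_left[OF d i(5)] j(5) i(4) j(4) by auto
    have le: "i \<le> e" "j \<le> e'" using i j h h' by auto
    show ?thesis
    proof (rule snake_snake_cross[OF h(1) h'(1) le g pq(3)[unfolded i(4) j(4)]], goal_cases)
      case 1
      from snake_join(1)[OF h(1) h'(1) order_refl i(2,3) h(3) order_refl j(2,3) h'(3) dd(1) 1]
      show ?thesis by simp
    next
      case 2
      from snake_join(1)[OF h'(1) h(1) order_refl j(2,3) h'(3) order_refl i(2,3) h(3) dd(2) 2]
      show ?thesis by simp
    qed
  qed
qed

section \<open>Closure of the shapes under breaks\<close>

lemma track_crossing_unique:
  assumes link: "linked h f a b" and \<gamma>: "\<And>i. a \<le> i \<Longrightarrow> i \<le> b \<Longrightarrow> \<gamma> (v + cell h i) = Some (f i)"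
    and fin: "finite A" "finite B" "A \<inter> B = {}" and dom: "dom \<gamma> = A \<union> B" and cut: "cut \<gamma> A B < 6"
    and i: "a \<le> i" "i < b" "v + cell h i \<in> A \<longleftrightarrow> v + cell h (i + 1) \<notin> A"
    and j: "a \<le> j" "j < b" "v + cell h j \<in> A \<longleftrightarrow> v + cell h (j + 1) \<notin> A"
  shows "i = j"
proof (rule ccontr)
  assume "i \<noteq> j"
  have mem: "v + cell h k \<in> A \<union> B" if "a \<le> k" "k \<le> b" for k
    using \<gamma>[OF that] dom by blast
  \<comment> \<open>The bound 6 in the hypothesis is the strength of two path bonds.\<close>
  have "bond \<gamma> (v + cell h i) (v + cell h (i + 1)) = 3" "bond \<gamma> (v + cell h j) (v + cell h (j + 1)) = 3"
    using i j \<gamma> by (auto intro!: linked_bond[OF link])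
  moreover have "bond \<gamma> (v + cell h i) (v + cell h (i + 1)) + bond \<gamma> (v + cell h j) (v + cell h (j + 1)) \<le> cut \<gamma> A B"
  proof (rule cut_ge_two[OF fin])
    show "v + cell h i \<in> A \<and> v + cell h (i + 1) \<in> B \<or> v + cell h i \<in> B \<and> v + cell h (i + 1) \<in> A"
      using mem[of i] mem[of "i + 1"] i fin(3) by auto
    show "v + cell h j \<in> A \<and> v + cell h (j + 1) \<in> B \<or> v + cell h j \<in> B \<and> v + cell h (j + 1) \<in> A"
      using mem[of j] mem[of "j + 1"] j fin(3) by auto
    show "{v + cell h i, v + cell h (i + 1)} \<noteq> {v + cell h j, v + cell h (j + 1)}"
      using \<open>i \<noteq> j\<close> by (auto simp: doubleton_eq_iff)
  qed
  ultimately show False using cut by simp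
qed

lemma map_add_left_Some_iff:
  "\<gamma> = \<alpha> ++ \<beta> \<Longrightarrow> dom \<alpha> \<inter> dom \<beta> = {} \<Longrightarrow> \<alpha> p = Some t \<longleftrightarrow> \<gamma> p = Some t \<and> p \<in> dom \<alpha>"
  by (simp only: map_add_disjoint_Some_iff) blast

lemma subtrack_eq:
  assumes "\<And>p t. \<alpha> p = Some t \<longleftrightarrow> track h f v a b p = Some t \<and> p \<in> dom \<alpha>"
    and "a \<le> a'" "b' \<le> b" "\<And>i. a \<le> i \<Longrightarrow> i \<le> b \<Longrightarrow> v + cell h i \<in> dom \<alpha> \<longleftrightarrow> a' \<le> i \<and> i \<le> b'"
  shows "\<alpha> = track h f v a' b'"
proof (rule map_eqI)
  fix p t
  show "\<alpha> p = Some t \<longleftrightarrow> track h f v a' b' p = Some t"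
  proof
    assume "\<alpha> p = Some t"
    then obtain i where "a \<le> i" "i \<le> b" "p = v + cell h i" "t = f i" "p \<in> dom \<alpha>"
      using assms(1)[of p t] unfolding track_Some by blast
    then show "track h f v a' b' p = Some t" using assms(4)[of i] by (auto simp: track_Some)
  next
    assume "track h f v a' b' p = Some t"
    then obtain i where i: "a' \<le> i" "i \<le> b'" "p = v + cell h i" "t = f i"
      unfolding track_Some by blast
    then have "p \<in> dom \<alpha>" using assms(2,3) assms(4)[of i] by simp
    moreover have "track h f v a b p = Some t" using i assms(2,3) by (auto simp: track_Some)
    ultimately show "\<alpha> p = Some t" using assms(1) by blast
  qed
qed

text \<open>The cut is too weak to cross two path bonds, so membership in \<alpha> changes once
  along the path and \<alpha> is an initial or a final segment.\<close>

lemma is_snake_break: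
  assumes "is_snake (\<alpha> ++ \<beta>)" and d: "dom \<alpha> \<inter> dom \<beta> = {}" and ne: "dom \<alpha> \<noteq> {}" "dom \<beta> \<noteq> {}"
    and cut: "cut (\<alpha> ++ \<beta>) (dom \<alpha>) (dom \<beta>) < 6"
  shows "is_snake \<alpha>"
proof -
  let ?\<gamma> = "\<alpha> ++ \<beta>"
  obtain v e a b where R: "valid_end e" "0 \<le> a" "a \<le> b" "b \<le> e" "?\<gamma> = snake v e a b"
    using assms(1) by (auto simp: is_snake_def)
  have link: "linked 3 (snake_tile e) a b" using linked_mono[OF linked_snake] R by blast
  have dom: "dom ?\<gamma> = dom \<alpha> \<union> dom \<beta>" by auto
  have fin: "finite (dom \<alpha>)" "finite (dom \<beta>)"
    using finite_dom_track[of 3 "snake_tile e" v a b] unfolding R(5)[symmetric] dom by simp_all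
  have \<gamma>: "?\<gamma> (v + cell 3 i) = Some (snake_tile e i)" if "a \<le> i" "i \<le> b" for i
    using track_cell[OF that] R(5) by simp
  let ?P = "\<lambda>i. v + cell 3 i \<in> dom \<alpha>"
  have domR: "dom ?\<gamma> = (\<lambda>i. v + cell 3 i) ` {a..b}" unfolding R(5) by (rule dom_track)
  obtain p q where pq: "p \<in> dom \<alpha>" "q \<in> dom \<beta>" using ne by blast
  then have "p \<in> (\<lambda>i. v + cell 3 i) ` {a..b}" "q \<in> (\<lambda>i. v + cell 3 i) ` {a..b}" "q \<notin> dom \<alpha>"
    using domR[unfolded dom] d by blast+
  then obtain x y where xy: "x \<in> {a..b}" "p = v + cell 3 x" "y \<in> {a..b}" "q = v + cell 3 y" "q \<notin> dom \<alpha>"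
    by blast
  have x: "a \<le> x" "x \<le> b" "?P x" and y: "a \<le> y" "y \<le> b" "\<not> ?P y"
    using xy(1,3) pq(1)[unfolded xy(2)] xy(5)[unfolded xy(4)] by simp_all
  have "\<exists>i. a \<le> i \<and> i \<le> b \<and> ?P i \<noteq> ?P a" using x y by blast
  then obtain i where i: "a \<le> i" "i \<le> b" "?P i \<noteq> ?P a" by blast
  obtain c where c: "a \<le> c" "c < b" "\<And>i. a \<le> i \<Longrightarrow> i \<le> c \<Longrightarrow> ?P i = ?P a" "\<And>i. c < i \<Longrightarrow> i \<le> b \<Longrightarrow> ?P i \<noteq> ?P a"
  proof (rule unique_crossing[OF i])
    show "i = j" if "a \<le> i" "i < b" "a \<le> j" "j < b" "?P i \<noteq> ?P (i + 1)" "?P j \<noteq> ?P (j + 1)" for i j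
      using track_crossing_unique[OF link \<gamma> fin d dom cut] that by blast
  qed blast
  have sub: "\<alpha> p = Some t \<longleftrightarrow> snake v e a b p = Some t \<and> p \<in> dom \<alpha>" for p t
    using map_add_left_Some_iff[OF refl d, of p t] unfolding R(5) .
  show ?thesis
  proof (cases "?P a")
    case True
    have "?P i \<longleftrightarrow> a \<le> i \<and> i \<le> c" if "a \<le> i" "i \<le> b" for i
      using c(3,4)[of i] True that not_le by blast
    then have "\<alpha> = snake v e a c"
      by (intro subtrack_eq[OF sub]) (use c(2) in auto)
    then show ?thesis using R c(1,2) unfolding is_snake_def
      by (intro exI[of _ v] exI[of _ e] exI[of _ a] exI[of _ c]) auto
  next
    case False
    have "?P i \<longleftrightarrow> c < i" if "a \<le> i" "i \<le> b" for i
      using c(3,4)[of i] False that not_le by blast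
    then have "?P i \<longleftrightarrow> c + 1 \<le> i \<and> i \<le> b" if "a \<le> i" "i \<le> b" for i
      using that by (simp add: zless_imp_add1_zle add1_zle_eq)
    then have "\<alpha> = snake v e (c + 1) b"
      by (intro subtrack_eq[OF sub]) (use c(1) in auto)
    then show ?thesis using R c(1,2) unfolding is_snake_def
      by (intro exI[of _ v] exI[of _ e] exI[of _ "c + 1"] exI[of _ b]) auto
  qed
qed

lemma snake_top_row: "valid_end e \<Longrightarrow> i = 0 \<or> i = anchor e \<Longrightarrow> snd (cell 3 i) = 0"
proof -
  assume *: "valid_end e" "i = 0 \<or> i = anchor e"
  then have "i = 0 \<or> i = e - 2 \<and> e mod 6 = 2 \<or> i = e \<and> e mod 6 = 5"
    using valid_end_mod[OF *(1)] by (auto simp: anchor_def split: if_splits)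
  then have "i mod 6 = 0 \<or> i mod 6 = 5" by presburger
  moreover have "even (i div 3) \<longleftrightarrow> i mod 6 < 3" by presburger
  moreover have "i mod 3 = i mod 6 mod 3" by presburger
  ultimately show ?thesis by (auto simp: cell_def)
qed

lemma anchor_bond:
  assumes "valid_end e" "i = 0 \<or> i = anchor e" "snd (cell 4 j) = -3" "u + cell 4 j = w + cell 3 i + (0, 1)"
    and "\<gamma> (w + cell 3 i) = Some (snake_tile e i)" "\<gamma> (u + cell 4 j) = Some (canopy_tile j)"
  shows "bond \<gamma> (w + cell 3 i) (w + cell 3 i + (0, 1)) = 2"
proof -
  have *: "\<gamma> (w + cell 3 i + (0, 1)) = Some (canopy_tile j)" using assms(4,6) by simp
  have "w + cell 3 i + (0, 1) - (w + cell 3 i) = (0, 1)" "w + cell 3 i - (w + cell 3 i + (0, 1)) = (0, -1)"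
    by (simp_all add: prod_eq_iff)
  then show ?thesis
    using bond_Some[of \<gamma> "w + cell 3 i" "snake_tile e i" "w + cell 3 i + (0, 1)" "canopy_tile j", OF assms(5) *]
      snake_glue_top[OF assms(1,2)] canopy_glue_bottom[OF assms(3)]
    by (simp add: glue_snake_tile glue_canopy_tile strength_def)
qed

lemma composite_anchor:
  assumes c: "composite \<gamma> v a b H" and r: "(w, e, k) \<in> H" and i: "i = 0 \<or> i = anchor e"
  shows "bond \<gamma> (w + cell 3 i) (w + cell 3 i + (0, 1)) = 2" "w + cell 3 i + (0, 1) \<in> dom (canopy v a b)"
proof -
  note h = composite_hangs[OF c r]
  show "w + cell 3 i + (0, 1) \<in> dom (canopy v a b)" using i h(5,6) by auto
  then obtain j where j: "a \<le> j" "j \<le> b" "v + cell 4 j = w + cell 3 i + (0, 1)"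
    unfolding dom_track by fastforce
  have "snd (cell 4 j) = -3"
    using arg_cong[OF j(3), of snd] snake_top_row[OF h(1) i] h(4) by simp
  moreover have "0 \<le> i" "i \<le> k" using i h(2) anchor_bounds(1)[OF h(1)] by auto
  ultimately show "bond \<gamma> (w + cell 3 i) (w + cell 3 i + (0, 1)) = 2"
    using anchor_bond[OF h(1) i _ j(3)] composite_snake_tile[OF c r] composite_canopy_tile[OF c j(1,2)] by blast
qed

text \<open>Used for both halves of a cut canopy, and for what is left when one snake drops
  off.\<close>

lemma composite_restrict:
  assumes c: "composite \<gamma> v a b H"
    and sub: "\<And>p t. \<alpha> p = Some t \<longleftrightarrow> \<gamma> p = Some t \<and> p \<in> dom \<alpha>"
    and ab: "a' \<le> b'" "a \<le> a'" "b' \<le> b"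
    and G: "\<And>j. a \<le> j \<Longrightarrow> j \<le> b \<Longrightarrow> v + cell 4 j \<in> dom \<alpha> \<longleftrightarrow> a' \<le> j \<and> j \<le> b'"
    and H: "H0 \<subseteq> H" "\<And>r. r \<in> H0 \<Longrightarrow> dom (hung_snake r) \<subseteq> dom \<alpha>"
      "\<And>r. r \<in> H - H0 \<Longrightarrow> dom (hung_snake r) \<inter> dom \<alpha> = {}"
    and anchors: "\<And>w e k. (w, e, k) \<in> H0 \<Longrightarrow> w + (0, 1) \<in> dom \<alpha> \<and> w + cell 3 (anchor e) + (0, 1) \<in> dom \<alpha>"
  shows "composite \<alpha> v a' b' H0"
  unfolding composite_def
proof (intro conjI allI ballI impI)
  have Gs: "canopy v a' b' p = Some t \<longleftrightarrow> canopy v a b p = Some t \<and> p \<in> dom \<alpha>" for p t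
  proof
    assume "canopy v a' b' p = Some t"
    then obtain j where j: "a' \<le> j" "j \<le> b'" "p = v + cell 4 j" "t = canopy_tile j"
      unfolding track_Some by blast
    then show "canopy v a b p = Some t \<and> p \<in> dom \<alpha>" using G[of j] ab by (auto simp: track_Some)
  next
    assume "canopy v a b p = Some t \<and> p \<in> dom \<alpha>"
    then obtain j where "a \<le> j" "j \<le> b" "p = v + cell 4 j" "t = canopy_tile j" "p \<in> dom \<alpha>"
      unfolding track_Some by blast
    then show "canopy v a' b' p = Some t" using G[of j] by (auto simp: track_Some)
  qed
  show "\<alpha> p = Some t \<longleftrightarrow> canopy v a' b' p = Some t \<or> (\<exists>r\<in>H0. hung_snake r p = Some t)" for p t
  proof -
    have "hung_snake r p = Some t \<and> p \<in> dom \<alpha> \<longleftrightarrow> hung_snake r p = Some t \<and> r \<in> H0" if "r \<in> H" for r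
      using H(2)[of r] H(3)[of r] that by blast
    then show ?thesis unfolding sub[of p] comp_Some[OF c] Gs using H(1) by blast
  qed
  show "a' \<le> b'" by (fact ab)
  show "hangs v a' b' r" if "r \<in> H0" for r
  proof -
    obtain w e k where r: "r = (w, e, k)" by (cases r) blast
    have domG: "dom (canopy v a' b') = dom (canopy v a b) \<inter> dom \<alpha>"
    proof (intro set_eqI iffI)
      fix p assume "p \<in> dom (canopy v a' b')"
      then obtain t where "canopy v a' b' p = Some t" by blast
      then show "p \<in> dom (canopy v a b) \<inter> dom \<alpha>" unfolding Gs by blast
    next
      fix p assume "p \<in> dom (canopy v a b) \<inter> dom \<alpha>"
      then obtain t where "canopy v a b p = Some t \<and> p \<in> dom \<alpha>" by blast
      then show "p \<in> dom (canopy v a' b')" unfolding Gs[symmetric] by blast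
    qed
    show ?thesis using composite_hangs[OF c, of w e k] anchors[of w e k] that H(1)
      unfolding r hangs_def domG by auto
  qed
  show "dom (hung_snake r) \<inter> dom (hung_snake r') = {}" if "r \<in> H0" "r' \<in> H0" "r \<noteq> r'" for r r'
    using that H(1) c unfolding composite_def by blast
qed

lemma int_interval_const:
  fixes P :: "int \<Rightarrow> bool"
  assumes "\<And>i. a \<le> i \<Longrightarrow> i < b \<Longrightarrow> P i = P (i + 1)" "a \<le> j" "j \<le> b"
  shows "P j = P a"
  using assms(2,3)
proof (induction j rule: int_ge_induct)
  case (step j)
  then have "P j = P a" "P j = P (j + 1)" using assms(1) by auto
  then show ?case by metis
qed simp

text \<open>A cut of strength at most 4 cannot cross two path bonds, nor a path bond and an anchor bond, nor
  three anchor bonds. So it crosses one bond of the canopy, or the two anchor bonds of one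
  snake, or one path bond behind the second anchor of a snake; the last cut separates at most two tiles
  and is excluded by \<open>small\<close>.\<close>

lemma composite_break:
  assumes c: "composite \<gamma> v a b H" and \<gamma>: "\<gamma> = \<alpha> ++ \<beta>" and d: "dom \<alpha> \<inter> dom \<beta> = {}" and ne: "dom \<beta> \<noteq> {}"
    and fin: "finite (dom \<gamma>)" and cut: "cut \<gamma> (dom \<alpha>) (dom \<beta>) < 5"
    and small: "card (dom \<beta>) \<le> 2 \<Longrightarrow> cut \<gamma> (dom \<alpha>) (dom \<beta>) < 3"
    and start: "v + cell 4 a \<in> dom \<alpha>"
  shows "is_composite \<alpha> \<and> (is_snake \<beta> \<or> is_composite \<beta>)"
proof -
  define A where "A = dom \<alpha>"
  define B where "B = dom \<beta>"
  have dom: "dom \<gamma> = A \<union> B" by (auto simp: \<gamma> A_def B_def)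
  have f: "finite A" "finite B" "A \<inter> B = {}" using fin d unfolding dom A_def B_def by auto
  have cutAB: "cut \<gamma> A B < 5" using cut by (simp add: A_def B_def)
  have sub\<alpha>: "\<alpha> p = Some t \<longleftrightarrow> \<gamma> p = Some t \<and> p \<in> A" for p t
    unfolding A_def by (rule map_add_left_Some_iff[OF \<gamma> d])
  have "\<gamma> = \<beta> ++ \<alpha>" "dom \<beta> \<inter> dom \<alpha> = {}" using \<gamma> map_add_comm[OF d] d by auto
  then have sub\<beta>: "\<beta> p = Some t \<longleftrightarrow> \<gamma> p = Some t \<and> p \<in> B" for p t
    unfolding B_def by (rule map_add_left_Some_iff)
  have ab: "a \<le> b" using c by (simp add: composite_def)
  have Gin: "v + cell 4 j \<in> A \<union> B" if "a \<le> j" "j \<le> b" for j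
    using composite_canopy_tile[OF c that] dom by blast
  have Hin: "w + cell 3 i \<in> A \<union> B" if "(w, e, k) \<in> H" "0 \<le> i" "i \<le> k" for w e k i
    using composite_snake_tile[OF c that] dom by blast
  have hlink: "bond \<gamma> (w + cell 3 i) (w + cell 3 (i + 1)) = 3" if "(w, e, k) \<in> H" "0 \<le> i" "i < k" for w e k i
    using that composite_snake_tile[OF c that(1)] composite_hangs(3)[OF c that(1)]
    by (intro linked_bond[OF linked_snake[of e]]) auto
  have glink: "bond \<gamma> (v + cell 4 j) (v + cell 4 (j + 1)) = 3" if "a \<le> j" "j < b" for j
    using that composite_canopy_tile[OF c] by (intro linked_bond[OF linked_canopy[of a b]]) auto
  \<comment> \<open>A crossing path bond uses up the budget: with any further bond of strength at
    least 2 the cut would reach 5.\<close>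
  have no2: False if "p \<in> A \<union> B" "q \<in> A \<union> B" "p \<in> A \<longleftrightarrow> q \<notin> A" "bond \<gamma> p q = 3"
      "p' \<in> A \<union> B" "q' \<in> A \<union> B" "p' \<in> A \<longleftrightarrow> q' \<notin> A" "2 \<le> bond \<gamma> p' q'" "{p, q} \<noteq> {p', q'}" for p q p' q'
  proof -
    have "bond \<gamma> p q + bond \<gamma> p' q' \<le> cut \<gamma> A B"
      by (rule cut_ge_two[OF f]) (use that in auto)
    then show False using cutAB that by simp
  qed
  have anchor_in: "w + cell 3 i \<in> A \<union> B" "w + cell 3 i + (0, 1) \<in> A \<union> B"
    if "(w, e, k) \<in> H" "i = 0 \<or> i = anchor e" for w e k i
  proof -
    have h: "valid_end e" "anchor e \<le> k" using composite_hangs[OF c that(1)] by auto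
    then have "0 \<le> i" "i \<le> k" using that(2) anchor_bounds(1)[OF h(1)] by auto
    then show "w + cell 3 i \<in> A \<union> B" using Hin that(1) by blast
    show "w + cell 3 i + (0, 1) \<in> A \<union> B" using composite_anchor(2)[OF c that] composite_dom_canopy[OF c] dom by blast
  qed
  have start': "v + cell 4 a \<in> A" using start by (simp add: A_def)
  show ?thesis
  proof (cases "\<exists>j. a \<le> j \<and> j \<le> b \<and> v + cell 4 j \<notin> A")
    \<comment> \<open>The canopy is cut. No hanging snake is then cut, and each one stays on the
      same side as the canopy cells above its anchors.\<close>
    case True
    let ?P = "\<lambda>j. v + cell 4 j \<in> A"
    obtain j where j: "a \<le> j" "j \<le> b" "?P j \<noteq> ?P a" using True start' by blast
    have cut6: "cut \<gamma> A B < 6" using cutAB by simp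
    obtain c0 where c0: "a \<le> c0" "c0 < b" "?P c0 \<noteq> ?P (c0 + 1)"
      "\<And>i. a \<le> i \<Longrightarrow> i \<le> c0 \<Longrightarrow> ?P i = ?P a" "\<And>i. c0 < i \<Longrightarrow> i \<le> b \<Longrightarrow> ?P i \<noteq> ?P a"
    proof (rule unique_crossing[OF j])
      show "i = j" if "a \<le> i" "i < b" "a \<le> j" "j < b" "?P i \<noteq> ?P (i + 1)" "?P j \<noteq> ?P (j + 1)" for i j
        using track_crossing_unique[OF linked_canopy composite_canopy_tile[OF c] f dom cut6] that by blast
    qed blast
    have cross: "v + cell 4 c0 \<in> A \<union> B" "v + cell 4 (c0 + 1) \<in> A \<union> B"
      "v + cell 4 c0 \<in> A \<longleftrightarrow> v + cell 4 (c0 + 1) \<notin> A" "bond \<gamma> (v + cell 4 c0) (v + cell 4 (c0 + 1)) = 3"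
      using Gin[of c0] Gin[of "c0 + 1"] c0(1-3) glink[of c0] by auto
    have disjGH: "w + cell 3 i \<noteq> v + cell 4 x" if "(w, e, k) \<in> H" for w e k i x
    proof
      assume "w + cell 3 i = v + cell 4 x"
      from arg_cong[OF this, of snd] show False
        using composite_hangs(4)[OF c that] cell_row[of 3 i] cell_row[of 4 x] by simp
    qed
    have Hside: "w + cell 3 i \<in> A \<longleftrightarrow> w \<in> A" if r: "(w, e, k) \<in> H" and i: "0 \<le> i" "i \<le> k" for w e k i
    proof -
      have "w + cell 3 i \<in> A \<longleftrightarrow> w + cell 3 0 \<in> A"
      proof (rule int_interval_const[OF _ i])
        fix i assume i: "0 \<le> i" "i < k"
        show "w + cell 3 i \<in> A \<longleftrightarrow> w + cell 3 (i + 1) \<in> A"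
        proof (rule ccontr)
          assume "\<not> ?thesis"
          moreover have "{v + cell 4 c0, v + cell 4 (c0 + 1)} \<noteq> {w + cell 3 i, w + cell 3 (i + 1)}"
            using disjGH[OF r, of i c0] disjGH[OF r, of "i + 1" c0] by (auto simp: doubleton_eq_iff)
          ultimately show False
            using no2[OF cross, of "w + cell 3 i" "w + cell 3 (i + 1)"] hlink[OF r i] Hin[OF r, of i]
              Hin[OF r, of "i + 1"] i by auto
        qed
      qed
      then show ?thesis by simp
    qed
    have anch: "w + cell 3 i + (0, 1) \<in> A \<longleftrightarrow> w \<in> A" if r: "(w, e, k) \<in> H" and i: "i = 0 \<or> i = anchor e" for w e k i
    proof -
      have "w + cell 3 i + (0, 1) \<in> A \<longleftrightarrow> w + cell 3 i \<in> A"
      proof (rule ccontr)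
        assume neg: "\<not> ?thesis"
        have "{v + cell 4 c0, v + cell 4 (c0 + 1)} \<noteq> {w + cell 3 i, w + cell 3 i + (0, 1)}"
          using disjGH[OF r, of i c0] disjGH[OF r, of i "c0 + 1"] by (metis insertI1 insertE singletonD)
        then show False
          using no2[OF cross anchor_in[OF r i]] composite_anchor(1)[OF c r i] neg by simp
      qed
      moreover have "0 \<le> i \<and> i \<le> k" using i composite_hangs(1,2)[OF c r] anchor_bounds(1)[of e] by auto
      then have "w + cell 3 i \<in> A \<longleftrightarrow> w \<in> A" using Hside[OF r] by blast
      ultimately show ?thesis by blast
    qed
    have HPA: "dom (hung_snake (w, e, k)) \<subseteq> (if w \<in> A then A else B)" if r: "(w, e, k) \<in> H" for w e k
      using Hside[OF r] Hin[OF r] by (auto simp: hung_snake_def dom_track)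
    have "composite \<alpha> v a c0 {r \<in> H. fst r \<in> A}"
    proof (rule composite_restrict[OF c sub\<alpha>[unfolded A_def]], goal_cases)
      case (4 j)
      show ?case unfolding A_def[symmetric] using c0(4,5)[of j] start' 4 by (cases "j \<le> c0") auto
    next
      case (6 r)
      then show ?case unfolding A_def[symmetric] using HPA[of "fst r" "fst (snd r)" "snd (snd r)"] by auto
    next
      case (7 r)
      then show ?case unfolding A_def[symmetric] using HPA[of "fst r" "fst (snd r)" "snd (snd r)"] f(3) by auto
    next
      case (8 w e k)
      then show ?case unfolding A_def[symmetric] using anch[of w e k 0] anch[of w e k "anchor e"] by auto
    qed (use c0(1,2) in auto)
    moreover have "composite \<beta> v (c0 + 1) b {r \<in> H. fst r \<notin> A}"
    proof (rule composite_restrict[OF c sub\<beta>[unfolded B_def]], goal_cases)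
      case (4 j)
      have "v + cell 4 j \<in> B \<longleftrightarrow> v + cell 4 j \<notin> A" using Gin[of j] 4 f(3) by blast
      then show ?case unfolding B_def[symmetric] using c0(4,5)[of j] start' 4 by (cases "j \<le> c0") auto
    next
      case (6 r)
      then show ?case unfolding B_def[symmetric] using HPA[of "fst r" "fst (snd r)" "snd (snd r)"] by auto
    next
      case (7 r)
      then show ?case unfolding B_def[symmetric] using HPA[of "fst r" "fst (snd r)" "snd (snd r)"] f(3) by auto
    next
      case (8 w e k)
      then show ?case unfolding B_def[symmetric]
        using anch[of w e k 0] anch[of w e k "anchor e"] anchor_in[of w e k 0] anchor_in[of w e k "anchor e"] by auto
    qed (use c0(1,2) in auto)
    ultimately show ?thesis unfolding is_composite_def by blast
  next
    \<comment> \<open>The canopy lies entirely in \<open>A\<close>, so \<open>B\<close> consists of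
      cells of hanging snakes.\<close>
    case False
    then have GA: "v + cell 4 j \<in> A" if "a \<le> j" "j \<le> b" for j using that by blast
    then have GpA: "dom (canopy v a b) \<subseteq> A" by (auto simp: dom_track)
    obtain q where q: "q \<in> B" using ne unfolding B_def by blast
    have "\<exists>w e k i. (w, e, k) \<in> H \<and> 0 \<le> i \<and> i \<le> k \<and> q = w + cell 3 i"
    proof (rule composite_domE[OF c, of q], goal_cases)
      case 1
      show "q \<in> dom \<gamma>" using q dom by blast
    next
      case (2 j)
      then show ?case using GA[of j] q f(3) by blast
    next
      case (3 w e k i)
      then show ?case by blast
    qed
    then obtain w e k i where r: "(w, e, k) \<in> H" and i: "0 \<le> i" "i \<le> k" "q = w + cell 3 i" by blast
    have anchA: "w + cell 3 i + (0, 1) \<in> A" if "(w, e, k) \<in> H" "i = 0 \<or> i = anchor e" for w e k i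
      using composite_anchor(2)[OF c that] GpA by blast
    show ?thesis
    proof (cases "\<exists>w e k i. (w, e, k) \<in> H \<and> 0 \<le> i \<and> i < k \<and> (w + cell 3 i \<in> A) \<noteq> (w + cell 3 (i + 1) \<in> A)")
      \<comment> \<open>A hanging snake is cut inside. All anchors must then stay in
        \<open>A\<close>, which leaves for \<open>B\<close> only the cells behind the second anchor,
        against \<open>small\<close>.\<close>
      case True
      then obtain w e k c0 where r: "(w, e, k) \<in> H" and c0: "0 \<le> c0" "c0 < k"
        "(w + cell 3 c0 \<in> A) \<noteq> (w + cell 3 (c0 + 1) \<in> A)" by blast
      have h: "valid_end e" "anchor e \<le> k" "k \<le> e" using composite_hangs[OF c r] by auto
      have cross: "w + cell 3 c0 \<in> A \<union> B" "w + cell 3 (c0 + 1) \<in> A \<union> B"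
        "w + cell 3 c0 \<in> A \<longleftrightarrow> w + cell 3 (c0 + 1) \<notin> A" "bond \<gamma> (w + cell 3 c0) (w + cell 3 (c0 + 1)) = 3"
        using Hin[OF r, of c0] Hin[OF r, of "c0 + 1"] c0 hlink[OF r] by auto
      have "3 \<le> cut \<gamma> A B"
      proof -
        have "w + cell 3 c0 \<in> A \<and> w + cell 3 (c0 + 1) \<in> B \<or> w + cell 3 (c0 + 1) \<in> A \<and> w + cell 3 c0 \<in> B"
          using cross by auto
        then show ?thesis
          using cut_ge_bond[OF f(1,2), of "w + cell 3 c0" "w + cell 3 (c0 + 1)" \<gamma>]
            cut_ge_bond[OF f(1,2), of "w + cell 3 (c0 + 1)" "w + cell 3 c0" \<gamma>] cross(4)
          by (auto simp: bond_sym[of \<gamma> "w + cell 3 (c0 + 1)"])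
      qed
      then have big: "2 < card B" using small unfolding A_def B_def by linarith
      have anA: "w' + cell 3 i \<in> A" if r': "(w', e', k') \<in> H" and i: "i = 0 \<or> i = anchor e'" for w' e' k' i
      proof (rule ccontr)
        assume neg: "w' + cell 3 i \<notin> A"
        have "{w + cell 3 c0, w + cell 3 (c0 + 1)} \<noteq> {w' + cell 3 i, w' + cell 3 i + (0, 1)}"
        proof -
          obtain x where x: "w' + cell 3 i + (0, 1) = v + cell 4 x"
            using composite_anchor(2)[OF c r' i] unfolding dom_track by blast
          have "w + cell 3 y \<noteq> v + cell 4 x" for y
          proof
            assume "w + cell 3 y = v + cell 4 x"
            from arg_cong[OF this, of snd] show False
              using composite_hangs(4)[OF c r] cell_row[of 3 y] cell_row[of 4 x] by simp
          qed
          then show ?thesis unfolding x by (auto simp: doubleton_eq_iff)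
        qed
        then show False
          using no2[OF cross, of "w' + cell 3 i" "w' + cell 3 i + (0, 1)"] composite_anchor(1)[OF c r' i]
            anchor_in[OF r' i] anchA[OF r' i] neg by auto
      qed
      have "B \<subseteq> (\<lambda>i. w + cell 3 i) ` {anchor e + 1..e}"
      proof
        fix q assume q: "q \<in> B"
        have "\<exists>w e k i. (w, e, k) \<in> H \<and> 0 \<le> i \<and> i \<le> k \<and> q = w + cell 3 i"
        proof (rule composite_domE[OF c, of q], goal_cases)
          case 1
          show "q \<in> dom \<gamma>" using q dom by blast
        next
          case (2 j)
          then show ?case using GA[of j] q f(3) by blast
        next
          case (3 w e k i)
          then show ?case by blast
        qed
        then obtain w' e' k' i where r': "(w', e', k') \<in> H" and i: "0 \<le> i" "i \<le> k'" "q = w' + cell 3 i" by blast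
        have uniq: "w' + cell 3 x = w + cell 3 c0 \<and> w' + cell 3 (x + 1) = w + cell 3 (c0 + 1) \<or>
            w' + cell 3 x = w + cell 3 (c0 + 1) \<and> w' + cell 3 (x + 1) = w + cell 3 c0"
          if x: "0 \<le> x" "x < k'" "(w' + cell 3 x \<in> A) \<noteq> (w' + cell 3 (x + 1) \<in> A)" for x
        proof (rule ccontr)
          assume "\<not> ?thesis"
          then have "{w + cell 3 c0, w + cell 3 (c0 + 1)} \<noteq> {w' + cell 3 x, w' + cell 3 (x + 1)}"
            by (auto simp: doubleton_eq_iff)
          then show False
            using no2[OF cross, of "w' + cell 3 x" "w' + cell 3 (x + 1)"] hlink[OF r' x(1,2)]
              Hin[OF r', of x] Hin[OF r', of "x + 1"] x by auto
        qed
        have t0: "w' + cell 3 0 \<in> A" "w' + cell 3 (anchor e') \<in> A" using anA[OF r', of 0] anA[OF r', of "anchor e'"] by auto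
        have qA: "q \<notin> A" using q f(3) by blast
        have tk: "anchor e' \<le> k'" "k' \<le> e'" "0 < anchor e'" using composite_hangs[OF c r'] anchor_bounds(1) by auto
        \<comment> \<open>The only crossing path bond lies on \<open>(w, e, k)\<close>. Any other
          hanging snake has its first tile in \<open>A\<close> and hence all of its tiles.\<close>
        have same: "(w', e', k') = (w, e, k)"
        proof (rule ccontr)
          assume ne: "(w', e', k') \<noteq> (w, e, k)"
          have dis: "dom (hung_snake (w', e', k')) \<inter> dom (hung_snake (w, e, k)) = {}"
            using ne r r' c unfolding composite_def by blast
          have "w' + cell 3 i \<in> A \<longleftrightarrow> w' + cell 3 0 \<in> A"
          proof (rule int_interval_const[OF _ i(1,2)], rule ccontr)
            fix x assume x: "0 \<le> x" "x < k'" "(w' + cell 3 x \<in> A) \<noteq> (w' + cell 3 (x + 1) \<in> A)"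
            have "w' + cell 3 x \<in> dom (hung_snake (w', e', k'))" using x by (simp add: hung_snake_def cell_in_dom_track)
            moreover have "w + cell 3 c0 \<in> dom (hung_snake (w, e, k))" "w + cell 3 (c0 + 1) \<in> dom (hung_snake (w, e, k))"
              using c0 by (simp_all add: hung_snake_def cell_in_dom_track)
            ultimately show False using uniq[OF x] dis by (metis disjoint_iff)
          qed
          then show False using t0 qA i by simp
        qed
        have "anchor e < i"
        proof (rule ccontr)
          assume "\<not> anchor e < i"
          then have it: "i \<le> anchor e'" using same by simp
          \<comment> \<open>A cell of \<open>B\<close> up to the second anchor would have cells of
            \<open>A\<close> on both sides along the path, which requires two crossings.\<close>
          have ex: "\<exists>x. l \<le> x \<and> x < u \<and> (w' + cell 3 x \<in> A) \<noteq> (w' + cell 3 (x + 1) \<in> A)"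
            if "l \<le> u" "(w' + cell 3 u \<in> A) \<noteq> (w' + cell 3 l \<in> A)" for l u
            using int_interval_const[of l u "\<lambda>x. w' + cell 3 x \<in> A" u] that by blast
          obtain x where x: "0 \<le> x" "x < i" "(w' + cell 3 x \<in> A) \<noteq> (w' + cell 3 (x + 1) \<in> A)"
            using ex[OF i(1)] t0 qA i(3) by blast
          obtain y where y: "i \<le> y" "y < anchor e'" "(w' + cell 3 y \<in> A) \<noteq> (w' + cell 3 (y + 1) \<in> A)"
            using ex[OF it] t0 qA i(3) by blast
          have "x = c0" using uniq[of x] x i(2) same by auto
          moreover have "y = c0" using uniq[of y] y i(1) tk same by auto
          ultimately show False using x y by simp
        qed
        then show "q \<in> (\<lambda>i. w + cell 3 i) ` {anchor e + 1..e}" using i(2,3) same h(3) by auto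
      qed
      then have "card B \<le> card {anchor e + 1..e}" by (rule surj_card_le[rotated]) simp
      also have "\<dots> \<le> 2" by (auto simp: anchor_def)
      finally show ?thesis using big by simp
    next
      \<comment> \<open>Every hanging snake lies on one side. One of them in \<open>B\<close> costs
        two anchor bonds, strength 4, and a second one would exceed the bound; so \<open>B\<close>
        is exactly one snake.\<close>
      case False
      have whole: "w + cell 3 i \<in> A \<longleftrightarrow> w \<in> A" if r: "(w, e, k) \<in> H" and i: "0 \<le> i" "i \<le> k" for w e k i
        using int_interval_const[of 0 k "\<lambda>i. w + cell 3 i \<in> A" i] False r i by fastforce
      have wB: "w \<in> B" using whole[OF r i(1,2)] i(3) q f(3) Hin[OF r, of 0] i by auto
      have t: "0 < anchor e" "anchor e \<le> k" using composite_hangs[OF c r] anchor_bounds(1) by auto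
      have wtB: "w + cell 3 (anchor e) \<in> B"
        using whole[OF r, of "anchor e"] t wB f(3) Hin[OF r, of "anchor e"] by auto
      have other: "w' \<in> A" if r': "(w', e', k') \<in> H" and n: "(w', e', k') \<noteq> (w, e, k)" for w' e' k'
      proof (rule ccontr)
        assume "w' \<notin> A"
        then have w': "w' \<in> B" using anchor_in[OF r', of 0] by simp
        have dis: "dom (hung_snake (w', e', k')) \<inter> dom (hung_snake (w, e, k)) = {}"
          using n r r' c unfolding composite_def by blast
        have "0 \<le> k'" using composite_hangs(1,2)[OF c r'] anchor_bounds(1) by fastforce
        then have "w' \<in> dom (hung_snake (w', e', k'))" using cell_in_dom_track[of w' 3 0] by (simp add: hung_snake_def)
        moreover have "w \<in> dom (hung_snake (w, e, k))" "w + cell 3 (anchor e) \<in> dom (hung_snake (w, e, k))"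
          using cell_in_dom_track[of w 3 0] cell_in_dom_track[of w 3 "anchor e"] t by (simp_all add: hung_snake_def)
        ultimately have ne: "w' \<noteq> w" "w' \<noteq> w + cell 3 (anchor e)" using dis by auto
        have ne2: "w \<noteq> w + cell 3 (anchor e)" using t cell_eq_iff[of 3 0 "anchor e"] by simp
        let ?F = "{(w + (0, 1), w), (w + cell 3 (anchor e) + (0, 1), w + cell 3 (anchor e)), (w' + (0, 1), w')}"
        have "(\<Sum>(p, q)\<in>?F. bond \<gamma> p q) \<le> cut \<gamma> A B"
          by (rule cut_ge_sum[OF f(1,2)])
            (use anchA[OF r, of 0] anchA[OF r, of "anchor e"] anchA[OF r', of 0] wB wtB w' in auto)
        moreover have "bond \<gamma> (w + (0, 1)) w = 2" "bond \<gamma> (w' + (0, 1)) w' = 2"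
          "bond \<gamma> (w + cell 3 (anchor e) + (0, 1)) (w + cell 3 (anchor e)) = 2"
          using composite_anchor(1)[OF c r, of 0] composite_anchor(1)[OF c r', of 0] composite_anchor(1)[OF c r, of "anchor e"]
          by (simp_all add: bond_sym[of \<gamma> "_ + (0, 1)"])
        ultimately show False using cutAB ne ne2 by simp
      qed
      have Beq: "B = dom (hung_snake (w, e, k))"
      proof (intro equalityI subsetI)
        fix p assume p: "p \<in> B"
        show "p \<in> dom (hung_snake (w, e, k))"
        proof (rule composite_domE[OF c, of p], goal_cases)
          case 1
          show "p \<in> dom \<gamma>" using p dom by blast
        next
          case (2 j)
          then show ?case using GA[of j] p f(3) by blast
        next
          case (3 w' e' k' i)
          then have "w' \<notin> A" using whole[OF 3(1-3)] p f(3) by auto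
          then have "(w', e', k') = (w, e, k)" using other[OF 3(1)] by blast
          then show ?case using 3 by (simp add: hung_snake_def cell_in_dom_track)
        qed
      next
        fix p assume "p \<in> dom (hung_snake (w, e, k))"
        then obtain i where "0 \<le> i" "i \<le> k" "p = w + cell 3 i" by (auto simp: hung_snake_def dom_track)
        then show "p \<in> B" using whole[OF r, of i] wB f(3) Hin[OF r, of i] by auto
      qed
      have "\<beta> = hung_snake (w, e, k)"
      proof (rule map_eqI)
        fix p t
        show "\<beta> p = Some t \<longleftrightarrow> hung_snake (w, e, k) p = Some t"
        proof
          assume p: "\<beta> p = Some t"
          then have "p \<in> dom (hung_snake (w, e, k))" unfolding Beq[symmetric] B_def by blast
          then obtain t' where t': "hung_snake (w, e, k) p = Some t'" by blast
          then have "\<gamma> p = Some t'" using comp_Some[OF c] r by blast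
          then show "hung_snake (w, e, k) p = Some t" using p t' sub\<beta> by simp
        next
          assume p: "hung_snake (w, e, k) p = Some t"
          then have "\<gamma> p = Some t" using comp_Some[OF c] r by blast
          moreover have "p \<in> B" using p unfolding Beq by blast
          ultimately show "\<beta> p = Some t" using sub\<beta> by simp
        qed
      qed
      moreover have "is_snake (hung_snake (w, e, k))"
        using composite_hangs[OF c r] t unfolding is_snake_def hung_snake_def
        by (intro exI[of _ w] exI[of _ e] exI[of _ 0] exI[of _ k]) auto
      moreover have "composite \<alpha> v a b (H - {(w, e, k)})"
      proof (rule composite_restrict[OF c sub\<alpha>[unfolded A_def]], goal_cases)
        case (4 j)
        then show ?case using GA[of j] by (simp add: A_def)
      next
        case (6 r)
        obtain w' e' k' where r': "r = (w', e', k')" by (cases r) blast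
        then have "w' \<in> A" using other[of w' e' k'] 6 by blast
        then show ?case unfolding A_def[symmetric] using whole[of w' e' k'] 6
          by (auto simp: r' hung_snake_def dom_track)
      next
        case (7 r)
        then have "r = (w, e, k)" by blast
        then show ?case unfolding A_def[symmetric] Beq[symmetric] using f(3) Beq by blast
      next
        case (8 w' e' k')
        then show ?case unfolding A_def[symmetric]
          using anchA[of w' e' k' 0] anchA[of w' e' k' "anchor e'"] by auto
      qed (use ab in auto)
      ultimately show ?thesis unfolding is_composite_def by blast
    qed
  qed
qed

section \<open>The invariant\<close>

lemma dom_translate: "p \<in> dom (translate u \<alpha>) \<longleftrightarrow> p - u \<in> dom \<alpha>"
  by (simp add: dom_def translate_eq)

lemma dom_translate_image: "dom (translate u \<alpha>) = (\<lambda>p. p + u) ` dom \<alpha>"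
proof (intro set_eqI iffI)
  fix p assume "p \<in> dom (translate u \<alpha>)"
  then show "p \<in> (\<lambda>p. p + u) ` dom \<alpha>"
    unfolding dom_translate by (intro image_eqI[of _ _ "p - u"]) simp_all
next
  fix p assume "p \<in> (\<lambda>p. p + u) ` dom \<alpha>"
  then obtain q where "p = q + u" "q \<in> dom \<alpha>" by blast
  then show "p \<in> dom (translate u \<alpha>)" unfolding dom_translate by simp
qed

lemma producible_finite:
  assumes "producible str T \<tau> \<gamma>"
  shows "finite (dom \<gamma>) \<and> dom \<gamma> \<noteq> {}"
  using assms
proof induction
  case (single t p)
  have "dom [p \<mapsto> t] = {p}" by (auto split: if_splits)
  then show ?case by (simp only:) simp
next
  case (transl \<alpha> v)
  then show ?case unfolding dom_translate_image by simp
next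
  case (comb \<alpha> \<beta> \<gamma>)
  then show ?case unfolding can_combine_def by simp
next
  case (brk1 \<gamma> \<alpha> \<beta>)
  then show ?case unfolding can_break_def by (metis dom_map_add finite_Un)
next
  case (brk2 \<gamma> \<alpha> \<beta>)
  then show ?case unfolding can_break_def by (metis dom_map_add finite_Un)
qed

lemma composite_canopy: "a \<le> b \<Longrightarrow> composite (canopy v a b) v a b {}"
  by (simp add: composite_def)

lemma hung_snake_move: "hung_snake (w + u, e, c) p = hung_snake (w, e, c) (p - u)"
  using translate_eq[of u "snake w e 0 c" p] by (simp add: hung_snake_def translate_track)

lemma composite_translate:
  assumes c: "composite \<gamma> v a b H"
  shows "composite (translate u \<gamma>) (v + u) a b ((\<lambda>(w, e, c). (w + u, e, c)) ` H)"
  unfolding composite_def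
proof (intro conjI allI ballI impI)
  have G: "canopy (v + u) a b p = canopy v a b (p - u)" for p
    using translate_eq[of u "canopy v a b" p] by (simp add: translate_track)
  then have domG: "p + u \<in> dom (canopy (v + u) a b) \<longleftrightarrow> p \<in> dom (canopy v a b)" for p
    by (simp add: dom_def)
  show "a \<le> b" using c by (simp add: composite_def)
  show "translate u \<gamma> p = Some t \<longleftrightarrow> canopy (v + u) a b p = Some t \<or>
      (\<exists>r\<in>(\<lambda>(w, e, c). (w + u, e, c)) ` H. hung_snake r p = Some t)" for p t
  proof -
    have "hung_snake ((\<lambda>(w, e, c). (w + u, e, c)) r) p = hung_snake r (p - u)" for r
      by (cases r) (simp add: hung_snake_move)
    then show ?thesis unfolding translate_eq comp_Some[OF c] G by simp
  qed
  show "hangs (v + u) a b r" if r: "r \<in> (\<lambda>(w, e, c). (w + u, e, c)) ` H" for r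
  proof -
    obtain w e k where k: "(w, e, k) \<in> H" "r = (w + u, e, k)" using r by auto
    note h = composite_hangs[OF c k(1)]
    have eq: "w + u + (0, 1) = w + (0, 1) + u"
      "w + u + cell 3 (anchor e) + (0, 1) = w + cell 3 (anchor e) + (0, 1) + u" by (simp_all add: ac_simps)
    have "w + u + (0, 1) \<in> dom (canopy (v + u) a b)" "w + u + cell 3 (anchor e) + (0, 1) \<in> dom (canopy (v + u) a b)"
      unfolding eq domG using h(5,6) by blast+
    then show ?thesis using h(1-4) unfolding k(2) hangs_def by simp
  qed
  show "dom (hung_snake r) \<inter> dom (hung_snake r') = {}"
    if r: "r \<in> (\<lambda>(w, e, c). (w + u, e, c)) ` H" "r' \<in> (\<lambda>(w, e, c). (w + u, e, c)) ` H" "r \<noteq> r'" for r r'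
  proof -
    obtain w e k where k: "(w, e, k) \<in> H" "r = (w + u, e, k)" using r by auto
    obtain w' e' k' where k': "(w', e', k') \<in> H" "r' = (w' + u, e', k')" using r by auto
    have ne: "(w, e, k) \<noteq> (w', e', k')" using k k' r(3) by auto
    then have dd: "dom (hung_snake (w, e, k)) \<inter> dom (hung_snake (w', e', k')) = {}"
      using c k(1) k'(1) unfolding composite_def by blast
    have "p - u \<in> dom (hung_snake (w, e, k)) \<and> p - u \<in> dom (hung_snake (w', e', k'))" if "p \<in> dom (hung_snake r) \<inter> dom (hung_snake r')" for p
      using that unfolding k(2) k'(2) dom_def by (simp add: hung_snake_move)
    then show ?thesis using dd by blast
  qed
qed

text \<open>The lower bound 3 forbids binding by a single anchor. The upper bound 5 limits the cut
  of a break to 4. The bound for sizes up to 2 protects the tiles behind the second anchor of a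
  hanging snake, which hang on one path bond.\<close>

lemma producible_snake_or_composite:
  assumes "producible strength tiles \<tau> \<gamma>"
    and \<tau>: "\<And>n. 3 \<le> \<tau> n" "\<And>n. \<tau> n \<le> 5" "\<And>n. n \<le> 2 \<Longrightarrow> \<tau> n \<le> 3"
  shows "is_snake \<gamma> \<or> is_composite \<gamma>"
proof -
  have brk: "is_snake \<alpha> \<or> is_composite \<alpha>" if inv: "is_snake \<gamma> \<or> is_composite \<gamma>" and br: "can_break strength \<tau> \<gamma> \<alpha> \<beta>" and fin: "finite (dom \<gamma>)"
    for \<gamma> \<alpha> \<beta>
  proof -
    have swap: "can_break strength \<tau> \<gamma> \<beta> \<alpha>" using can_break_commute[OF br] by simp
    have facts: "\<gamma> = \<alpha> ++ \<beta>" "dom \<alpha> \<inter> dom \<beta> = {}" "dom \<alpha> \<noteq> {}" "dom \<beta> \<noteq> {}" "cut \<gamma> (dom \<alpha>) (dom \<beta>) < 5"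
      "card (dom \<beta>) \<le> 2 \<Longrightarrow> cut \<gamma> (dom \<alpha>) (dom \<beta>) < 3"
      if "can_break strength \<tau> \<gamma> \<alpha> \<beta>" for \<alpha> \<beta>
    proof -
      let ?m = "min (card (dom \<alpha>)) (card (dom \<beta>))"
      have cu: "cut \<gamma> (dom \<alpha>) (dom \<beta>) < \<tau> ?m" using that unfolding can_break_def by blast
      show "\<gamma> = \<alpha> ++ \<beta>" "dom \<alpha> \<inter> dom \<beta> = {}" "dom \<alpha> \<noteq> {}" "dom \<beta> \<noteq> {}"
        using that unfolding can_break_def by blast+
      show "cut \<gamma> (dom \<alpha>) (dom \<beta>) < 5" using cu \<tau>(2)[of ?m] by linarith
      show "cut \<gamma> (dom \<alpha>) (dom \<beta>) < 3" if "card (dom \<beta>) \<le> 2"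
        using cu \<tau>(3)[of ?m] that by linarith
    qed
    note f = facts[OF br] and f' = facts[OF swap]
    from inv show ?thesis
    proof
      assume "is_snake \<gamma>"
      moreover have "cut \<gamma> (dom \<alpha>) (dom \<beta>) < 6" using f(5) by linarith
      ultimately have "is_snake \<alpha>" using is_snake_break[of \<alpha> \<beta>] f(1-4) by blast
      then show ?thesis ..
    next
      assume "is_composite \<gamma>"
      then obtain v a b H where c: "composite \<gamma> v a b H" unfolding is_composite_def by blast
      then have "v + cell 4 a \<in> dom \<gamma>" using composite_canopy_tile[OF c, of a] by (auto simp: composite_def)
      \<comment> \<open>\<open>composite_break\<close> expects the start of the canopy in its first
        part; otherwise the two parts change roles.\<close>
      then consider "v + cell 4 a \<in> dom \<alpha>" | "v + cell 4 a \<in> dom \<beta>" unfolding f(1) by auto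
      then show ?thesis
      proof cases
        case 1
        show ?thesis using composite_break[OF c f(1,2,4) fin f(5,6) 1] by blast
      next
        case 2
        show ?thesis using composite_break[OF c f'(1,2,4) fin f'(5,6) 2] by blast
      qed
    qed
  qed
  from assms(1) show ?thesis
  proof induction
    case (single t p)
    then consider e i where "valid_end e" "0 \<le> i" "i \<le> e" "t = snake_tile e i" | i where "t = canopy_tile i"
      unfolding tiles_def by blast
    then show ?case
    proof cases
      case 1
      have "[p \<mapsto> t] = snake (p - cell 3 i) e i i" unfolding track_single 1(4) by simp
      then have "is_snake [p \<mapsto> t]" unfolding is_snake_def using 1 by blast
      then show ?thesis ..
    next
      case 2
      have "[p \<mapsto> t] = canopy (p - cell 4 i) i i" unfolding track_single 2 by simp
      then have "is_composite [p \<mapsto> t]" unfolding is_composite_def using composite_canopy[OF order_refl] by metis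
      then show ?thesis ..
    qed
  next
    case (transl \<alpha> v)
    then show ?case
    proof (elim disjE)
      assume "is_snake \<alpha>"
      then have "is_snake (translate v \<alpha>)" unfolding is_snake_def using translate_track by metis
      then show ?thesis ..
    next
      assume "is_composite \<alpha>"
      then have "is_composite (translate v \<alpha>)" unfolding is_composite_def using composite_translate by metis
      then show ?thesis ..
    qed
  next
    case (comb \<alpha> \<beta> \<gamma>)
    let ?m = "min (card (dom \<alpha>)) (card (dom \<beta>))"
    have g: "\<gamma> = \<alpha> ++ \<beta>" and d: "dom \<alpha> \<inter> dom \<beta> = {}" and cu: "\<tau> ?m \<le> cut \<gamma> (dom \<alpha>) (dom \<beta>)"
      using comb(3) unfolding can_combine_def by blast+
    have cu2: "2 < cut (\<alpha> ++ \<beta>) (dom \<alpha>) (dom \<beta>)" using cu \<tau>(1)[of ?m] g by simp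
    then have cu0: "0 < cut (\<alpha> ++ \<beta>) (dom \<alpha>) (dom \<beta>)" by simp
    have fin: "finite (dom \<alpha>)" "finite (dom \<beta>)" using producible_finite comb(1,2) by blast+
    have d': "dom \<beta> \<inter> dom \<alpha> = {}" using d by blast
    have sw: "\<alpha> ++ \<beta> = \<beta> ++ \<alpha>" by (rule map_add_comm[OF d])
    have cu2': "2 < cut (\<beta> ++ \<alpha>) (dom \<beta>) (dom \<alpha>)"
      using cu2 unfolding sw cut_commute[of _ "dom \<beta>"] .
    consider "is_snake \<alpha>" "is_snake \<beta>" | "is_snake \<alpha>" "is_composite \<beta>" | "is_composite \<alpha>" "is_snake \<beta>" | "is_composite \<alpha>" "is_composite \<beta>"
      using comb.IH by blast
    then show ?case
    proof cases
      case 1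
      then show ?thesis using is_snake_combine[OF 1 d cu0] g by simp
    next
      case 2
      then show ?thesis using is_composite_combine_snake[OF 2(1) _ d fin(2) cu2] g unfolding is_composite_def[of \<beta>] by blast
    next
      case 3
      then show ?thesis using is_composite_combine_snake[OF 3(2) _ d' fin(1) cu2'] g sw unfolding is_composite_def[of \<alpha>] by metis
    next
      case 4
      then show ?thesis using is_composite_combine[OF _ _ d cu0] g unfolding is_composite_def[of \<alpha>] is_composite_def[of \<beta>] by blast
    qed
  next
    case (brk1 \<gamma> \<alpha> \<beta>)
    show ?case using brk[OF brk1.IH brk1(2)] producible_finite[OF brk1(1)] by blast
  next
    case (brk2 \<gamma> \<alpha> \<beta>)
    have "can_break strength \<tau> \<gamma> \<beta> \<alpha>" using can_break_commute[OF brk2(2)] by simp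
    then show ?case using brk[OF brk2.IH] producible_finite[OF brk2(1)] by blast
  qed
qed

section \<open>Terminal assemblies\<close>

lemma terminalD:
  assumes "terminal str T \<tau> \<gamma>"
  shows "producible str T \<tau> \<gamma>" "producible str T \<tau> \<beta> \<Longrightarrow> \<not> can_combine str \<tau> \<gamma> \<beta> \<delta>"
    "\<not> can_break str \<tau> \<gamma> \<alpha> \<beta>"
  using assms unfolding terminal_def by (metis translate_0)+

text \<open>A single tile can be added at temperature \<open>\<tau> 1\<close>, so a free
  neighbouring cell of the path is incompatible with being terminal.\<close>

lemma terminal_no_extension:
  assumes t: "terminal strength T \<tau> \<gamma>" and "\<tau> 1 \<le> 3" "t \<in> T" "p \<in> dom \<gamma>" "q \<notin> dom \<gamma>"
  shows "bond (\<gamma> ++ [q \<mapsto> t]) p q < 3"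
proof (rule ccontr)
  assume big: "\<not> bond (\<gamma> ++ [q \<mapsto> t]) p q < 3"
  have fin: "finite (dom \<gamma>)" using producible_finite[OF terminalD(1)[OF t]] by blast
  have "3 \<le> cut (\<gamma> ++ [q \<mapsto> t]) (dom \<gamma>) (dom [q \<mapsto> t])"
    using cut_ge_bond[OF fin, of "dom [q \<mapsto> t]" p q "\<gamma> ++ [q \<mapsto> t]"] assms(4) big by simp
  moreover have "min (card (dom \<gamma>)) (card (dom [q \<mapsto> t])) = 1"
    using fin assms(4) card_gt_0_iff[of "dom \<gamma>"] by auto
  ultimately have "can_combine strength \<tau> \<gamma> [q \<mapsto> t] (\<gamma> ++ [q \<mapsto> t])"
    unfolding can_combine_def using assms(2,5) by auto
  then show False using terminalD(2)[OF t producible.single[OF assms(3)]] by blast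
qed

lemma canopy_tile_in_tiles: "canopy_tile i \<in> tiles"
  by (simp add: tiles_def)

lemma snake_tile_in_tiles: "valid_end e \<Longrightarrow> 0 \<le> i \<Longrightarrow> i \<le> e \<Longrightarrow> snake_tile e i \<in> tiles"
  unfolding tiles_def by blast

text \<open>The cell following the canopy is always free: the path does not meet itself, and the
  hanging snakes lie in lower rows.\<close>

lemma composite_not_terminal:
  assumes c: "composite \<gamma> v a b H" and "\<tau> 1 \<le> 3"
  shows "\<not> terminal strength tiles \<tau> \<gamma>"
proof
  assume t: "terminal strength tiles \<tau> \<gamma>"
  let ?p = "v + cell 4 b" and ?q = "v + cell 4 (b + 1)"
  have ab: "a \<le> b" using c by (simp add: composite_def)
  have p: "\<gamma> ?p = Some (canopy_tile b)" using composite_canopy_tile[OF c ab] by simp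
  have q: "?q \<notin> dom \<gamma>"
  proof
    assume "?q \<in> dom \<gamma>"
    then show False
    proof (rule composite_domE[OF c], goal_cases)
      case (1 j)
      then show ?case by simp
    next
      case (2 w e k i)
      from arg_cong[OF 2(4), of snd] show ?case
        using composite_hangs(4)[OF c 2(1)] cell_row[of 3 i] cell_row[of 4 "b + 1"] by simp
    qed
  qed
  have "bond (\<gamma> ++ [?q \<mapsto> canopy_tile (b + 1)]) ?p ?q = 3"
    by (rule linked_bond[OF linked_canopy[of b "b + 1"]]) (use p in \<open>auto simp: map_add_def\<close>)
  then show False
    using terminal_no_extension[OF t assms(2) canopy_tile_in_tiles _ q, of ?p "b + 1"] p by auto
qed

lemma terminal_snake_full:
  assumes R: "valid_end e" "0 \<le> a" "a \<le> b" "b \<le> e" and "\<tau> 1 \<le> 3" and t: "terminal strength tiles \<tau> (snake v e a b)"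
  shows "a = 0 \<and> b = e"
proof (intro conjI; rule ccontr)
  let ?\<gamma> = "snake v e a b"
  assume "a \<noteq> 0"
  then have a: "0 \<le> a - 1" using R by simp
  let ?p = "v + cell 3 a" and ?q = "v + cell 3 (a - 1)"
  have q: "?q \<notin> dom ?\<gamma>" by (simp add: cell_in_dom_track)
  have p: "?\<gamma> ?p = Some (snake_tile e a)" using R by (intro track_cell) auto
  let ?\<delta> = "?\<gamma> ++ [?q \<mapsto> snake_tile e (a - 1)]"
  have "?\<delta> (v + cell 3 (a - 1)) = Some (snake_tile e (a - 1))" "?\<delta> (v + cell 3 (a - 1 + 1)) = Some (snake_tile e (a - 1 + 1))"
    using p by (simp_all add: map_add_def)
  from linked_bond[OF linked_snake[of e] a _ this] R(3,4)
  have "bond ?\<delta> ?q (v + cell 3 (a - 1 + 1)) = 3" by linarith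
  then have "bond ?\<delta> ?q ?p = 3" unfolding diff_add_cancel .
  then show False
    using terminal_no_extension[OF t assms(5) snake_tile_in_tiles[OF R(1) a] _ q, of ?p] p R bond_sym[of ?\<delta> ?q ?p] by auto
next
  let ?\<gamma> = "snake v e a b"
  assume "b \<noteq> e"
  then have b: "b + 1 \<le> e" using R by simp
  let ?p = "v + cell 3 b" and ?q = "v + cell 3 (b + 1)"
  have q: "?q \<notin> dom ?\<gamma>" by (simp add: cell_in_dom_track)
  have p: "?\<gamma> ?p = Some (snake_tile e b)" using R by (intro track_cell) auto
  let ?\<delta> = "?\<gamma> ++ [?q \<mapsto> snake_tile e (b + 1)]"
  have "?\<delta> ?p = Some (snake_tile e b)" "?\<delta> ?q = Some (snake_tile e (b + 1))"
    using p by (simp_all add: map_add_def)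
  from linked_bond[OF linked_snake[of e] _ _ this] R(2,3) b have "bond ?\<delta> ?p ?q = 3" by linarith
  then show False
    using terminal_no_extension[OF t assms(5) snake_tile_in_tiles[OF R(1) _ b] _ q, of ?p] p R by auto
qed

lemma cell_anchor:
  assumes "valid_end e" "e + 1 = 3 * j"
  shows "cell 3 (anchor e) = (j - 1, 0)"
proof -
  have "anchor e div 3 = j - 1" using assms(2) unfolding anchor_def by presburger
  moreover have "fst (cell 3 (anchor e)) = anchor e div 3" by (simp add: cell_def)
  ultimately show ?thesis using snake_top_row[OF assms(1), of "anchor e"] by (simp add: prod_eq_iff)
qed

text \<open>A canopy is chosen that covers both anchors and has more tiles than the snake. The
  relevant temperature is then that of the size of the snake, and the two anchor bonds provide
  4.\<close>

lemma short_snake_not_terminal: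
  assumes e: "valid_end e" "e + 1 = 3 * j" and \<tau>: "\<tau> 1 \<le> 3" "\<tau> (nat (3 * j)) \<le> 4"
  shows "\<not> terminal strength tiles \<tau> (snake v e 0 e)"
proof
  assume t: "terminal strength tiles \<tau> (snake v e 0 e)"
  have j: "1 \<le> j" using e unfolding valid_end_def by auto
  \<comment> \<open>The lowest canopy row, -3 relative to \<open>u\<close>, comes to lie directly
    above the top row of the snake.\<close>
  define u where "u = v + (0, 4)"
  \<comment> \<open>Index of the bottom canopy cell in the column of the second anchor; the one
    above the first anchor has index 3.\<close>
  define i1 where "i1 = cell_index 4 (j - 1, -3)"
  let ?R = "snake v e 0 e" and ?G = "canopy u 0 (4 * j)"
  let ?\<gamma> = "?R ++ ?G"
  have c1: "cell 4 i1 = (j - 1, -3)" unfolding i1_def by (rule cell_cell_index) auto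
  have i1: "0 \<le> i1" "i1 \<le> 4 * j" using j by (auto simp: i1_def cell_index_def)
  have c0: "cell 4 3 = (0, -3)" by (simp add: cell_def)
  have d: "dom ?R \<inter> dom ?G = {}"
  proof (rule ccontr)
    assume "dom ?R \<inter> dom ?G \<noteq> {}"
    then obtain i k where ik: "v + cell 3 i = u + cell 4 k" unfolding dom_track by blast
    from arg_cong[OF ik, of snd] show False
      using cell_row[of 3 i] cell_row[of 4 k] by (simp add: u_def)
  qed
  have tp: "0 < anchor e" "anchor e \<le> e" using anchor_bounds e by auto
  have R: "?\<gamma> (v + cell 3 i) = Some (snake_tile e i)" if "0 \<le> i" "i \<le> e" for i
    by (rule map_add_Some_left[OF d track_cell[OF that]])
  have G: "?\<gamma> (u + cell 4 k) = Some (canopy_tile k)" if "0 \<le> k" "k \<le> 4 * j" for k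
    by (intro map_add_Some_right track_cell that)
  have pos: "u + cell 4 3 = v + cell 3 0 + (0, 1)" "u + cell 4 i1 = v + cell 3 (anchor e) + (0, 1)"
    unfolding u_def c0 c1 cell_anchor[OF e] by (auto simp: prod_eq_iff)
  have b: "bond ?\<gamma> (v + cell 3 0) (v + cell 3 0 + (0, 1)) = 2"
    "bond ?\<gamma> (v + cell 3 (anchor e)) (v + cell 3 (anchor e) + (0, 1)) = 2"
    using anchor_bond[OF e(1) _ _ pos(1), of ?\<gamma>] anchor_bond[OF e(1) _ _ pos(2), of ?\<gamma>]
      R[of 0] R[of "anchor e"] G[of 3] G[of i1] tp i1 j c0 c1 by auto
  have "bond ?\<gamma> (v + cell 3 0) (v + cell 3 0 + (0, 1)) +
      bond ?\<gamma> (v + cell 3 (anchor e)) (v + cell 3 (anchor e) + (0, 1)) \<le> cut ?\<gamma> (dom ?R) (dom ?G)"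
  proof (rule cut_ge_two[OF _ _ d])
    show "v + cell 3 0 \<in> dom ?R \<and> v + cell 3 0 + (0, 1) \<in> dom ?G \<or>
      v + cell 3 0 \<in> dom ?G \<and> v + cell 3 0 + (0, 1) \<in> dom ?R"
      unfolding pos(1)[symmetric] cell_in_dom_track using tp j by simp
    show "v + cell 3 (anchor e) \<in> dom ?R \<and> v + cell 3 (anchor e) + (0, 1) \<in> dom ?G \<or>
      v + cell 3 (anchor e) \<in> dom ?G \<and> v + cell 3 (anchor e) + (0, 1) \<in> dom ?R"
      unfolding pos(2)[symmetric] cell_in_dom_track using tp i1 by simp
    show "{v + cell 3 0, v + cell 3 0 + (0, 1)} \<noteq> {v + cell 3 (anchor e), v + cell 3 (anchor e) + (0, 1)}"
      unfolding cell_anchor[OF e] doubleton_eq_iff using tp cell_anchor[OF e] cell_eq_iff[of 3 0 "anchor e"]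
      by (auto simp: prod_eq_iff)
  qed simp_all
  then have "4 \<le> cut ?\<gamma> (dom ?R) (dom ?G)" using b by simp
  moreover have "min (card (dom ?R)) (card (dom ?G)) = nat (3 * j)"
    using e(2) j by (simp add: card_dom_track)
  ultimately have "can_combine strength \<tau> ?R ?G ?\<gamma>"
    unfolding can_combine_def using d \<tau>(2) by simp
  moreover have "producible strength tiles \<tau> ?G"
    by (rule track_producible[where \<tau> = \<tau>, OF linked_canopy \<tau>(1)]) (use j canopy_tile_in_tiles in auto)
  ultimately show False using terminalD(2)[OF t] by blast
qed

lemma strength_le: "strength g \<le> 3"
  by (simp add: strength_def)

lemma bond_le: "bond \<gamma> p q \<le> 3"
  by (auto simp: bond_eq strength_le split: option.splits)

text \<open>Tiles that touch without being consecutive on the path have no bond, so splitting the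
  path in the middle cuts a single bond of strength 3.\<close>

lemma long_snake_not_terminal:
  assumes e: "valid_end e" and \<tau>: "3 < \<tau> (nat ((e + 1) div 2))"
  shows "\<not> terminal strength tiles \<tau> (snake v e 0 e)"
proof
  assume t: "terminal strength tiles \<tau> (snake v e 0 e)"
  define m where "m = (e + 1) div 2"
  have m: "0 < m" "m \<le> e" using e unfolding valid_end_def m_def by auto
  let ?\<gamma> = "snake v e 0 e" and ?A = "snake v e 0 (m - 1)" and ?B = "snake v e m e"
  have \<gamma>: "?\<gamma> = ?A ++ ?B" using track_append[of 0 "m - 1" e 3 "snake_tile e" v] m by simp
  have d: "dom ?A \<inter> dom ?B = {}" by (rule track_disjoint) simp
  have "cut ?\<gamma> (dom ?A) (dom ?B) \<le> 3 * card {(v + cell 3 (m - 1), v + cell 3 m)}"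
  proof (rule cut_le)
    fix p q assume pq: "p \<in> dom ?A" "q \<in> dom ?B" "0 < bond ?\<gamma> p q"
    obtain i where i: "0 \<le> i" "i \<le> m - 1" "p = v + cell 3 i" using pq(1) unfolding dom_track by auto
    obtain k where k: "m \<le> k" "k \<le> e" "q = v + cell 3 k" using pq(2) unfolding dom_track by auto
    have le: "i \<le> e" "k \<le> e" using i k m by auto
    have g: "?\<gamma> (v + cell 3 i) = Some (snake_tile e i)" "?\<gamma> (v + cell 3 k) = Some (snake_tile e k)"
      using i k m by (auto intro!: track_cell)
    have "i + 1 = k"
      by (rule snake_snake_cross[OF e e le g pq(3)[unfolded i(3) k(3)]]) (use i k in simp_all)
    then have "i = m - 1" "k = m" using i k by auto
    then show "(p, q) \<in> {(v + cell 3 (m - 1), v + cell 3 m)} \<and> bond ?\<gamma> p q \<le> 3"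
      using i k bond_le by simp
  qed simp_all
  moreover have "min (card (dom ?A)) (card (dom ?B)) = nat ((e + 1) div 2)"
    using m by (simp add: card_dom_track m_def min_def)
  moreover have "dom ?A \<noteq> {}" "dom ?B \<noteq> {}" using m by (simp_all add: dom_track)
  moreover have "bond_connected strength ?A" "bond_connected strength ?B"
    using m by (intro track_connected linked_mono[OF linked_snake]; simp)+
  ultimately have "can_break strength \<tau> ?\<gamma> ?A ?B"
    unfolding can_break_def using \<gamma> d \<tau> by simp
  then show False using terminalD(3)[OF t] by blast
qed

text \<open>A bond would have to continue the path beyond \<open>e\<close> or to precede 0, but the
  outer glues are missing there.\<close>

lemma full_snake_no_bond:
  assumes e: "valid_end e" and R: "valid_end e'" "0 \<le> a" "a \<le> b" "b \<le> e'"
    and d: "dom (snake v e 0 e) \<inter> dom (snake w e' a b) = {}"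
    and \<gamma>: "\<And>i. 0 \<le> i \<Longrightarrow> i \<le> e \<Longrightarrow> \<gamma> (v + cell 3 i) = Some (snake_tile e i)"
      "\<And>i. a \<le> i \<Longrightarrow> i \<le> b \<Longrightarrow> \<gamma> (w + cell 3 i) = Some (snake_tile e' i)"
    and pq: "p \<in> dom (snake v e 0 e)" "q \<in> dom (snake w e' a b)"
  shows "bond \<gamma> p q = 0"
proof (rule ccontr)
  assume "bond \<gamma> p q \<noteq> 0"
  then have pos: "0 < bond \<gamma> p q" by simp
  obtain i where i: "0 \<le> i" "i \<le> e" "p = v + cell 3 i" using pq(1) unfolding dom_track by auto
  obtain k where k: "a \<le> k" "k \<le> b" "q = w + cell 3 k" using pq(2) unfolding dom_track by auto
  have d': "dom (snake w e' a b) \<inter> dom (snake v e 0 e) = {}" using d by blast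
  have ke: "k \<le> e'" using k R by simp
  show False
  proof (rule snake_snake_cross[OF e R(1) i(2) ke \<gamma>(1)[OF i(1,2)] \<gamma>(2)[OF k(1,2)] pos[unfolded i(3) k(3)]], goal_cases)
    case 1
    show False using track_ends[OF d i(1,2) k(1,2) 1(4,5)] 1(1) by simp
  next
    case 2
    show False using track_ends[OF d' k(1,2) i(1,2) 2(4,5)] 2(2) by simp
  qed
qed

text \<open>Each column has 4 consecutive indices. In the worst case the first cell is the last of
  its column and the second the first of its own, which gives a distance of 4(j - 1) - 3.\<close>

lemma canopy_span:
  assumes "w + (0, 1) \<in> dom (canopy v a b)" "w + (j - 1, 0) + (0, 1) \<in> dom (canopy v a b)"
  shows "4 * j - 6 \<le> b - a + 1"
proof -
  obtain x where x: "a \<le> x" "x \<le> b" "w + (0, 1) = v + cell 4 x" using assms(1) unfolding dom_track by auto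
  obtain y where y: "a \<le> y" "y \<le> b" "w + (j - 1, 0) + (0, 1) = v + cell 4 y" using assms(2) unfolding dom_track by auto
  have "y div 4 = x div 4 + (j - 1)"
    using arg_cong[OF x(3), of fst] arg_cong[OF y(3), of fst] by (simp add: cell_def)
  then show ?thesis using x y by linarith
qed

text \<open>The last two conditions on \<tau> answer the two threats. A break has a smaller part of
  at most half the tiles, and every cut of the path has strength at least 3. A partner that reaches
  both anchors has at least 3j - 2 tiles, so strength 5 is needed where the anchors give 4.\<close>

lemma exact_snake_terminal:
  fixes j :: int
  assumes e: "valid_end e" "e + 1 = 3 * j" and j: "4 \<le> j" and mono: "mono \<tau>"
    and \<tau>: "\<And>n. 3 \<le> \<tau> n" "\<And>n. \<tau> n \<le> 5" "\<And>n. n \<le> 2 \<Longrightarrow> \<tau> n \<le> 3"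
      "\<tau> (nat (3 * j div 2)) \<le> 3" "5 \<le> \<tau> (nat (3 * j - 2))"
  shows "terminal strength tiles \<tau> (snake v0 e 0 e)"
  unfolding terminal_def translate_track
proof (intro conjI allI impI)
  have "\<tau> 1 \<le> 3" using \<tau>(3) by simp
  then show "producible strength tiles \<tau> (snake v0 e 0 e)"
    by (rule track_producible[OF linked_snake]) (use e(1) snake_tile_in_tiles in \<open>auto simp: valid_end_def\<close>)
next
  fix u \<beta> \<delta> assume pb: "producible strength tiles \<tau> \<beta>"
  define v where "v = v0 + u"
  let ?R = "snake v e 0 e"
  show "\<not> can_combine strength \<tau> (snake (v0 + u) e 0 e) \<beta> \<delta>"
  proof
    assume "can_combine strength \<tau> (snake (v0 + u) e 0 e) \<beta> \<delta>"
    then have d: "dom ?R \<inter> dom \<beta> = {}"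
      and cu: "\<tau> (min (card (dom ?R)) (card (dom \<beta>))) \<le> cut (?R ++ \<beta>) (dom ?R) (dom \<beta>)"
      unfolding can_combine_def v_def[symmetric] by blast+
    let ?\<gamma> = "?R ++ \<beta>"
    have cu2: "2 < cut ?\<gamma> (dom ?R) (dom \<beta>)"
      using cu \<tau>(1)[of "min (card (dom ?R)) (card (dom \<beta>))"] by linarith
    have fin: "finite (dom \<beta>)" using producible_finite[OF pb] by blast
    have R: "?\<gamma> (v + cell 3 i) = Some (snake_tile e i)" if "0 \<le> i" "i \<le> e" for i
      by (rule map_add_Some_left[OF d track_cell[OF that]])
    from producible_snake_or_composite[OF pb \<tau>(1-3)] show False
    proof
      assume "is_snake \<beta>"
      then obtain w e' a b where \<beta>: "valid_end e'" "0 \<le> a" "a \<le> b" "b \<le> e'" "\<beta> = snake w e' a b"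
        unfolding is_snake_def by blast
      have "0 < cut ?\<gamma> (dom ?R) (dom \<beta>)" using cu2 by simp
      from cut_pos_imp[OF this]
      obtain p q where pq: "p \<in> dom ?R" "q \<in> dom \<beta>" "0 < bond ?\<gamma> p q" .
      have B: "?\<gamma> (w + cell 3 i) = Some (snake_tile e' i)" if "a \<le> i" "i \<le> b" for i
        unfolding \<beta>(5) by (intro map_add_Some_right track_cell that)
      show False
        using full_snake_no_bond[OF e(1) \<beta>(1-4) d[unfolded \<beta>(5)] R B pq(1) pq(2)[unfolded \<beta>(5)]] pq(3) by simp
    next
      assume "is_composite \<beta>"
      then obtain w a b H where c: "composite \<beta> w a b H" unfolding is_composite_def by blast
      have no: "\<forall>r\<in>H. \<forall>p\<in>dom ?R. \<forall>q\<in>dom (hung_snake r). bond ?\<gamma> p q = 0"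
      proof (intro ballI)
        fix r p q assume r: "r \<in> H" and p: "p \<in> dom ?R" and q: "q \<in> dom (hung_snake r)"
        obtain x e' k where k: "r = (x, e', k)" by (cases r) blast
        note h = composite_hangs[OF c r[unfolded k]]
        have k0: "0 \<le> k" using anchor_bounds(1)[OF h(1)] h(2) by simp
        have sub: "dom (snake x e' 0 k) \<subseteq> dom \<beta>" using composite_dom_hung_snake[OF c r] by (simp add: k hung_snake_def)
        then have dd: "dom ?R \<inter> dom (snake x e' 0 k) = {}" using d by blast
        have B: "?\<gamma> (x + cell 3 i) = Some (snake_tile e' i)" if "0 \<le> i" "i \<le> k" for i
          by (intro map_add_Some_right composite_snake_tile[OF c r[unfolded k] that])
        show "bond ?\<gamma> p q = 0"
          by (rule full_snake_no_bond[OF e(1) h(1) order_refl k0 h(3) dd R B p])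
            (use q in \<open>simp_all add: k hung_snake_def\<close>)
      qed
      have "hangs w a b (v, e, e)"
        using snake_hangs[OF e(1) order_refl order_refl refl c d fin no cu2] by blast
      then have an: "v + (0, 1) \<in> dom (canopy w a b)" "v + cell 3 (anchor e) + (0, 1) \<in> dom (canopy w a b)"
        unfolding hangs_def by auto
      have "4 * j - 6 \<le> b - a + 1"
        using canopy_span[OF an[unfolded cell_anchor[OF e]]] .
      \<comment> \<open>The hypothesis \<open>4 \<le> j\<close> enters here, as 4j - 6 must be at
        least 3j - 2.\<close>
      then have "3 * j - 2 \<le> b - a + 1" using j by simp
      then have "nat (3 * j - 2) \<le> card (dom (canopy w a b))" by (simp add: card_dom_track)
      also have "\<dots> \<le> card (dom \<beta>)" by (rule card_mono[OF fin composite_dom_canopy[OF c]])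
      finally have "nat (3 * j - 2) \<le> min (card (dom ?R)) (card (dom \<beta>))"
        using e(2) by (simp add: card_dom_track)
      then have "5 \<le> cut ?\<gamma> (dom ?R) (dom \<beta>)"
        using monoD[OF mono] \<tau>(5) cu by (meson order_trans)
      moreover have "cut ?\<gamma> (dom ?R) (dom \<beta>) \<le> 2 * card {(v + cell 3 0, v + cell 3 0 + (0, 1)),
          (v + cell 3 (anchor e), v + cell 3 (anchor e) + (0, 1))}"
      proof (rule cut_le)
        fix p q assume "p \<in> dom ?R" "q \<in> dom \<beta>" "0 < bond ?\<gamma> p q"
        from snake_composite_bond[OF refl c d no this]
        show "(p, q) \<in> {(v + cell 3 0, v + cell 3 0 + (0, 1)),
          (v + cell 3 (anchor e), v + cell 3 (anchor e) + (0, 1))} \<and> bond ?\<gamma> p q \<le> 2" by auto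
      qed (simp_all add: fin)
      moreover have "card {(v + cell 3 0, v + cell 3 0 + (0, 1)),
          (v + cell 3 (anchor e), v + cell 3 (anchor e) + (0, 1))} \<le> 2"
        by (rule order_trans[OF card_insert_le_m1]) auto
      ultimately show False by linarith
    qed
  qed
next
  fix u \<alpha> \<beta>
  define v where "v = v0 + u"
  let ?R = "snake v e 0 e"
  show "\<not> can_break strength \<tau> (snake (v0 + u) e 0 e) \<alpha> \<beta>"
  proof
    assume "can_break strength \<tau> (snake (v0 + u) e 0 e) \<alpha> \<beta>"
    then have g: "?R = \<alpha> ++ \<beta>" and d: "dom \<alpha> \<inter> dom \<beta> = {}" and ne: "dom \<alpha> \<noteq> {}" "dom \<beta> \<noteq> {}"
      and cu: "cut ?R (dom \<alpha>) (dom \<beta>) < \<tau> (min (card (dom \<alpha>)) (card (dom \<beta>)))"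
      unfolding can_break_def v_def[symmetric] by blast+
    have dom: "dom ?R = dom \<alpha> \<union> dom \<beta>" unfolding g by auto
    have fin: "finite (dom \<alpha>)" "finite (dom \<beta>)"
      using finite_dom_track[of 3 "snake_tile e" v 0 e] unfolding dom by simp_all
    have "card (dom \<alpha>) + card (dom \<beta>) = nat (3 * j)"
      using card_Un_disjoint[OF fin d] card_dom_track[of 3 "snake_tile e" v 0 e] e(2) unfolding dom by simp
    then have "min (card (dom \<alpha>)) (card (dom \<beta>)) \<le> nat (3 * j div 2)" by linarith
    then have cu3: "cut ?R (dom \<alpha>) (dom \<beta>) < 3"
      using monoD[OF mono] \<tau>(4) cu by (meson le_trans less_le_trans)
    let ?P = "\<lambda>i. v + cell 3 i \<in> dom \<alpha>"
    \<comment> \<open>Without a crossing path bond all tiles would lie on one side and the other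
      part would be empty.\<close>
    have "\<exists>i. 0 \<le> i \<and> i < e \<and> ?P i \<noteq> ?P (i + 1)"
    proof (rule ccontr)
      assume "\<not> ?thesis"
      then have const: "?P i = ?P 0" if "0 \<le> i" "i \<le> e" for i
        using int_interval_const[of 0 e ?P i] that by blast
      obtain p q where pq: "p \<in> dom \<alpha>" "q \<in> dom \<beta>" using ne by blast
      then have "p \<in> dom ?R" "q \<in> dom ?R" "q \<notin> dom \<alpha>" using dom d by auto
      then obtain i i' where i: "i \<in> {0..e}" "p = v + cell 3 i" "i' \<in> {0..e}" "q = v + cell 3 i'" "q \<notin> dom \<alpha>"
        unfolding dom_track by blast
      then have "?P i = ?P 0" "?P i' = ?P 0" using const by simp_all
      then show False using pq(1) i(2,4,5) by metis
    qed
    then obtain i where i: "0 \<le> i" "i < e" "?P i \<noteq> ?P (i + 1)" by blast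
    have b: "bond ?R (v + cell 3 i) (v + cell 3 (i + 1)) = 3"
      using i by (intro linked_bond[OF linked_snake[of e]] track_cell) auto
    have "v + cell 3 i \<in> dom ?R" "v + cell 3 (i + 1) \<in> dom ?R" using i by (simp_all add: cell_in_dom_track)
    then consider "v + cell 3 i \<in> dom \<alpha>" "v + cell 3 (i + 1) \<in> dom \<beta>"
      | "v + cell 3 (i + 1) \<in> dom \<alpha>" "v + cell 3 i \<in> dom \<beta>"
      using i(3) unfolding dom by blast
    then show False
    proof cases
      case 1
      then show False using cut_ge_bond[OF fin 1, of ?R] b cu3 by simp
    next
      case 2
      then show False using cut_ge_bond[OF fin 2, of ?R] b cu3 by (simp add: bond_sym)
    qed
  qed
qed

section \<open>The rectangle and the choice of the temperature\<close>

lemma cell_image: "0 \<le> j \<Longrightarrow> cell 3 ` {0..3 * j - 1} = {0..j - 1} \<times> {-2..0}"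
proof (intro set_eqI iffI)
  fix p assume "p \<in> cell 3 ` {0..3 * j - 1}"
  then obtain i where i: "0 \<le> i" "i \<le> 3 * j - 1" "p = cell 3 i" by auto
  then have "0 \<le> i div 3" "i div 3 \<le> j - 1" by linarith+
  then show "p \<in> {0..j - 1} \<times> {-2..0}"
    using cell_row[of 3 i] i(3) by (cases p) (auto simp: cell_def)
next
  fix p assume p: "p \<in> {0..j - 1} \<times> {-2..0::int}"
  then have "cell 3 (cell_index 3 p) = p" by (intro cell_cell_index) auto
  moreover have "cell_index 3 p \<in> {0..3 * j - 1}" using p by (auto simp: cell_index_def)
  ultimately show "p \<in> cell 3 ` {0..3 * j - 1}" by (metis imageI)
qed

text \<open>The first threshold is the largest possible size of the smaller part when a snake of
  width k is split. The second is the size of the snake of width k - 1, the largest one that a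
  canopy has to capture.\<close>

definition temperature :: "nat \<Rightarrow> nat \<Rightarrow> nat" where
  "temperature k n = (if n \<le> 3 * k div 2 then 3 else if n \<le> 3 * k - 3 then 4 else 5)"

theorem theorem1:
  shows "\<exists>(T :: tile set) (str :: nat \<Rightarrow> nat). finite T \<and>
           (\<forall>k :: nat. 7 \<le> k \<longrightarrow>
              (\<exists>\<tau> :: nat \<Rightarrow> nat. mono \<tau> \<and>
                 (\<exists>x y. self_assembles str T \<tau> (rectangle x y k 3))))"
proof (rule exI[of _ tiles], rule exI[of _ strength], intro conjI finite_tiles allI impI)
  fix k :: nat assume k: "7 \<le> k"
  have mono: "mono (temperature k)" by (rule monoI) (auto simp: temperature_def)
  have \<tau>: "3 \<le> temperature k n" "temperature k n \<le> 5" "n \<le> 2 \<Longrightarrow> temperature k n \<le> 3" for n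
    using k by (auto simp: temperature_def)
  have \<tau>1: "temperature k 1 \<le> 3" using \<tau>(3) by simp
  define e where "e = 3 * int k - 1"
  have e: "valid_end e" "e + 1 = 3 * int k" using k by (auto simp: e_def valid_end_def) presburger
  have "terminal strength tiles (temperature k) (snake 0 e 0 e)"
  proof (rule exact_snake_terminal[OF e _ mono \<tau>])
    have "nat (3 * int k div 2) = 3 * k div 2" by linarith
    then show "temperature k (nat (3 * int k div 2)) \<le> 3" by (simp add: temperature_def)
    have "nat (3 * int k - 2) = 3 * k - 2" by linarith
    moreover have "\<not> 3 * k - 2 \<le> 3 * k div 2" "\<not> 3 * k - 2 \<le> 3 * k - 3" using k by linarith+
    ultimately show "5 \<le> temperature k (nat (3 * int k - 2))" by (simp add: temperature_def)
  qed (use k in auto)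
  moreover have "\<exists>v. dom (translate v \<gamma>) = rectangle (-1) (-1) k 3" if t: "terminal strength tiles (temperature k) \<gamma>" for \<gamma>
  proof -
    have "is_snake \<gamma> \<or> is_composite \<gamma>" by (rule producible_snake_or_composite[OF terminalD(1)[OF t] \<tau>])
    moreover have "\<not> is_composite \<gamma>" using composite_not_terminal[where \<tau> = "temperature k", OF _ \<tau>1] t unfolding is_composite_def by blast
    ultimately obtain v e' a b where R: "valid_end e'" "0 \<le> a" "a \<le> b" "b \<le> e'" "\<gamma> = snake v e' a b"
      unfolding is_snake_def by blast
    have ab: "a = 0" "b = e'" using terminal_snake_full[where \<tau> = "temperature k", OF R(1-4) \<tau>1] t R(5) by auto
    have t': "terminal strength tiles (temperature k) (snake v e' 0 e')" using t R(5) ab by simp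
    have "e' + 1 = 3 * ((e' + 1) div 3)" using R(1) unfolding valid_end_def by presburger
    then obtain j where j: "e' + 1 = 3 * j" by blast
    have j0: "0 < j" using R j by simp
    have "\<not> j < int k"
    proof
      assume "j < int k"
      then have "nat (3 * j) \<le> 3 * k - 3" by linarith
      then have "temperature k (nat (3 * j)) \<le> 4" by (simp add: temperature_def)
      then show False using short_snake_not_terminal[of e' j "temperature k" v] R(1) j \<tau>1 t' by blast
    qed
    moreover have "\<not> int k < j"
    proof
      assume "int k < j"
      \<comment> \<open>Already for width k + 1 the half, rounded down, exceeds that of width
        k.\<close>
      then have "3 * k div 2 < nat ((e' + 1) div 2)" unfolding j by linarith
      then have "3 < temperature k (nat ((e' + 1) div 2))" by (simp add: temperature_def)
      then show False using long_snake_not_terminal[OF R(1)] t' by blast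
    qed
    ultimately have jk: "j = int k" by simp
    have e'_eq: "e' = 3 * int k - 1" using j jk by simp
    \<comment> \<open>The path fills the rows -2 to 0 and the columns from 0 on. Raised by 2 it
      becomes the rectangle with both offsets equal to -1.\<close>
    define u where "u = (0, 2) - v"
    have "translate u \<gamma> = snake (0, 2) e' 0 e'" unfolding R(5) ab translate_track u_def by simp
    then have "dom (translate u \<gamma>) = (\<lambda>p. (0, 2) + p) ` (cell 3 ` {0..3 * int k - 1})"
      using j jk by (simp add: dom_track image_image e'_eq)
    also have "\<dots> = (\<lambda>p. (0, 2) + p) ` ({0..int k - 1} \<times> {-2..0})" by (simp add: cell_image)
    also have "\<dots> = rectangle (-1) (-1) k 3"
    proof (intro set_eqI iffI)
      fix p assume "p \<in> (\<lambda>p. (0, 2) + p) ` ({0..int k - 1} \<times> {-2..0::int})"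
      then show "p \<in> rectangle (-1) (-1) k 3" by (auto simp: rectangle_def)
    next
      fix p assume p: "p \<in> rectangle (-1) (-1) k 3"
      then have "p = (0, 2) + (fst p, snd p - 2)" "(fst p, snd p - 2) \<in> {0..int k - 1} \<times> {-2..0}"
        by (auto simp: rectangle_def)
      then show "p \<in> (\<lambda>p. (0, 2) + p) ` ({0..int k - 1} \<times> {-2..0})" by blast
    qed
    finally show ?thesis by blast
  qed
  ultimately have "self_assembles strength tiles (temperature k) (rectangle (-1) (-1) k 3)"
    unfolding self_assembles_def by blast
  then show "\<exists>\<tau> :: nat \<Rightarrow> nat. mono \<tau> \<and> (\<exists>x y. self_assembles strength tiles \<tau> (rectangle x y k 3))"
    using mono by blast
qed

end
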